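(* Consider two contact strata $\mathcal C_\beta$ and $\mathcal C_{\beta'}$ in $J_\infty G(2,4)$ (where $\beta,\beta'$ are plane partitions of size $2\times2$). Then $$\overline{\mathcal C}_\beta\supseteq\overline{\mathcal C}_{\beta'}\quad\Leftrightarrow\quad\beta\trianglelefteq\beta'.$$
   Context: Work over $\mathbb C$; below take $k=2$, $n=4$. $G(k,n)$: Grassmannian of $k$-dimensional subspaces of $\mathbb C^n$ (row spans of $k\times n$ matrices). $F_i\subset\mathbb C^n$: span of the last $i$ standard basis vectors. For $1\le a\le k$, $1\le b\le n-k$, $\Omega_{(b^a)}=\{V\mid\dim V\cap F_{n-k+a-b}\ge a\}$ (reduced), the Schubert variety of the rectangular partition with $a$ rows and $b$ columns. $J_\infty G(k,n)$ is the arc space; points with residue field $K$ are arcs $\operatorname{Spec}K[[t]]\to G(k,n)$. $\operatorname{ord}_\Lambda(Y)=e$ means the ideal of $Y$ pulls back to $(t^e)$ ($t^\infty=0$). Put $\alpha_{i,j}=\operatorname{ord}_\Lambda(\Omega_{(j^i)})$ for $1\le i\le k,1\le j\le n-k$ and $\alpha_{i,j}=0$ if $i>k$ or $j>n-k$. The invariant factor profile of $\Lambda$ is $\beta_{i,j}=\alpha_{i,j}-\alpha_{i+1,j+1}$ ($1\le i\le k,1\le j\le n-k$), with $\infty-x=\infty$. A plane partition is a $k\times(n-k)$ matrix with entries in $\{0,1,\ldots,\infty\}$ non-increasing along rows and columns. $\mathcal C_\beta\subset J_\infty G(k,n)$ is the set of arcs with invariant factor profile $\beta$ (non-empty and irreducible);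 $\overline{\mathcal C}_\beta$ is its Zariski closure. Network: $\Gamma_0$ is the directed graph with internal vertices $v_{i,j}$ ($1\le i\le k$, $1\le j\le n-k$), sources $1,\ldots,k$, sinks $1,\ldots,n-k$, and edges: source $i\to v_{i,n-k}$; $v_{i,j+1}\to v_{i,j}$; $v_{i,j}\to v_{i+1,j}$; $v_{k,j}\to$ sink $j$. A matrix $(w_{i,j})$ of size $k\times(n-k)$ gives an essential weighting $w$: $w_{i,j}$ is the weight of the edge $v_{i,j+1}\to v_{i,j}$ if $k-i<n-k-j$, of the edge $v_{i,j}\to v_{i+1,j}$ if $k-i>n-k-j$, and of the vertex $v_{i,j}$ if $k-i=n-k-j$; all other edges and vertices have weight $1$. The weight of a directed path is the product of the weights of its vertices and edges; $X(\Gamma_0,w)$ is the $k\times(n-k)$ matrix whose $(i,j)$ entry is the sum of the weights of all paths from source $i$ to sink $j$. $\Lambda(\Gamma_0,w)$ is the arc given by the $k\times n$ matrix $(X(\Gamma_0,w)\,|\,\Delta')$, with $\Delta'$ the $k\times k$ antidiagonal permutation matrix. The weight exponents of $\beta$ are $c_{i,j}=\beta_{i,j}$ if $k-i=n-k-j$; $c_{i,j}=\beta_{i,j}-\beta_{i,j+1}$ if $k-i<n-k-j$; $c_{i,j}=\beta_{i,j}-\beta_{i+1,j}$ if $k-i>n-k-j$ ($\infty-x=\infty$). Let $u_{i,j}=\sum_{p\ge0}u_{i,j}^{[p]}t^p$ with independent transcendentals $u_{i,j}^{[p]}$, and let $w(u,\beta)$ be the essential weighting with $w_{i,j}=t^{c_{i,j}}u_{i,j}$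 ($t^\infty=0$); $\Lambda(\Gamma_0,w(u,\beta))$ is the generic point of $\mathcal C_\beta$. For $1\le i_1<\dots<i_k\le n$, $\operatorname{ord}_\beta([i_1\ldots i_k])$ is the $t$-order of the $k\times k$ minor of $(X(\Gamma_0,w(u,\beta))|\Delta')$ with columns $i_1,\ldots,i_k$. The Plücker order: $\beta\trianglelefteq\beta'$ iff $\operatorname{ord}_\beta([i_1\ldots i_k])\le\operatorname{ord}_{\beta'}([i_1\ldots i_k])$ for all $1\le i_1<\dots<i_k\le n$. *)

theory Defs
  imports
    "HOL-Library.Poly_Mapping"
    "HOL-Library.Extended_Nat"
    "HOL-Computational_Algebra.Formal_Power_Series"
    "HOL-Computational_Algebra.Fraction_Field"
    "HOL-Algebra.Algebraic_Closure_Type"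
    "Jordan_Normal_Form.VS_Connect"
    "Jordan_Normal_Form.DL_Submatrix"
begin

section \<open>Polynomials and power series\<close>

text \<open>Polynomials over the complex numbers with variables indexed by the type \<open>'x\<close>.\<close>

type_synonym 'x cpoly = "('x \<Rightarrow>\<^sub>0 nat) \<Rightarrow>\<^sub>0 complex"

definition poly_const :: "complex \<Rightarrow> 'x cpoly" where
  "poly_const c = Poly_Mapping.single 0 c"

definition poly_var :: "'x \<Rightarrow> 'x cpoly" where
  "poly_var x = Poly_Mapping.single (Poly_Mapping.single x 1) 1"

text \<open>Evaluation at the point \<open>v\<close> of an algebra with structure map \<open>h\<close>.\<close>

definition poly_eval :: "(complex \<Rightarrow> 'r) \<Rightarrow> ('x \<Rightarrow> 'r) \<Rightarrow> 'x cpoly \<Rightarrow> 'r::comm_ring_1" where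
  "poly_eval h v f =
     (\<Sum>m\<in>Poly_Mapping.keys f. h (Poly_Mapping.lookup f m) *
        (\<Prod>x\<in>Poly_Mapping.keys m. v x ^ Poly_Mapping.lookup m x))"

definition fps_ord :: "'r::zero fps \<Rightarrow> enat" where
  "fps_ord f = (if f = 0 then \<infinity> else enat (subdegree f))"

definition t_pow :: "enat \<Rightarrow> 'r::comm_ring_1 fps" where
  "t_pow c = (case c of enat m \<Rightarrow> fps_X ^ m | \<infinity> \<Rightarrow> 0)"


section \<open>The universal domain\<close>

text \<open>
  \<open>univ_field\<close> is an algebraic closure of $\mathbb{C}(x_0, x_1, x_2, \ldots)$. The arc space
  of $G(k,n)$ is covered by spectra of countably generated $\mathbb{C}$-algebras, so the
  residue field of each of its points embeds over $\mathbb{C}$ into \<open>univ_field\<close>. Hence every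
  point of the arc space, closed or not, is given by an arc with coefficients in
  \<open>univ_field\<close>. The arc space is represented by these arcs: its topology is pulled back along
  the surjection from arcs over \<open>univ_field\<close> to points of the scheme, and contact strata are
  full preimages, so that inclusions between (closures of) strata are unaffected.
\<close>

type_synonym univ_field = "nat cpoly fract alg_closure"

definition scal :: "complex \<Rightarrow> univ_field" where
  "scal c = to_ac (Fract (poly_const c) 1)"


section \<open>Grassmannians and arcs\<close>

text \<open>
  Rows and columns of matrices of type \<open>mat\<close> are numbered from 0. All double-indexed families
  of type \<open>nat \<Rightarrow> nat \<Rightarrow> _\<close> below (plane partitions, weights, profiles) are numbered from 1.
\<close>

definition index_sets :: "nat \<Rightarrow> nat \<Rightarrow> nat set set" where
  "index_sets k n = {J. J \<subseteq> {0..<n} \<and> card J = k}"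

definition minor :: "nat set \<Rightarrow> 'r::comm_ring_1 mat \<Rightarrow> 'r" where
  "minor J A = det (submatrix A UNIV J)"

definition vec_span :: "nat \<Rightarrow> 'r::comm_ring_1 vec set \<Rightarrow> 'r vec set" where
  "vec_span n S = LinearCombinations.module.span class_ring (module_vec TYPE('r) n) S"

definition row_span :: "'r::comm_ring_1 mat \<Rightarrow> 'r vec set" where
  "row_span A = vec_span (dim_col A) (set (rows A))"

text \<open>
  For a local ring \<open>'r\<close> these are the \<open>'r\<close>-valued points of $G(k,n)$: over a field the
  \<open>k\<close>-dimensional subspaces, over \<open>K[[t]]\<close> the arcs $\operatorname{Spec} K[[t]] \to G(k,n)$.
\<close>

definition grassmannian :: "nat \<Rightarrow> nat \<Rightarrow> 'r::comm_ring_1 vec set set" where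
  "grassmannian k n = {row_span A | A. A \<in> carrier_mat k n \<and> (\<exists>J\<in>index_sets k n. minor J A dvd 1)}"

definition arcs :: "nat \<Rightarrow> nat \<Rightarrow> univ_field fps vec set set" where
  "arcs k n = grassmannian k n"

text \<open>
  The standard affine chart where the minor \<open>J\<close> is invertible: each of its points is the row span
  of exactly one of the following matrices, whose entries are the chart coordinates.
\<close>

definition chart :: "nat \<Rightarrow> nat \<Rightarrow> nat set \<Rightarrow> 'r::comm_ring_1 mat set" where
  "chart k n J = {B \<in> carrier_mat k n. submatrix B UNIV J = 1\<^sub>m k}"

text \<open>
  Coordinate functions of the charts and of their arc spaces. The variables range over all
  entries, including those of the identity block, which are constants; variables outside the
  matrix evaluate to 0. Neither changes the rings of functions obtained by evaluation.
\<close>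

definition entry :: "'r::zero mat \<Rightarrow> nat \<times> nat \<Rightarrow> 'r" where
  "entry B = (\<lambda>(i, j). if i < dim_row B \<and> j < dim_col B then B $$ (i, j) else 0)"

definition arc_coord :: "'r::zero fps mat \<Rightarrow> nat \<times> nat \<times> nat \<Rightarrow> 'r" where
  "arc_coord B = (\<lambda>(i, j, p). fps_nth (entry B (i, j)) p)"

text \<open>A subset of the arc space is closed iff it is closed in the arc space of each chart.\<close>

definition zariski_closed :: "nat \<Rightarrow> nat \<Rightarrow> univ_field fps vec set set \<Rightarrow> bool" where
  "zariski_closed k n Z \<longleftrightarrow> Z \<subseteq> arcs k n \<and>
     (\<forall>J\<in>index_sets k n. \<exists>S :: (nat \<times> nat \<times> nat) cpoly set.
        \<forall>B\<in>chart k n J. row_span B \<in> Z \<longleftrightarrow> (\<forall>f\<in>S. poly_eval scal (arc_coord B) f = 0))"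

definition zariski_closure ::
    "nat \<Rightarrow> nat \<Rightarrow> univ_field fps vec set set \<Rightarrow> univ_field fps vec set set" where
  "zariski_closure k n C = \<Inter>{Z. zariski_closed k n Z \<and> C \<subseteq> Z}"


section \<open>Schubert varieties and contact strata\<close>

definition flag :: "nat \<Rightarrow> nat \<Rightarrow> complex vec set" where
  "flag n i = vec_span n (unit_vec n ` {n - i..<n})"

definition subspace_dim :: "nat \<Rightarrow> complex vec set \<Rightarrow> nat" where
  "subspace_dim n W = vectorspace.dim class_ring ((module_vec TYPE(complex) n)\<lparr>carrier := W\<rparr>)"

text \<open>The complex points of the Schubert variety of the partition with \<open>a\<close> rows and \<open>b\<close> columns.\<close>

definition schubert :: "nat \<Rightarrow> nat \<Rightarrow> nat \<Rightarrow> nat \<Rightarrow> complex vec set set" where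
  "schubert k n a b = {V \<in> grassmannian k n. subspace_dim n (V \<inter> flag n (n - k + a - b)) \<ge> a}"

text \<open>The ideal, in the chart \<open>J\<close>, of the subset \<open>Y\<close> of $G(k,n)$ with its reduced structure.\<close>

definition chart_ideal ::
    "nat \<Rightarrow> nat \<Rightarrow> nat set \<Rightarrow> complex vec set set \<Rightarrow> (nat \<times> nat) cpoly set" where
  "chart_ideal k n J Y =
     {f. \<forall>B\<in>chart k n J. row_span B \<in> Y \<longrightarrow> poly_eval (\<lambda>c. c) (entry B) f = 0}"

text \<open>
  The exponent \<open>e\<close> such that the ideal of \<open>Y\<close> pulls back to $(t^e)$. It can be computed in any chart
  containing the arc; the infimum runs over all of them.
\<close>

definition contact_order ::
    "nat \<Rightarrow> nat \<Rightarrow> univ_field fps vec set \<Rightarrow> complex vec set set \<Rightarrow> enat" where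
  "contact_order k n L Y =
     Inf {fps_ord (poly_eval (\<lambda>c. fps_const (scal c)) (entry B) f) | J B f.
            J \<in> index_sets k n \<and> B \<in> chart k n J \<and> row_span B = L \<and> f \<in> chart_ideal k n J Y}"

definition schubert_order ::
    "nat \<Rightarrow> nat \<Rightarrow> univ_field fps vec set \<Rightarrow> nat \<Rightarrow> nat \<Rightarrow> enat" where
  "schubert_order k n L i j =
     (if i \<in> {1..k} \<and> j \<in> {1..n - k} then contact_order k n L (schubert k n i j) else 0)"

text \<open>Subtraction on \<open>enat\<close> satisfies \<open>\<infinity> - x = \<infinity>\<close> for all \<open>x\<close>.\<close>

definition profile :: "nat \<Rightarrow> nat \<Rightarrow> univ_field fps vec set \<Rightarrow> nat \<Rightarrow> nat \<Rightarrow> enat" where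
  "profile k n L i j = schubert_order k n L i j - schubert_order k n L (i + 1) (j + 1)"

definition contact_stratum ::
    "nat \<Rightarrow> nat \<Rightarrow> (nat \<Rightarrow> nat \<Rightarrow> enat) \<Rightarrow> univ_field fps vec set set" where
  "contact_stratum k n \<beta> =
     {L \<in> arcs k n. \<forall>i\<in>{1..k}. \<forall>j\<in>{1..n - k}. profile k n L i j = \<beta> i j}"

text \<open>Only the entries with indices in \<open>{1..r} \<times> {1..s}\<close> matter.\<close>

definition plane_partition :: "nat \<Rightarrow> nat \<Rightarrow> (nat \<Rightarrow> nat \<Rightarrow> enat) \<Rightarrow> bool" where
  "plane_partition r s \<beta> \<longleftrightarrow>
     (\<forall>i\<in>{1..r}. \<forall>j\<in>{1..s}.
        (j < s \<longrightarrow> \<beta> i (j + 1) \<le> \<beta> i j) \<and> (i < r \<longrightarrow> \<beta> (i + 1) j \<le> \<beta> i j))"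


section \<open>The planar network and the Pluecker order\<close>

datatype vertex = Source nat | Inner nat nat | Sink nat

definition network_edges :: "nat \<Rightarrow> nat \<Rightarrow> (vertex \<times> vertex) set" where
  "network_edges k n =
     {(Source i, Inner i (n - k)) | i. i \<in> {1..k}} \<union>
     {(Inner i (j + 1), Inner i j) | i j. i \<in> {1..k} \<and> 1 \<le> j \<and> j < n - k} \<union>
     {(Inner i j, Inner (i + 1) j) | i j. 1 \<le> i \<and> i < k \<and> j \<in> {1..n - k}} \<union>
     {(Inner k j, Sink j) | j. j \<in> {1..n - k}}"

definition network_paths :: "nat \<Rightarrow> nat \<Rightarrow> vertex \<Rightarrow> vertex \<Rightarrow> vertex list set" where
  "network_paths k n x y =
     {p. p \<noteq> [] \<and> hd p = x \<and> last p = y \<and> successively (\<lambda>u v. (u, v) \<in> network_edges k n) p}"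

text \<open>
  The essential weighting. The conditions of the form $k - i < n - k - j$ are written
  without subtraction of \<open>i\<close> and \<open>j\<close>, to avoid truncation.
\<close>

definition vertex_weight ::
    "nat \<Rightarrow> nat \<Rightarrow> (nat \<Rightarrow> nat \<Rightarrow> 'r::comm_ring_1) \<Rightarrow> vertex \<Rightarrow> 'r" where
  "vertex_weight k n w x =
     (case x of Inner i j \<Rightarrow> if k + j = n - k + i then w i j else 1 | _ \<Rightarrow> 1)"

definition edge_weight ::
    "nat \<Rightarrow> nat \<Rightarrow> (nat \<Rightarrow> nat \<Rightarrow> 'r::comm_ring_1) \<Rightarrow> vertex \<times> vertex \<Rightarrow> 'r" where
  "edge_weight k n w e =
     (case e of
        (Inner i j, Inner i' j') \<Rightarrow>
          if i' = i \<and> j = j' + 1 \<and> k + j' < n - k + i then w i j'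
          else if i' = i + 1 \<and> j' = j \<and> k + j > n - k + i then w i j
          else 1
      | _ \<Rightarrow> 1)"

definition path_weight ::
    "nat \<Rightarrow> nat \<Rightarrow> (nat \<Rightarrow> nat \<Rightarrow> 'r::comm_ring_1) \<Rightarrow> vertex list \<Rightarrow> 'r" where
  "path_weight k n w p =
     prod_list (map (vertex_weight k n w) p) * prod_list (map (edge_weight k n w) (zip p (tl p)))"

text \<open>The entries of $X(\Gamma_0, w)$ and the matrix $(X(\Gamma_0, w) \mid \Delta')$.\<close>

definition network_entry ::
    "nat \<Rightarrow> nat \<Rightarrow> (nat \<Rightarrow> nat \<Rightarrow> 'r::comm_ring_1) \<Rightarrow> nat \<Rightarrow> nat \<Rightarrow> 'r" where
  "network_entry k n w i j = (\<Sum>p\<in>network_paths k n (Source i) (Sink j). path_weight k n w p)"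

definition network_matrix ::
    "nat \<Rightarrow> nat \<Rightarrow> (nat \<Rightarrow> nat \<Rightarrow> 'r::comm_ring_1) \<Rightarrow> 'r mat" where
  "network_matrix k n w =
     mat k n (\<lambda>(i, j). if j < n - k then network_entry k n w (i + 1) (j + 1)
                      else if i + (j - (n - k)) = k - 1 then 1 else 0)"

definition weight_exponent :: "nat \<Rightarrow> nat \<Rightarrow> (nat \<Rightarrow> nat \<Rightarrow> enat) \<Rightarrow> nat \<Rightarrow> nat \<Rightarrow> enat" where
  "weight_exponent k n \<beta> i j =
     (if k + j = n - k + i then \<beta> i j
      else if k + j < n - k + i then \<beta> i j - \<beta> i (j + 1)
      else \<beta> i j - \<beta> (i + 1) j)"

text \<open>The independent transcendentals $u_{i,j}^{[p]}$ are the variables \<open>(i, j, p)\<close>.\<close>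

definition generic_series :: "nat \<Rightarrow> nat \<Rightarrow> (nat \<times> nat \<times> nat) cpoly fps" where
  "generic_series i j = Abs_fps (\<lambda>p. poly_var (i, j, p))"

definition generic_weighting ::
    "nat \<Rightarrow> nat \<Rightarrow> (nat \<Rightarrow> nat \<Rightarrow> enat) \<Rightarrow> nat \<Rightarrow> nat \<Rightarrow> (nat \<times> nat \<times> nat) cpoly fps" where
  "generic_weighting k n \<beta> i j = t_pow (weight_exponent k n \<beta> i j) * generic_series i j"

definition generic_minor_order ::
    "nat \<Rightarrow> nat \<Rightarrow> (nat \<Rightarrow> nat \<Rightarrow> enat) \<Rightarrow> nat set \<Rightarrow> enat" where
  "generic_minor_order k n \<beta> J = fps_ord (minor J (network_matrix k n (generic_weighting k n \<beta>)))"

definition pluecker_le ::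
    "nat \<Rightarrow> nat \<Rightarrow> (nat \<Rightarrow> nat \<Rightarrow> enat) \<Rightarrow> (nat \<Rightarrow> nat \<Rightarrow> enat) \<Rightarrow> bool" where
  "pluecker_le k n \<beta> \<beta>' \<longleftrightarrow>
     (\<forall>J\<in>index_sets k n. generic_minor_order k n \<beta> J \<le> generic_minor_order k n \<beta>' J)"

end

theory Submission
  imports Defs
begin

text \<open>
  An arc in G(2,4) is the row span of a $2 \times 4$ matrix over $K[[t]]$ with a unit minor, and the
  $t$-orders of its six minors $p_{ij}$ (columns are numbered from 0) depend on the arc only. The
  theorem rests on a description of closures by these orders, \<open>zariski_closure_contact_stratum\<close>:
  the closure of the stratum of \<open>\<beta>\<close> consists of all arcs with \<open>ord p_J \<ge> generic_order \<beta> J\<close> for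
  every \<open>J\<close>, where \<open>generic_order \<beta> J\<close> is the order of $p_J$ at the generic point of the stratum.
  One arc of the stratum attains all these bounds at once (\<open>ex_generic_arc\<close>), so closures are
  included in each other exactly when the generic orders compare, which is the Pluecker order
  (\<open>generic_minor_order_eq\<close>).

  The strata are defined through contact orders with Schubert varieties. In every affine chart the
  reduced ideal of a rectangular Schubert variety is generated by the Pluecker coordinates that
  vanish on it, so a contact order is a minimum of orders of minors (\<open>contact_order_schubert\<close>).
  The stratum then satisfies the bounds above. Only the one for $p_{02}$ needs an argument, and it
  comes from the Pluecker relation $p_{02} p_{13} = p_{01} p_{23} + p_{03} p_{12}$. Since the bounds
  are closed conditions, they hold on the closure.

  Conversely, let \<open>Z\<close> be closed and contain the stratum. If an affine family \<open>F \<rho>\<close> of arcs in a chart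
  lies in \<open>Z\<close> for all but finitely many \<open>\<rho>\<close>, then so does \<open>F 0\<close>, because a polynomial in \<open>\<rho>\<close> with
  infinitely many zeros vanishes. It remains to join each arc that satisfies the bounds to the
  stratum by such families. Adding multiples of a column to a later one preserves the flag and moves
  the arc into the big cell $p_{23} \neq 0$, whose points are $2 \times 2$ matrices. Write $a$, $b$,
  $c$, $d$ for \<open>\<beta> 2 2\<close>, \<open>\<beta> 1 2\<close>, \<open>\<beta> 2 1\<close>, \<open>\<beta> 1 1\<close>. If $a + d \le b + c$, the bounds on the
  entries imply the bound on the determinant, so they define a linear space and a generic
  perturbation of the entries suffices. Otherwise the bounds on the entries are $b + c - a$, $b$, $c$
  and $a$; dividing each entry by the corresponding power of $t$ leaves an arbitrary matrix whose determinant has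
  order at least $f = a + d - b - c$, and such a matrix can be deformed into one with unit entries and
  determinant of order exactly $f$ (\<open>determinantal_locus_deformation\<close>).
\<close>

section \<open>Evaluation of polynomials\<close>

definition monomial_value :: "('x \<Rightarrow> 'r) \<Rightarrow> ('x \<Rightarrow>\<^sub>0 nat) \<Rightarrow> 'r::comm_ring_1" where
  "monomial_value v m = (\<Prod>x\<in>Poly_Mapping.keys m. v x ^ Poly_Mapping.lookup m x)"

lemma monomial_value_superset:
  assumes "finite A" "Poly_Mapping.keys m \<subseteq> A"
  shows "monomial_value v m = (\<Prod>x\<in>A. v x ^ Poly_Mapping.lookup m x)"
  unfolding monomial_value_def
  by (rule prod.mono_neutral_left) (use assms in \<open>auto simp: in_keys_iff\<close>)

lemma monomial_value_zero [simp]: "monomial_value v 0 = 1"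
  by (simp add: monomial_value_def)

lemma monomial_value_single [simp]: "monomial_value v (Poly_Mapping.single x n) = v x ^ n"
  by (simp add: monomial_value_def)

lemma monomial_value_add: "monomial_value v (m + n) = monomial_value v m * monomial_value v n"
proof -
  let ?A = "Poly_Mapping.keys m \<union> Poly_Mapping.keys n"
  have "Poly_Mapping.keys (m + n) \<subseteq> ?A" by (rule Poly_Mapping.keys_add)
  then show ?thesis
    by (simp add: monomial_value_superset[of ?A] lookup_add power_add prod.distrib)
qed

lemma poly_eval_superset:
  assumes "comm_ring_hom h" "finite A" "Poly_Mapping.keys f \<subseteq> A"
  shows "poly_eval h v f = (\<Sum>m\<in>A. h (Poly_Mapping.lookup f m) * monomial_value v m)"
proof -
  interpret comm_ring_hom h by fact
  show ?thesis
    unfolding poly_eval_def monomial_value_def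
    by (rule sum.mono_neutral_left) (use assms in \<open>auto simp: in_keys_iff\<close>)
qed

lemma poly_eval_monomial_value:
  "poly_eval h v f = (\<Sum>m\<in>Poly_Mapping.keys f. h (Poly_Mapping.lookup f m) * monomial_value v m)"
  by (simp add: poly_eval_def monomial_value_def)

lemma poly_eval_add:
  assumes "comm_ring_hom h"
  shows "poly_eval h v (f + g) = poly_eval h v f + poly_eval h v g"
proof -
  interpret comm_ring_hom h by fact
  let ?A = "Poly_Mapping.keys f \<union> Poly_Mapping.keys g"
  have "Poly_Mapping.keys (f + g) \<subseteq> ?A" by (rule Poly_Mapping.keys_add)
  then show ?thesis
    by (simp add: poly_eval_superset[OF assms, of ?A] lookup_add hom_add ring_distribs sum.distrib)
qed

lemma poly_eval_zero [simp]: "poly_eval h v 0 = 0"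
  by (simp add: poly_eval_def)

lemma poly_eval_sum:
  assumes "comm_ring_hom h"
  shows "poly_eval h v (sum F I) = (\<Sum>i\<in>I. poly_eval h v (F i))"
  by (induction I rule: infinite_finite_induct) (simp_all add: poly_eval_add[OF assms])

lemma poly_eval_single:
  assumes "comm_ring_hom h"
  shows "poly_eval h v (Poly_Mapping.single m c) = h c * monomial_value v m"
proof -
  interpret comm_ring_hom h by fact
  show ?thesis by (simp add: poly_eval_superset[OF assms, of "{m}"])
qed

lemma poly_mapping_eq_sum_single:
  "f = (\<Sum>m\<in>Poly_Mapping.keys f. Poly_Mapping.single m (Poly_Mapping.lookup f m))"
  by (rule poly_mapping_eqI)
    (auto simp: lookup_sum lookup_single when_def in_keys_iff sum.delta)

lemma poly_eval_mult:
  assumes "comm_ring_hom h"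
  shows "poly_eval h v (f * g) = poly_eval h v f * poly_eval h v g"
proof -
  interpret comm_ring_hom h by fact
  have "poly_eval h v (f * g) =
    poly_eval h v ((\<Sum>m\<in>Poly_Mapping.keys f. Poly_Mapping.single m (Poly_Mapping.lookup f m)) *
      (\<Sum>m\<in>Poly_Mapping.keys g. Poly_Mapping.single m (Poly_Mapping.lookup g m)))"
    using poly_mapping_eq_sum_single[of f] poly_mapping_eq_sum_single[of g] by simp
  also have "\<dots> = poly_eval h v f * poly_eval h v g"
    by (simp add: sum_product mult_single poly_eval_sum[OF assms] poly_eval_single[OF assms]
        monomial_value_add poly_eval_monomial_value[of h v] hom_mult mult.assoc mult.left_commute)
  finally show ?thesis .
qed

lemma poly_eval_const:
  assumes "comm_ring_hom h"
  shows "poly_eval h v (poly_const c) = h c"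
  by (simp add: poly_const_def poly_eval_single[OF assms])

lemma poly_eval_var:
  assumes "comm_ring_hom h"
  shows "poly_eval h v (poly_var x) = v x"
proof -
  interpret comm_ring_hom h by fact
  show ?thesis by (simp add: poly_var_def poly_eval_single[OF assms])
qed

lemma poly_eval_diff:
  assumes "comm_ring_hom h"
  shows "poly_eval h v (f - g) = poly_eval h v f - poly_eval h v g"
  using poly_eval_add[OF assms, of v "f - g" g] by simp

lemmas poly_eval_hom = poly_eval_add poly_eval_diff poly_eval_mult poly_eval_sum poly_eval_const
  poly_eval_var

text \<open>
  With \<open>g\<close> the evaluation of polynomials in one variable at a parameter, this shows that a polynomial
  condition on a point that moves polynomially is polynomial in the parameter.
\<close>

lemma hom_poly_eval:
  assumes "comm_ring_hom g"
  shows "g (poly_eval h v f) = poly_eval (\<lambda>c. g (h c)) (\<lambda>x. g (v x)) f"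
proof -
  interpret comm_ring_hom g by fact
  show ?thesis by (simp add: poly_eval_def hom_sum hom_prod hom_mult hom_power)
qed

lemma comm_ring_hom_id: "comm_ring_hom (\<lambda>c. c)"
  by unfold_locales auto

lemma comm_ring_hom_scal: "comm_ring_hom scal"
proof
  show "scal 0 = 0" "scal 1 = 1"
    by (simp_all add: scal_def poly_const_def Zero_fract_def[symmetric] One_fract_def[symmetric])
  show "scal (x + y) = scal x + scal y" for x y
    by (simp add: scal_def poly_const_def single_add flip: to_ac_add)
  show "scal (x * y) = scal x * scal y" for x y
    by (simp add: scal_def poly_const_def mult_single flip: to_ac_mult)
qed

lemma comm_ring_hom_fps_const: "comm_ring_hom (fps_const :: 'r::comm_ring_1 \<Rightarrow> _)"
  by unfold_locales (auto simp flip: fps_const_1_eq_1)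

lemma comm_ring_hom_poly: "comm_ring_hom (\<lambda>p :: 'r::comm_ring_1 poly. poly p x)"
  by unfold_locales auto

lemma comm_ring_hom_comp: "comm_ring_hom g \<Longrightarrow> comm_ring_hom h \<Longrightarrow> comm_ring_hom (\<lambda>c. g (h c))"
proof -
  assume "comm_ring_hom g" "comm_ring_hom h"
  then interpret g: comm_ring_hom g + h: comm_ring_hom h .
  show ?thesis
    by unfold_locales (simp_all add: g.hom_add g.hom_mult h.hom_add h.hom_mult)
qed

lemma inj_scal: "inj scal"
proof (rule injI)
  fix x y assume "scal x = scal y"
  then have "Poly_Mapping.lookup (Poly_Mapping.single (0 :: nat \<Rightarrow>\<^sub>0 nat) x) 0 = Poly_Mapping.lookup (Poly_Mapping.single (0 :: nat \<Rightarrow>\<^sub>0 nat) y) 0"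
    by (simp add: scal_def poly_const_def eq_fract(1))
  then show "x = y" by simp
qed

lemma infinite_univ_field: "infinite (UNIV :: univ_field set)"
proof
  assume "finite (UNIV :: univ_field set)"
  then have "finite (range scal)" by (rule finite_subset[rotated]) simp
  then have "finite (UNIV :: complex set)" using inj_scal finite_imageD by blast
  then show False using infinite_UNIV_char_0 by blast
qed


section \<open>Two-by-four matrices\<close>

lemma index_sets_2_4:
  "index_sets 2 4 = {{0,1},{0,2},{0,3},{1,2},{1,3},{2,3}}"
proof
  show "index_sets 2 4 \<subseteq> {{0,1},{0,2},{0,3},{1,2},{1,3},{2,3}}"
  proof
    fix J :: "nat set" assume "J \<in> index_sets 2 4"
    then have J: "J \<subseteq> {0,1,2,3}" "card J = 2" by (auto simp: index_sets_def)
    then obtain i j where ij: "J = {i, j}" "i \<noteq> j" by (auto simp: card_2_iff)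
    then have "i \<in> {0,1,2,3}" "j \<in> {0,1,2,3}" using J by auto
    with ij show "J \<in> {{0,1},{0,2},{0,3},{1,2},{1,3},{2,3}}"
      by (elim insertE emptyE) (simp_all add: doubleton_eq_iff)
  qed
qed (auto simp: index_sets_def)

lemma index_sets_2_4E:
  assumes "J \<in> index_sets 2 4"
  obtains i j where "J = {i, j}" "i < j" "j < 4"
  using assms unfolding index_sets_2_4 by force

lemma pick_pair:
  assumes "i < j"
  shows "pick {i, j} 0 = i" "pick {i, j} (Suc 0) = j"
proof -
  show 0: "pick {i, j} 0 = i" using assms by (auto intro: Least_equality)
  show "pick {i, j} (Suc 0) = j" using assms 0 by (auto intro!: Least_equality)
qed

lemma submatrix_pair:
  assumes "A \<in> carrier_mat 2 4" "i < j" "j < 4"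
  shows "submatrix A UNIV {i, j} = mat 2 2 (\<lambda>(k, l). A $$ (k, if l = 0 then i else j))"
proof -
  have "{k. k < (4::nat) \<and> (k = i \<or> k = j)} = {i, j}" using assms by auto
  then have c: "card {k. k < (4::nat) \<and> (k = i \<or> k = j)} = 2" using assms by simp
  have "pick {i, j} l = (if l = 0 then i else j)" if "l < 2" for l
    using that pick_pair[OF assms(2)] by (cases l) (auto simp del: pick.simps)
  with assms(1) show ?thesis
    unfolding submatrix_def by (intro eq_matI) (simp_all add: c pick_UNIV del: pick.simps)
qed

lemma det_2:
  assumes "A \<in> carrier_mat 2 2"
  shows "det A = A $$ (0, 0) * A $$ (1, 1) - A $$ (0, 1) * A $$ (1, 0)"
  using assms laplace_expansion_column[OF assms, of 0]
  by (simp add: numeral_2_eq_2 cofactor_def det_single mat_delete_def)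

lemma minor_pair:
  assumes "A \<in> carrier_mat 2 4" "i < j" "j < 4"
  shows "minor {i, j} A = A $$ (0, i) * A $$ (1, j) - A $$ (0, j) * A $$ (1, i)"
  unfolding minor_def submatrix_pair[OF assms]
  by (subst det_2) auto

definition row_comb :: "'r::comm_ring_1 mat \<Rightarrow> 'r \<Rightarrow> 'r \<Rightarrow> 'r vec" where
  "row_comb A x y = vec 4 (\<lambda>k. x * A $$ (0, k) + y * A $$ (1, k))"

lemma row_span_eq:
  fixes A :: "'r::idom mat"
  assumes A: "A \<in> carrier_mat 2 4"
  shows "row_span A = {row_comb A x y | x y. True}"
proof -
  interpret idom_vec where n = 4 and f_ty = "TYPE('r)" .
  have rows: "rows A = [row A 0, row A 1]"
    using A by (intro nth_equalityI) (auto simp: less_2_cases_iff)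
  have r: "row A 0 \<in> carrier_vec 4" "row A 1 \<in> carrier_vec 4" using A row_carrier[of A 0] row_carrier[of A 1] by simp_all
  have s: "row_span A = span {row A 0, row A 1}"
    using A by (simp add: row_span_def vec_span_def rows)
  have lc: "lincomb_list c [row A 0, row A 1] = row_comb A (c 0) (c 1)" for c
    using A r by (intro eq_vecI) (auto simp: lincomb_list_def row_comb_def)
  have "span {row A 0, row A 1} = span_list [row A 0, row A 1]"
    using r by (subst span_list_as_span) auto
  also have "\<dots> = {row_comb A x y | x y. True}"
    unfolding span_list_def lc
    by (auto intro: exI[of _ "\<lambda>i. if i = 0 then _ else _"])
  finally show ?thesis using s by simp
qed

lemma row_comb_carrier [simp]: "row_comb A x y \<in> carrier_vec 4" "dim_vec (row_comb A x y) = 4"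
  by (simp_all add: row_comb_def)

lemma row_comb_index [simp]: "k < 4 \<Longrightarrow> row_comb A x y $ k = x * A $$ (0, k) + y * A $$ (1, k)"
  by (simp add: row_comb_def)

lemma row_comb_eq_iff:
  "row_comb A x y = v \<longleftrightarrow> v \<in> carrier_vec 4 \<and> (\<forall>k<4. x * A $$ (0, k) + y * A $$ (1, k) = v $ k)"
  by (auto simp: row_comb_def vec_eq_iff intro!: carrier_vecI)

text \<open>
  The factor \<open>u\<close> is the determinant of the matrix that expresses the rows of \<open>B\<close> through those of
  \<open>A\<close>.
\<close>

lemma minor_eq_if_row_span_subset:
  fixes A B :: "'r::idom mat"
  assumes A: "A \<in> carrier_mat 2 4" and B: "B \<in> carrier_mat 2 4"
    and sub: "row_span B \<subseteq> row_span A"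
  obtains u where "\<And>J. J \<in> index_sets 2 4 \<Longrightarrow> minor J B = u * minor J A"
proof -
  have "row_comb B 1 0 \<in> row_span A" "row_comb B 0 1 \<in> row_span A"
    using sub unfolding row_span_eq[OF B] by blast+
  then obtain p q r s where "row_comb B 1 0 = row_comb A p q" "row_comb B 0 1 = row_comb A r s"
    unfolding row_span_eq[OF A] by blast
  then have e: "B $$ (0, k) = p * A $$ (0, k) + q * A $$ (1, k)"
    "B $$ (1, k) = r * A $$ (0, k) + s * A $$ (1, k)" if "k < 4" for k
    using that by (auto simp: row_comb_eq_iff)
  show ?thesis
  proof (rule that[of "p * s - q * r"])
    fix J assume "J \<in> index_sets 2 4"
    then obtain i j where J: "J = {i, j}" "i < j" "j < 4" by (rule index_sets_2_4E)
    then have "i < 4" by simp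
    then show "minor J B = (p * s - q * r) * minor J A"
      using J by (simp add: minor_pair[OF A] minor_pair[OF B] e algebra_simps del: One_nat_def)
  qed
qed

lemma chart_pair_iff:
  assumes "i < j" "j < 4"
  shows "B \<in> chart 2 4 {i, j} \<longleftrightarrow> B \<in> carrier_mat 2 4 \<and>
    B $$ (0, i) = 1 \<and> B $$ (0, j) = 0 \<and> B $$ (1, i) = 0 \<and> B $$ (1, j) = 1"
proof (cases "B \<in> carrier_mat 2 4")
  case True
  show ?thesis
    using True by (auto simp: chart_def submatrix_pair[OF True assms] mat_eq_iff less_2_cases_iff)
qed (simp add: chart_def)

lemma chart_carrier: "B \<in> chart 2 4 J \<Longrightarrow> B \<in> carrier_mat 2 4"
  by (simp add: chart_def)

lemma minor_chart:
  assumes "B \<in> chart 2 4 J" "J \<in> index_sets 2 4"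
  shows "minor J B = 1"
  using assms by (simp add: minor_def chart_def)

lemma ex_chart_representative:
  fixes A :: "'r::idom mat"
  assumes A: "A \<in> carrier_mat 2 4" and J: "J \<in> index_sets 2 4" and unit: "minor J A dvd 1"
  obtains B where "B \<in> chart 2 4 J" "row_span B = row_span A"
proof -
  from J obtain i j where ij: "J = {i, j}" "i < j" "j < 4" by (rule index_sets_2_4E)
  then have i: "i < 4" by simp
  from unit obtain e where e: "(A $$ (0, i) * A $$ (1, j) - A $$ (0, j) * A $$ (1, i)) * e = 1"
    unfolding ij(1) minor_pair[OF A ij(2,3)] by (metis dvdE)
  \<comment> \<open>left multiplication of \<open>A\<close> by the inverse of its submatrix \<open>J\<close>, by Cramer's rule\<close>
  define B where "B = mat 2 4 (\<lambda>(k, l). if k = 0 then e * (A $$ (1, j) * A $$ (0, l) - A $$ (0, j) * A $$ (1, l))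
      else e * (A $$ (0, i) * A $$ (1, l) - A $$ (1, i) * A $$ (0, l)))"
  have B: "B \<in> carrier_mat 2 4" by (simp add: B_def)
  have "B \<in> chart 2 4 {i, j}"
    unfolding chart_pair_iff[OF ij(2,3)]
    using e i ij by (auto simp: B_def algebra_simps)
  moreover have "row_span B = row_span A"
  proof
    have "row_comb B x y = row_comb A (e * (x * A $$ (1, j) - y * A $$ (1, i))) (e * (y * A $$ (0, i) - x * A $$ (0, j)))" for x y
      by (simp add: row_comb_eq_iff B_def algebra_simps)
    then show "row_span B \<subseteq> row_span A" unfolding row_span_eq[OF A] row_span_eq[OF B] by blast
    have "row_comb A x y = row_comb B (x * A $$ (0, i) + y * A $$ (1, i)) (x * A $$ (0, j) + y * A $$ (1, j))" for x y
      unfolding row_comb_eq_iff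
    proof (safe; (rule row_comb_carrier)?)
      fix k :: nat assume k: "k < 4"
      show "x * A $$ (0, k) + y * A $$ (1, k) = row_comb B (x * A $$ (0, i) + y * A $$ (1, i)) (x * A $$ (0, j) + y * A $$ (1, j)) $ k"
      proof -
        have "row_comb B (x * A $$ (0, i) + y * A $$ (1, i)) (x * A $$ (0, j) + y * A $$ (1, j)) $ k
          = ((A $$ (0, i) * A $$ (1, j) - A $$ (0, j) * A $$ (1, i)) * e) * (x * A $$ (0, k) + y * A $$ (1, k))"
          using k by (simp add: B_def algebra_simps)
        then show ?thesis by (simp only: e mult_1_left)
      qed
    qed
    then show "row_span A \<subseteq> row_span B" unfolding row_span_eq[OF A] row_span_eq[OF B] by blast
  qed
  ultimately show ?thesis using that ij by blast
qed


section \<open>Orders of power series\<close>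

lemma fps_ord_ge_iff: "n \<le> fps_ord f \<longleftrightarrow> (\<forall>p. enat p < n \<longrightarrow> fps_nth f p = 0)"
proof (cases "f = 0")
  case False
  have "enat p < n \<Longrightarrow> n \<le> enat (subdegree f) \<Longrightarrow> fps_nth f p = 0" for p
    using order.strict_trans2 by (fastforce intro: nth_less_subdegree_zero)
  moreover have "n \<le> enat (subdegree f)" if "\<forall>p. enat p < n \<longrightarrow> fps_nth f p = 0"
    using that False nth_subdegree_nonzero[of f] not_le by blast
  ultimately show ?thesis using False by (auto simp: fps_ord_def)
qed (simp add: fps_ord_def)

lemma fps_ord_0 [simp]: "fps_ord 0 = \<infinity>"
  by (simp add: fps_ord_def)

lemma fps_ord_1 [simp]: "fps_ord (1 :: 'k::zero_neq_one fps) = 0"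
  by (simp add: fps_ord_def zero_enat_def)

lemma fps_ord_eq_infinity_iff [simp]: "fps_ord f = \<infinity> \<longleftrightarrow> f = 0"
  by (simp add: fps_ord_def)

lemma fps_ord_mult [simp]: "fps_ord (f * g :: 'k::idom fps) = fps_ord f + fps_ord g"
  by (simp add: fps_ord_def)

lemma fps_ord_uminus [simp]: "fps_ord (- f :: 'k::ring_1 fps) = fps_ord f"
  by (simp add: fps_ord_def)

lemma fps_ord_add_ge: "n \<le> fps_ord f \<Longrightarrow> n \<le> fps_ord g \<Longrightarrow> n \<le> fps_ord (f + g :: 'k::ring_1 fps)"
  by (simp add: fps_ord_ge_iff)

lemma fps_ord_diff_ge: "n \<le> fps_ord f \<Longrightarrow> n \<le> fps_ord g \<Longrightarrow> n \<le> fps_ord (f - g :: 'k::ring_1 fps)"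
  by (simp add: fps_ord_ge_iff)

lemma fps_ord_eq_0_iff: "fps_ord f = 0 \<longleftrightarrow> fps_nth f 0 \<noteq> 0"
  by (auto simp: fps_ord_def zero_enat_def subdegree_eq_0_iff)

lemma fps_ord_t_pow [simp]: "fps_ord (t_pow n :: 'k::idom fps) = n"
  by (cases n) (simp_all add: t_pow_def fps_ord_def fps_X_power_subdegree)

lemma fps_dvd_iff_ord: "(f :: 'k::field fps) dvd g \<longleftrightarrow> fps_ord f \<le> fps_ord g"
  by (cases "f = 0"; cases "g = 0") (simp_all add: fps_ord_def fps_dvd_iff)

lemma fps_unit_iff_ord: "(f :: 'k::field fps) dvd 1 \<longleftrightarrow> fps_ord f = 0"
  by (simp add: fps_dvd_iff_ord)

text \<open>
  Generic members of an affine family attain the expected order: at most one \<open>\<rho>\<close> cancels the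
  coefficient of \<open>t^n\<close>, and for \<open>n = \<infinity>\<close> both series vanish.
\<close>

lemma finite_non_generic_order:
  fixes f g :: "'k::field fps"
  assumes "fps_ord g = n" "n \<le> fps_ord f"
  shows "finite {\<rho>. fps_ord (f + fps_const \<rho> * g) \<noteq> n}"
proof (cases n)
  case infinity
  then show ?thesis using assms by simp
next
  case (enat m)
  have "\<rho> = - fps_nth f m / fps_nth g m" if "fps_ord (f + fps_const \<rho> * g) \<noteq> n" for \<rho>
  proof -
    have g: "g \<noteq> 0" "subdegree g = m" using assms(1) enat by (auto simp: fps_ord_def split: if_splits)
    have ge: "n \<le> fps_ord (f + fps_const \<rho> * g)"
      using assms by (intro fps_ord_add_ge) (simp_all add: add_increasing)
    have "fps_nth (f + fps_const \<rho> * g) m = 0"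
    proof (rule ccontr)
      assume "fps_nth (f + fps_const \<rho> * g) m \<noteq> 0"
      then have "fps_ord (f + fps_const \<rho> * g) \<le> enat m"
        using fps_ord_ge_iff[of "enat (Suc m)" "f + fps_const \<rho> * g"]
        by (metis enat_ord_simps(2) lessI not_le ileI1 eSuc_enat)
      with ge that show False using enat by auto
    qed
    moreover have "fps_nth g m \<noteq> 0" using g nth_subdegree_nonzero by blast
    ultimately show ?thesis by (simp add: field_simps eq_neg_iff_add_eq_0)
  qed
  then have "{\<rho>. fps_ord (f + fps_const \<rho> * g) \<noteq> n} \<subseteq> {- fps_nth f m / fps_nth g m}" by blast
  then show ?thesis using finite_subset by blast
qed

section \<open>Schubert conditions over the complex numbers\<close>

context
  fixes W :: "complex vec set"
  assumes W: "W \<subseteq> carrier_vec 4" "0\<^sub>v 4 \<in> W"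
    "\<And>v w. v \<in> W \<Longrightarrow> w \<in> W \<Longrightarrow> v + w \<in> W" "\<And>c v. v \<in> W \<Longrightarrow> c \<cdot>\<^sub>v v \<in> W"
begin

interpretation vec_space "TYPE(complex)" 4 .

lemma submodule_closed_subset: "submodule class_ring W V"
  using W by unfold_locales auto

text \<open>
  Spans inside \<open>W\<close> agree with spans in the ambient space, so the dimension of \<open>W\<close> can be computed
  without treating \<open>W\<close> as a vector space of its own.
\<close>

lemma subspace_dim_eq_Least:
  "subspace_dim 4 W = (LEAST n. \<exists>A. finite A \<and> card A = n \<and> A \<subseteq> W \<and> vec_span 4 A = W)"
proof -
  have vs: "vectorspace class_ring (V\<lparr>carrier := W\<rparr>)"
    by (rule subspace_is_vs) (simp add: subspace_def submodule_closed_subset vec_vs)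
  have span: "module.span class_ring (V\<lparr>carrier := W\<rparr>) A = vec_span 4 A" if "A \<subseteq> W" for A
    unfolding vec_span_def
    by (rule span_li_not_depend(1)[OF that submodule_closed_subset])
  show ?thesis
    unfolding subspace_dim_def vectorspace.dim_def[OF vs]
    by (rule arg_cong[of _ _ Least]) (intro ext ex_cong1 conj_cong refl; simp add: span)
qed

end

lemma vec_span_list:
  fixes vs :: "'r::idom vec list"
  assumes "set vs \<subseteq> carrier_vec n"
  shows "vec_span n (set vs) = {vec n (\<lambda>k. \<Sum>i<length vs. c i * (vs ! i) $ k) | c. True}"
proof -
  interpret idom_vec where n = n and f_ty = "TYPE('r)" .
  have sm: "(c l \<cdot>\<^sub>v vs ! l) $ k = c l * vs ! l $ k" if "l < length vs" "k < n" for c l k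
  proof -
    have "vs ! l \<in> carrier_vec n" using that(1) assms by auto
    then show ?thesis using that(2) by simp
  qed
  have "lincomb_list c vs = vec n (\<lambda>k. \<Sum>i<length vs. c i * (vs ! i) $ k)" for c
    using assms sm
    by (intro eq_vecI) (auto simp: lincomb_list_def sumlist_nth dim_sumlist atLeast0LessThan subset_iff
        intro!: sum.cong simp del: index_smult_vec)
  then show ?thesis
    by (simp add: vec_span_def flip: span_list_as_span[OF assms]) (auto simp: span_list_def)
qed

lemma vec_span_empty: "vec_span 4 {} = {0\<^sub>v 4 :: 'r::idom vec}"
  using vec_span_list[of "[]" 4] by (auto simp: zero_vec_def)

lemma vec_span_singleton:
  assumes "v \<in> carrier_vec 4"
  shows "vec_span 4 {v :: 'r::idom vec} = {c \<cdot>\<^sub>v v | c. True}"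
proof -
  have "vec 4 (\<lambda>k. c * v $ k) = c \<cdot>\<^sub>v v" for c using assms by auto
  then show ?thesis using vec_span_list[of "[v]" 4] assms
    by (auto intro: exI[of _ "\<lambda>_. _"])
qed

lemma row_comb_inject:
  fixes B :: "complex mat"
  assumes B: "B \<in> carrier_mat 2 4" and J: "J \<in> index_sets 2 4" "minor J B \<noteq> 0"
    and eq: "row_comb B x y = row_comb B x' y'"
  shows "x = x' \<and> y = y'"
proof -
  from J(1) obtain i j where ij: "J = {i, j}" "i < j" "j < 4" by (rule index_sets_2_4E)
  have e: "x * B $$ (0, k) + y * B $$ (1, k) = x' * B $$ (0, k) + y' * B $$ (1, k)" if "k < 4" for k
    using arg_cong[OF eq, of "\<lambda>v. vec_index v k"] that by simp
  have m: "minor J B = B $$ (0, i) * B $$ (1, j) - B $$ (0, j) * B $$ (1, i)"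
    unfolding ij(1) by (rule minor_pair[OF B ij(2,3)])
  have ei: "(x * B $$ (0, i) + y * B $$ (1, i)) - (x' * B $$ (0, i) + y' * B $$ (1, i)) = 0"
    and ej: "(x * B $$ (0, j) + y * B $$ (1, j)) - (x' * B $$ (0, j) + y' * B $$ (1, j)) = 0"
    using e[of i] e[of j] ij by (simp_all del: One_nat_def)
  have "(x - x') * minor J B =
    ((x * B $$ (0, i) + y * B $$ (1, i)) - (x' * B $$ (0, i) + y' * B $$ (1, i))) * B $$ (1, j) -
    ((x * B $$ (0, j) + y * B $$ (1, j)) - (x' * B $$ (0, j) + y' * B $$ (1, j))) * B $$ (1, i)"
    unfolding m by (simp add: algebra_simps)
  moreover have "(y - y') * minor J B =
    ((x * B $$ (0, j) + y * B $$ (1, j)) - (x' * B $$ (0, j) + y' * B $$ (1, j))) * B $$ (0, i) -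
    ((x * B $$ (0, i) + y * B $$ (1, i)) - (x' * B $$ (0, i) + y' * B $$ (1, i))) * B $$ (0, j)"
    unfolding m by (simp add: algebra_simps)
  ultimately have "(x - x') * minor J B = 0" "(y - y') * minor J B = 0"
    unfolding ei ej by simp_all
  then show ?thesis using J(2) by simp
qed

text \<open>
  A subspace of the plane is zero, a line, or the whole plane, and these have spanning sets of least
  size 0, 1 and 2.
\<close>

lemma subspace_dim_in_row_span:
  fixes B :: "complex mat"
  assumes B: "B \<in> carrier_mat 2 4" and J: "J \<in> index_sets 2 4" "minor J B \<noteq> 0"
    and W: "W \<subseteq> row_span B" "0\<^sub>v 4 \<in> W"
      "\<And>v w. v \<in> W \<Longrightarrow> w \<in> W \<Longrightarrow> v + w \<in> W" "\<And>c v. v \<in> W \<Longrightarrow> c \<cdot>\<^sub>v v \<in> W"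
  shows "1 \<le> subspace_dim 4 W \<longleftrightarrow> (\<exists>v\<in>W. v \<noteq> 0\<^sub>v 4)"
    and "2 \<le> subspace_dim 4 W \<longleftrightarrow> row_span B \<subseteq> W"
proof -
  define P where "P n \<longleftrightarrow> (\<exists>A. finite A \<and> card A = n \<and> A \<subseteq> W \<and> vec_span 4 A = W)" for n
  have carrier: "W \<subseteq> carrier_vec 4" using W(1) unfolding row_span_eq[OF B] by auto
  have dim: "subspace_dim 4 W = (LEAST n. P n)"
    unfolding P_def by (rule subspace_dim_eq_Least[OF carrier W(2-4)])
  note inj = row_comb_inject[OF B J]
  have P0: "P 0 \<longleftrightarrow> W = {0\<^sub>v 4}"
    unfolding P_def by (auto simp: vec_span_empty)
  have P1: "P 1 \<longleftrightarrow> (\<exists>v\<in>W. W = {c \<cdot>\<^sub>v v | c. True})"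
  proof
    assume "P 1"
    then obtain v where "{v} \<subseteq> W" "vec_span 4 {v} = W" unfolding P_def by (auto simp: card_1_singleton_iff)
    then show "\<exists>v\<in>W. W = {c \<cdot>\<^sub>v v | c. True}" using carrier vec_span_singleton[of v] by auto
  next
    assume "\<exists>v\<in>W. W = {c \<cdot>\<^sub>v v | c. True}"
    then obtain v where "v \<in> W" "W = {c \<cdot>\<^sub>v v | c. True}" by blast
    then show "P 1" unfolding P_def using carrier vec_span_singleton[of v]
      by (intro exI[of _ "{v}"]) auto
  qed
  have zero_comb: "row_comb B 0 0 = 0\<^sub>v 4" by (simp add: row_comb_eq_iff)
  have top: "\<not> P 0 \<and> \<not> P 1 \<and> P 2" if "W = row_span B"
  proof (intro conjI)
    have r: "row_comb B 1 0 \<in> W" "row_comb B 0 1 \<in> W" using that unfolding row_span_eq[OF B] by blast+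
    show "\<not> P 0" unfolding P0 using r(1) zero_comb inj[of 1 0 0 0] by auto
    show "\<not> P 1" unfolding P1
    proof
      assume "\<exists>v\<in>W. W = {c \<cdot>\<^sub>v v | c. True}"
      then obtain v c d where v: "v \<in> W" "row_comb B 1 0 = c \<cdot>\<^sub>v v" "row_comb B 0 1 = d \<cdot>\<^sub>v v" using r by blast
      from v(1) obtain x y where xy: "v = row_comb B x y" using W(1) unfolding row_span_eq[OF B] by auto
      have "row_comb B 1 0 = row_comb B (c * x) (c * y)" "row_comb B 0 1 = row_comb B (d * x) (d * y)"
        unfolding v(2,3) xy by (simp_all add: vec_eq_iff algebra_simps)
      then have "1 = c * x" "0 = c * y" "1 = d * y" using inj by blast+
      then show False by auto
    qed
    have rows: "row_span B = vec_span 4 (set (rows B))" using B by (simp add: row_span_def)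
    have "set (rows B) = {row B 0, row B 1}"
      using B by (auto simp: rows_def less_2_cases_iff)
    moreover have "row B 0 = row_comb B 1 0" "row B 1 = row_comb B 0 1"
      using B by (auto simp: row_def row_comb_def)
    moreover have "row_comb B 1 0 \<noteq> row_comb B 0 1" using inj[of 1 0 0 1] by auto
    ultimately show "P 2" unfolding P_def
      using r that rows by (intro exI[of _ "set (rows B)"]) auto
  qed
  have cases: "W = {0\<^sub>v 4} \<or> (\<exists>v\<in>W. W = {c \<cdot>\<^sub>v v | c. True}) \<or> W = row_span B"
  proof (rule ccontr)
    assume neg: "\<not> ?thesis"
    then obtain v where v: "v \<in> W" "v \<noteq> 0\<^sub>v 4" using W(2) by blast
    then obtain w where w: "w \<in> W" "\<And>c. w \<noteq> c \<cdot>\<^sub>v v" using neg W(4) by blast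
    obtain x y x' y' where xy: "v = row_comb B x y" "w = row_comb B x' y'"
      using v w W(1) unfolding row_span_eq[OF B] by blast
    have "x \<noteq> 0 \<or> y \<noteq> 0" using v(2) zero_comb xy(1) by auto
    then have det: "x * y' - y * x' \<noteq> 0"
    proof
      assume x: "x \<noteq> 0"
      show ?thesis
      proof
        assume "x * y' - y * x' = 0"
        then have "w = (x' / x) \<cdot>\<^sub>v v" using x unfolding xy by (auto simp: vec_eq_iff field_simps)
        with w show False by blast
      qed
    next
      assume y: "y \<noteq> 0"
      show ?thesis
      proof
        assume "x * y' - y * x' = 0"
        then have "w = (y' / y) \<cdot>\<^sub>v v" using y unfolding xy by (auto simp: vec_eq_iff field_simps)
        with w show False by blast
      qed
    qed
    have "row_span B \<subseteq> W"
    proof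
      fix u assume "u \<in> row_span B"
      then obtain p q where u: "u = row_comb B p q" unfolding row_span_eq[OF B] by blast
      define D where "D = x * y' - y * x'"
      have "u = ((p * y' - q * x') / D) \<cdot>\<^sub>v v + ((q * x - p * y) / D) \<cdot>\<^sub>v w"
        using det unfolding u xy D_def[symmetric]
        by (auto simp: vec_eq_iff divide_simps) (simp add: D_def algebra_simps)
      then show "u \<in> W" using v(1) w(1) W(3,4) by auto
    qed
    then show False using neg W(1) by blast
  qed
  have "subspace_dim 4 W = (if W = {0\<^sub>v 4} then 0 else if W = row_span B then 2 else 1)"
  proof -
    consider "W = {0\<^sub>v 4}" | "W \<noteq> {0\<^sub>v 4}" "W = row_span B" | "W \<noteq> {0\<^sub>v 4}" "W \<noteq> row_span B" by blast
    then show ?thesis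
    proof cases
      case 1
      then have "P 0" using P0 by blast
      then show ?thesis using 1 dim by simp
    next
      case 2
      have "(LEAST n. P n) = 2"
      proof (rule Least_equality)
        show "P 2" using top 2 by blast
        show "2 \<le> n" if "P n" for n
          using that top[OF 2(2)] by (cases n; cases "n - 1") auto
      qed
      then show ?thesis using 2 dim by simp
    next
      case 3
      have "(LEAST n. P n) = 1"
      proof (rule Least_equality)
        show "P 1" using P1 3 cases by blast
        show "1 \<le> n" if "P n" for n
          using that P0 3(1) by (cases n) auto
      qed
      then show ?thesis using 3 dim by simp
    qed
  qed
  note dim_W = this
  have top_nonzero: "W \<noteq> {0\<^sub>v 4}" if "W = row_span B" using top[OF that] P0 by blast
  have "1 \<le> subspace_dim 4 W \<longleftrightarrow> W \<noteq> {0\<^sub>v 4}" by (subst dim_W) simp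
  also have "\<dots> \<longleftrightarrow> (\<exists>v\<in>W. v \<noteq> 0\<^sub>v 4)" using W(2) by blast
  finally show "1 \<le> subspace_dim 4 W \<longleftrightarrow> (\<exists>v\<in>W. v \<noteq> 0\<^sub>v 4)" .
  have "2 \<le> subspace_dim 4 W \<longleftrightarrow> W \<noteq> {0\<^sub>v 4} \<and> W = row_span B" by (subst dim_W) simp
  also have "\<dots> \<longleftrightarrow> row_span B \<subseteq> W" using W(1) top_nonzero by blast
  finally show "2 \<le> subspace_dim 4 W \<longleftrightarrow> row_span B \<subseteq> W" .
qed

lemma flag_eq:
  assumes "i \<le> 4"
  shows "flag 4 i = {v \<in> carrier_vec 4. \<forall>k<4 - i. v $ k = 0}"
proof -
  let ?vs = "map (\<lambda>l. unit_vec 4 (4 - i + l) :: complex vec) [0..<i]"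
  have image: "(\<lambda>l. 4 - i + l) ` {0..<i} = {4 - i..<4}"
    using assms image_add_atLeastLessThan[of "4 - i" 0 i] by simp
  have vs: "set ?vs = unit_vec 4 ` {4 - i..<4}"
    unfolding image[symmetric] set_map set_upt image_image ..
  have comb: "vec 4 (\<lambda>k. \<Sum>l<length ?vs. c l * (?vs ! l) $ k) = vec 4 (\<lambda>k. \<Sum>l<i. if k = 4 - i + l then c l else 0)" for c
    using assms by (intro eq_vecI) (auto intro!: sum.cong)
  have "set ?vs \<subseteq> carrier_vec 4" by auto
  from vec_span_list[OF this]
  have flag: "flag 4 i = {vec 4 (\<lambda>k. \<Sum>l<i. if k = 4 - i + l then c l else 0) | c. True}"
    unfolding flag_def comb vs .
  show ?thesis
  proof (intro equalityI subsetI)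
    fix v assume "v \<in> flag 4 i"
    then show "v \<in> {v \<in> carrier_vec 4. \<forall>k<4 - i. v $ k = 0}" unfolding flag by auto
  next
    fix v :: "complex vec" assume v: "v \<in> {v \<in> carrier_vec 4. \<forall>k<4 - i. v $ k = 0}"
    have "(\<Sum>l<i. if k = 4 - i + l then v $ (4 - i + l) else 0) = v $ k" if "k < 4" for k
    proof (cases "k < 4 - i")
      case True
      then show ?thesis using v by (auto intro!: sum.neutral)
    next
      case False
      then have "(k = 4 - i + l) = (l = k - (4 - i))" for l by auto
      then show ?thesis using False assms that by (simp add: less_diff_conv2)
    qed
    then have "v = vec 4 (\<lambda>k. \<Sum>l<i. if k = 4 - i + l then v $ (4 - i + l) else 0)"
      using v by (auto simp: vec_eq_iff)
    then show "v \<in> flag 4 i" unfolding flag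
      by (intro CollectI exI[of _ "\<lambda>l. vec_index v (4 - i + l)"] conjI TrueI)
  qed
qed

text \<open>
  The flag space of dimension \<open>2 + a - b\<close> consists of the vectors that vanish in the first \<open>2 + b - a\<close>
  coordinates. For \<open>a = 1\<close> a non-zero vector of the plane has to lie in it, for \<open>a = 2\<close> the whole
  plane.
\<close>

lemma schubert_row_span_iff:
  fixes B :: "complex mat"
  assumes B: "B \<in> carrier_mat 2 4" and J: "J \<in> index_sets 2 4" "minor J B \<noteq> 0"
    and ab: "a \<in> {1, 2}" "b \<in> {1, 2}"
  shows "row_span B \<in> schubert 2 4 a b \<longleftrightarrow>
    (if a = 1 then \<exists>x y. (x \<noteq> 0 \<or> y \<noteq> 0) \<and> (\<forall>k\<le>b. x * B $$ (0, k) + y * B $$ (1, k) = 0)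
     else \<forall>k<b. B $$ (0, k) = 0 \<and> B $$ (1, k) = 0)"
proof -
  let ?i = "2 + a - b"
  let ?W = "row_span B \<inter> flag 4 ?i"
  have i: "?i \<le> 4" "4 - ?i = 2 + b - a" using ab by auto
  have gr: "row_span B \<in> grassmannian 2 4"
    using B J dvd_field_iff[of "minor J B" 1] unfolding grassmannian_def by auto
  have W: "?W \<subseteq> row_span B" "0\<^sub>v 4 \<in> ?W"
      "\<And>v w. v \<in> ?W \<Longrightarrow> w \<in> ?W \<Longrightarrow> v + w \<in> ?W" "\<And>c v. v \<in> ?W \<Longrightarrow> c \<cdot>\<^sub>v v \<in> ?W"
  proof -
    have "row_comb B 0 0 = 0\<^sub>v 4" by (simp add: row_comb_eq_iff)
    then have "0\<^sub>v 4 \<in> row_span B" unfolding row_span_eq[OF B] by (metis (mono_tags, lifting) CollectI)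
    moreover have "0\<^sub>v 4 \<in> flag 4 ?i" unfolding flag_eq[OF i(1)] by simp
    ultimately show "0\<^sub>v 4 \<in> ?W" by blast
    show "v + w \<in> ?W" if vw: "v \<in> ?W" "w \<in> ?W" for v w
    proof -
      from vw obtain x y x' y' where "v = row_comb B x y" "w = row_comb B x' y'"
        unfolding row_span_eq[OF B] by blast
      then have "v + w = row_comb B (x + x') (y + y')" by (auto simp: vec_eq_iff algebra_simps)
      then have "v + w \<in> row_span B" unfolding row_span_eq[OF B] by blast
      moreover have "v + w \<in> flag 4 ?i" using vw unfolding flag_eq[OF i(1)] by auto
      ultimately show ?thesis by blast
    qed
    show "c \<cdot>\<^sub>v v \<in> ?W" if v: "v \<in> ?W" for c v
    proof -
      from v obtain x y where "v = row_comb B x y" unfolding row_span_eq[OF B] by blast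
      then have "c \<cdot>\<^sub>v v = row_comb B (c * x) (c * y)" by (auto simp: vec_eq_iff algebra_simps)
      then have "c \<cdot>\<^sub>v v \<in> row_span B" unfolding row_span_eq[OF B] by blast
      moreover have "c \<cdot>\<^sub>v v \<in> flag 4 ?i" using v unfolding flag_eq[OF i(1)] by auto
      ultimately show ?thesis by blast
    qed
  qed auto
  note dim = subspace_dim_in_row_span[OF B J W]
  have zero: "row_comb B x y = 0\<^sub>v 4 \<longleftrightarrow> x = 0 \<and> y = 0" for x y
    using row_comb_inject[OF B J, of x y 0 0] by (auto simp: row_comb_eq_iff)
  have flag: "row_comb B x y \<in> flag 4 ?i \<longleftrightarrow> (\<forall>k<2 + b - a. x * B $$ (0, k) + y * B $$ (1, k) = 0)" for x y
    using i ab unfolding flag_eq[OF i(1)] by auto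
  have "row_span B \<in> schubert 2 4 a b \<longleftrightarrow> a \<le> subspace_dim 4 ?W"
    using gr by (simp add: schubert_def)
  also have "\<dots> \<longleftrightarrow> (if a = 1 then \<exists>v\<in>?W. v \<noteq> 0\<^sub>v 4 else row_span B \<subseteq> flag 4 ?i)"
  proof (cases "a = 1")
    case True
    show ?thesis using dim(1) by (simp only: True simp_thms if_True)
  next
    case False
    then have a: "a = 2" using ab by blast
    have "2 \<le> subspace_dim 4 ?W \<longleftrightarrow> row_span B \<subseteq> ?W" by (rule dim(2))
    then have "2 \<le> subspace_dim 4 ?W \<longleftrightarrow> row_span B \<subseteq> flag 4 ?i" by simp
    then show ?thesis by (simp only: a if_False) simp
  qed
  also have "\<dots> \<longleftrightarrow> (if a = 1 then \<exists>x y. (x \<noteq> 0 \<or> y \<noteq> 0) \<and> row_comb B x y \<in> flag 4 ?i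
      else \<forall>x y. row_comb B x y \<in> flag 4 ?i)"
  proof -
    have "(\<exists>v\<in>?W. v \<noteq> 0\<^sub>v 4) \<longleftrightarrow> (\<exists>x y. row_comb B x y \<noteq> 0\<^sub>v 4 \<and> row_comb B x y \<in> flag 4 ?i)"
      unfolding row_span_eq[OF B] by blast
    moreover have "row_span B \<subseteq> flag 4 ?i \<longleftrightarrow> (\<forall>x y. row_comb B x y \<in> flag 4 ?i)"
      unfolding row_span_eq[OF B] by blast
    ultimately show ?thesis unfolding zero by (simp only: de_Morgan_conj)
  qed
  also have "\<dots> \<longleftrightarrow> (if a = 1 then \<exists>x y. (x \<noteq> 0 \<or> y \<noteq> 0) \<and> (\<forall>k\<le>b. x * B $$ (0, k) + y * B $$ (1, k) = 0)
     else \<forall>k<b. B $$ (0, k) = 0 \<and> B $$ (1, k) = 0)"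
  proof (cases "a = 1")
    case True
    then show ?thesis unfolding flag by (simp add: less_Suc_eq_le)
  next
    case False
    then have "2 + b - a = b" using ab by auto
    have "(\<forall>x y. \<forall>k<b. x * B $$ (0, k) + y * B $$ (1, k) = 0) \<longleftrightarrow> (\<forall>k<b. B $$ (0, k) = 0 \<and> B $$ (1, k) = 0)"
    proof (intro iffI allI impI)
      fix k assume *: "\<forall>x y. \<forall>k<b. x * B $$ (0, k) + y * B $$ (1, k) = 0" and k: "k < b"
      from *[rule_format, OF k, of 1 0] *[rule_format, OF k, of 0 1]
      show "B $$ (0, k) = 0 \<and> B $$ (1, k) = 0" by simp
    qed simp
    then show ?thesis unfolding flag using False \<open>2 + b - a = b\<close> by simp
  qed
  finally show ?thesis .
qed

text \<open>
  The plane meets the flag space of dimension \<open>2 + a - b\<close> in dimension at least \<open>a\<close> iff its projection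
  to the first \<open>2 + b - a\<close> coordinates has rank at most \<open>2 - a\<close>. This makes every minor vanish that
  uses at least \<open>3 - a\<close> of these columns.
\<close>

definition schubert_coords :: "nat \<Rightarrow> nat \<Rightarrow> nat set set" where
  "schubert_coords a b = {J \<in> index_sets 2 4. card (J \<inter> {..<2 + b - a}) \<ge> 3 - a}"

lemma schubert_coords_pair_iff:
  assumes "i < j" "j < 4" "a \<in> {1, 2}"
  shows "{i, j} \<in> schubert_coords a b \<longleftrightarrow> (if a = 1 then j \<le> b else i < b)"
  using assms by (auto simp: schubert_coords_def index_sets_def Int_insert_left)

lemma schubert_coords_subset: "schubert_coords a b \<subseteq> index_sets 2 4"
  by (auto simp: schubert_coords_def)

text \<open>
  For \<open>a = 1\<close>, if the column \<open>(x k, y k)\<close> is not zero, the row combination with coefficients \<open>y k\<close> and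
  \<open>- x k\<close> vanishes in all columns that form a zero minor with column \<open>k\<close>. For \<open>a = 2\<close>, if all minors
  through a non-zero column \<open>k\<close> vanish, then all columns are multiples of it and the matrix has rank one,
  which the non-zero minor \<open>J\<close> excludes.
\<close>

lemma schubert_row_span_iff_minors:
  fixes B :: "complex mat"
  assumes B: "B \<in> carrier_mat 2 4" and J: "J \<in> index_sets 2 4" "minor J B \<noteq> 0"
    and ab: "a \<in> {1, 2}" "b \<in> {1, 2}"
  shows "row_span B \<in> schubert 2 4 a b \<longleftrightarrow> (\<forall>J\<in>schubert_coords a b. minor J B = 0)"
proof -
  define x y where "x = (\<lambda>k. B $$ (0, k))" and "y = (\<lambda>k. B $$ (1, k))"
  have minor: "minor {i, j} B = 0 \<longleftrightarrow> x i * y j = x j * y i" if "i < 4" "j < 4" "i \<noteq> j" for i j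
  proof (cases "i < j")
    case True
    then show ?thesis using minor_pair[OF B, of i j] that by (simp add: x_def y_def)
  next
    case False
    moreover have "{i, j} = {j, i}" by blast
    ultimately show ?thesis using minor_pair[OF B, of j i] that
      by (auto simp: x_def y_def mult.commute)
  qed
  have vanish: "(\<forall>J\<in>schubert_coords a b. minor J B = 0) \<longleftrightarrow>
    (\<forall>i j. i < j \<and> j < 4 \<and> (if a = 1 then j \<le> b else i < b) \<longrightarrow> x i * y j = x j * y i)"
    (is "?L \<longleftrightarrow> ?R")
  proof
    assume L: ?L
    show ?R
    proof (intro allI impI)
      fix i j assume ij: "i < j \<and> j < 4 \<and> (if a = 1 then j \<le> b else i < b)"
      then have "{i, j} \<in> schubert_coords a b"
        using schubert_coords_pair_iff[of i j a b] ab(1) by (simp del: One_nat_def)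
      then have "minor {i, j} B = 0" using L by blast
      then show "x i * y j = x j * y i" using minor[of i j] ij by simp
    qed
  next
    assume R: ?R
    show ?L
    proof
      fix J assume J: "J \<in> schubert_coords a b"
      then obtain i j where ij: "J = {i, j}" "i < j" "j < 4"
        using schubert_coords_subset index_sets_2_4E by blast
      then show "minor J B = 0"
        using J R schubert_coords_pair_iff[OF ij(2,3) ab(1), of b] minor[of i j] by auto
    qed
  qed
  have proportional: "x i * y j = x j * y i" if "x k \<noteq> 0 \<or> y k \<noteq> 0" "x k * y i = x i * y k" "x k * y j = x j * y k" for i j k
  proof -
    have "x k * (x i * y j - x j * y i) = x i * (x k * y j) - x j * (x k * y i)"
      "y k * (x i * y j - x j * y i) = (x i * y k) * y j - (x j * y k) * y i"
      by (simp_all add: algebra_simps)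
    moreover have "x i * (x k * y j) - x j * (x k * y i) = 0" unfolding that(2,3) by simp
    moreover have "(x i * y k) * y j - (x j * y k) * y i = 0" unfolding that(2,3)[symmetric] by simp
    ultimately have "x k * (x i * y j - x j * y i) = 0" "y k * (x i * y j - x j * y i) = 0"
      by simp_all
    then show ?thesis using that(1) by auto
  qed
  show ?thesis
  proof (cases "a = 1")
    case True
    have "(\<exists>u v. (u \<noteq> 0 \<or> v \<noteq> 0) \<and> (\<forall>k\<le>b. u * x k + v * y k = 0)) \<longleftrightarrow>
      (\<forall>i j. i < j \<and> j < 4 \<and> j \<le> b \<longrightarrow> x i * y j = x j * y i)" (is "?L \<longleftrightarrow> ?R")
    proof
      assume ?L
      then obtain u v where uv: "u \<noteq> 0 \<or> v \<noteq> 0" "\<And>k. k \<le> b \<Longrightarrow> u * x k + v * y k = 0" by blast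
      show ?R
      proof (intro allI impI)
        fix i j assume "i < j \<and> j < 4 \<and> j \<le> b"
        then have "u * x i + v * y i = 0" "u * x j + v * y j = 0" using uv(2)[of i] uv(2)[of j] by auto
        moreover have "u * (x i * y j - x j * y i) = (u * x i + v * y i) * y j - (u * x j + v * y j) * y i"
          "v * (x i * y j - x j * y i) = (u * x j + v * y j) * x i - (u * x i + v * y i) * x j"
          by (simp_all add: algebra_simps)
        ultimately have "u * (x i * y j - x j * y i) = 0" "v * (x i * y j - x j * y i) = 0" by simp_all
        then show "x i * y j = x j * y i" using uv(1) by auto
      qed
    next
      assume R: ?R
      show ?L
      proof (cases "\<forall>k\<le>b. x k = 0 \<and> y k = 0")
        case True
        then show ?thesis by (intro exI[of _ 1] exI[of _ 0]) simp
      next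
        case False
        then obtain k where k: "k \<le> b" "x k \<noteq> 0 \<or> y k \<noteq> 0" by blast
        have "y k * x l + (- x k) * y l = 0" if "l \<le> b" for l
          using R[rule_format, of k l] R[rule_format, of l k] that k(1) ab(2)
          by (cases k l rule: linorder_cases) (auto simp: mult.commute)
        then show ?thesis using k(2) by (intro exI[of _ "y k"] exI[of _ "- x k"]) auto
      qed
    qed
    then show ?thesis
      unfolding schubert_row_span_iff[OF B J ab] vanish using True by (simp add: x_def y_def)
  next
    case False
    have "(\<forall>k<b. x k = 0 \<and> y k = 0) \<longleftrightarrow>
      (\<forall>i j. i < j \<and> j < 4 \<and> i < b \<longrightarrow> x i * y j = x j * y i)" (is "?L \<longleftrightarrow> ?R")
    proof
      assume R: ?R
      show ?L
      proof (rule ccontr)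
        assume "\<not> ?L"
        then obtain k where k: "k < b" "x k \<noteq> 0 \<or> y k \<noteq> 0" by blast
        have "x k * y l = x l * y k" if "l < 4" for l
          using R[rule_format, of k l] R[rule_format, of l k] that k(1) ab(2)
          by (cases k l rule: linorder_cases) (auto simp: mult.commute)
        moreover obtain i j where "J = {i, j}" "i < j" "j < 4" using J(1) by (rule index_sets_2_4E)
        ultimately have "minor J B = 0" using proportional[OF k(2), of i j] minor[of i j] by simp
        then show False using J(2) by simp
      qed
    qed auto
    then show ?thesis
      unfolding schubert_row_span_iff[OF B J ab] vanish using False by (simp add: x_def y_def)
  qed
qed

section \<open>Ideals of the Schubert varieties in the charts\<close>

text \<open>
  The exponent of \<open>z\<close> in the value of the monomial \<open>m\<close> on the curve that sends each variable \<open>x\<close> to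
  \<open>z ^ n x\<close>.
\<close>

definition monomial_weight :: "('x \<Rightarrow> nat) \<Rightarrow> ('x \<Rightarrow>\<^sub>0 nat) \<Rightarrow> nat" where
  "monomial_weight n m = (\<Sum>x\<in>Poly_Mapping.keys m. Poly_Mapping.lookup m x * n x)"

lemma monomial_weight_superset:
  assumes "finite A" "Poly_Mapping.keys m \<subseteq> A"
  shows "monomial_weight n m = (\<Sum>x\<in>A. Poly_Mapping.lookup m x * n x)"
  unfolding monomial_weight_def
  by (rule sum.mono_neutral_left) (use assms in \<open>auto simp: in_keys_iff\<close>)

lemma monomial_value_curve:
  "monomial_value (\<lambda>x. if x \<in> T then z ^ n x else 0) m =
    (if Poly_Mapping.keys m \<subseteq> T then z ^ monomial_weight n m else (0 :: 'r::comm_ring_1))"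
proof (cases "Poly_Mapping.keys m \<subseteq> T")
  case True
  then have "monomial_value (\<lambda>x. if x \<in> T then z ^ n x else 0) m =
      (\<Prod>x\<in>Poly_Mapping.keys m. z ^ (Poly_Mapping.lookup m x * n x))"
    unfolding monomial_value_def by (intro prod.cong) (auto simp: mult.commute simp flip: power_mult)
  with True show ?thesis by (simp add: monomial_weight_def power_sum)
next
  case False
  then obtain x where x: "x \<in> Poly_Mapping.keys m" "x \<notin> T" by blast
  then have "(\<Prod>x\<in>Poly_Mapping.keys m. (if x \<in> T then z ^ n x else 0) ^ Poly_Mapping.lookup m x) = 0"
    by (intro prod_zero) (auto simp: in_keys_iff power_0_left intro!: bexI[of _ x])
  with False show ?thesis by (simp add: monomial_value_def)
qed

lemma monomial_value_dvd:
  assumes "x \<in> Poly_Mapping.keys m" "D dvd w x"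
  shows "D dvd monomial_value w m"
proof -
  have "w x dvd w x ^ Poly_Mapping.lookup m x"
    using assms(1) by (intro dvd_power) (auto simp: in_keys_iff)
  also have "\<dots> dvd monomial_value w m"
    unfolding monomial_value_def using assms(1) by (intro dvd_prodI) auto
  finally show ?thesis using assms(2) dvd_trans by blast
qed

text \<open>
  Restricted to the curve, \<open>f\<close> becomes a polynomial in \<open>z\<close> whose coefficient of \<open>z ^ k\<close> is the sum of
  the coefficients of \<open>f\<close> over all monomials of weight \<open>k\<close>. All these sums vanish. Modulo \<open>D\<close>, the value
  of a monomial at \<open>w\<close> depends on its weight only, so the terms of each weight cancel. In this way
  vanishing at complex points turns into divisibility at points over any algebra.
\<close>

lemma dvd_poly_eval_if_vanishes_on_curve:
  fixes f :: "'x cpoly" and w :: "'x \<Rightarrow> 'r::comm_ring_1"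
  assumes hom: "comm_ring_hom h"
    and vanish: "\<And>z :: complex. poly_eval (\<lambda>c. c) (\<lambda>x. if x \<in> T then z ^ n x else 0) f = 0"
    and out: "\<And>x. x \<notin> T \<Longrightarrow> D dvd w x"
    and cong: "\<And>m m'. \<lbrakk>m \<in> Poly_Mapping.keys f; m' \<in> Poly_Mapping.keys f;
        Poly_Mapping.keys m \<subseteq> T; Poly_Mapping.keys m' \<subseteq> T; monomial_weight n m = monomial_weight n m'\<rbrakk>
      \<Longrightarrow> D dvd monomial_value w m - monomial_value w m'"
  shows "D dvd poly_eval h w f"
proof -
  interpret comm_ring_hom h by fact
  define K where "K = {m \<in> Poly_Mapping.keys f. Poly_Mapping.keys m \<subseteq> T}"
  let ?c = "Poly_Mapping.lookup f" and ?wt = "monomial_weight n"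
  have fin: "finite K" by (simp add: K_def)
  define p where "p = (\<Sum>m\<in>K. monom (?c m) (?wt m))"
  have "poly p z = 0" for z
  proof -
    have "poly p z = (\<Sum>m\<in>K. ?c m * z ^ ?wt m)" by (simp add: p_def poly_sum poly_monom)
    also have "\<dots> = (\<Sum>m\<in>Poly_Mapping.keys f. ?c m * monomial_value (\<lambda>x. if x \<in> T then z ^ n x else 0) m)"
      by (rule sum.mono_neutral_cong_left) (auto simp: K_def monomial_value_curve)
    also have "\<dots> = 0" using vanish[of z] by (simp add: poly_eval_monomial_value)
    finally show ?thesis .
  qed
  then have "p = 0" using poly_all_0_iff_0 by blast
  have group: "(\<Sum>m\<in>{m \<in> K. ?wt m = k}. ?c m) = 0" for k
  proof -
    have "(\<Sum>m\<in>{m \<in> K. ?wt m = k}. ?c m) = coeff p k"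
      by (simp add: p_def coeff_sum sum.If_cases fin if_distrib cong: if_cong)
         (simp add: Int_def conj_commute fin sum.inter_filter)
    then show ?thesis by (simp add: \<open>p = 0\<close>)
  qed
  \<comment> \<open>a representative of each weight\<close>
  define r where "r k = (SOME m. m \<in> K \<and> ?wt m = k)" for k
  have r: "r (?wt m) \<in> K \<and> ?wt (r (?wt m)) = ?wt m" if "m \<in> K" for m
    unfolding r_def by (rule someI[of _ m]) (use that in simp)
  have "poly_eval h w f = (\<Sum>m\<in>Poly_Mapping.keys f - K. h (?c m) * monomial_value w m)
      + (\<Sum>m\<in>K. h (?c m) * monomial_value w m)"
    unfolding poly_eval_monomial_value by (rule sum.subset_diff) (auto simp: K_def)
  also have "(\<Sum>m\<in>K. h (?c m) * monomial_value w m) =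
      (\<Sum>m\<in>K. h (?c m) * (monomial_value w m - monomial_value w (r (?wt m))))
      + (\<Sum>m\<in>K. h (?c m) * monomial_value w (r (?wt m)))"
    by (simp add: algebra_simps flip: sum.distrib)
  also have "(\<Sum>m\<in>K. h (?c m) * monomial_value w (r (?wt m))) =
      (\<Sum>k\<in>?wt ` K. \<Sum>m\<in>{m \<in> K. ?wt m = k}. h (?c m) * monomial_value w (r (?wt m)))"
    by (rule sum.group[symmetric]) (auto simp: fin)
  also have "\<dots> = (\<Sum>k\<in>?wt ` K. h (\<Sum>m\<in>{m \<in> K. ?wt m = k}. ?c m) * monomial_value w (r k))"
    by (simp add: hom_sum sum_distrib_right)
  also have "\<dots> = 0" by (simp add: group)
  finally have eq: "poly_eval h w f = (\<Sum>m\<in>Poly_Mapping.keys f - K. h (?c m) * monomial_value w m)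
      + (\<Sum>m\<in>K. h (?c m) * (monomial_value w m - monomial_value w (r (?wt m))))" by simp
  show ?thesis
    unfolding eq
  proof (intro dvd_add dvd_sum dvd_mult)
    fix m assume "m \<in> Poly_Mapping.keys f - K"
    then obtain x where x: "x \<in> Poly_Mapping.keys m" "x \<notin> T" by (auto simp: K_def)
    show "D dvd monomial_value w m" by (rule monomial_value_dvd[where x = x and w = w, OF x(1) out[OF x(2)]])
  next
    fix m assume "m \<in> K"
    then show "D dvd monomial_value w m - monomial_value w (r (?wt m))"
      using r[of m] unfolding K_def by (intro cong) simp_all
  qed
qed

lemma digit_eq:
  fixes a a' q q' N :: nat
  assumes "a + N * q = a' + N * q'" "a < N" "a' < N"
  shows "a = a' \<and> q = q'"
proof
  show "a = a'" using arg_cong[OF assms(1), of "\<lambda>x. x mod N"] assms(2,3) by simp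
  show "q = q'" using arg_cong[OF assms(1), of "\<lambda>x. x div N"] assms(2,3) by simp
qed

text \<open>
  Digits in base \<open>N\<close>: four exponents below \<open>N\<close> can be read off from a single weight.
\<close>

lemma four_digits_eq:
  fixes N :: nat
  assumes "a + b * N + c * N ^ 2 + d * N ^ 3 = a' + b' * N + c' * N ^ 2 + d' * N ^ 3"
    "a < N" "b < N" "c < N" "a' < N" "b' < N" "c' < N"
  shows "a = a' \<and> b = b' \<and> c = c' \<and> d = d'"
proof -
  have "a + N * (b + N * (c + N * d)) = a' + N * (b' + N * (c' + N * d'))"
    using assms(1) by (simp add: algebra_simps power2_eq_square power3_eq_cube)
  from digit_eq[OF this assms(2,5)] have 1: "a = a'" "b + N * (c + N * d) = b' + N * (c' + N * d')" by auto
  from digit_eq[OF this(2) assms(3,6)] have 2: "b = b'" "c + N * d = c' + N * d'" by auto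
  from digit_eq[OF this(2) assms(4,7)] 1 2 show ?thesis
    by auto
qed

lemma ex_exponent_bound:
  fixes f :: "('x \<Rightarrow>\<^sub>0 nat) \<Rightarrow>\<^sub>0 'c::zero"
  obtains S where "\<And>m x. m \<in> Poly_Mapping.keys f \<Longrightarrow> Poly_Mapping.lookup m x \<le> S"
proof (rule that)
  fix m x assume m: "m \<in> Poly_Mapping.keys f"
  have "Poly_Mapping.lookup m x \<le> (\<Sum>x\<in>Poly_Mapping.keys m. Poly_Mapping.lookup m x)"
    by (cases "x \<in> Poly_Mapping.keys m") (auto simp: in_keys_iff intro: member_le_sum)
  also have "\<dots> \<le> (\<Sum>m\<in>Poly_Mapping.keys f. \<Sum>x\<in>Poly_Mapping.keys m. Poly_Mapping.lookup m x)"
    by (rule member_le_sum[OF m]) auto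
  finally show "Poly_Mapping.lookup m x \<le> (\<Sum>m\<in>Poly_Mapping.keys f. \<Sum>x\<in>Poly_Mapping.keys m. Poly_Mapping.lookup m x)" .
qed

lemma entry_inside: "B \<in> carrier_mat 2 4 \<Longrightarrow> i < 2 \<Longrightarrow> j < 4 \<Longrightarrow> entry B (i, j) = B $$ (i, j)"
  by (simp add: entry_def)

text \<open>
  The ideal of a coordinate subspace of a chart is generated by the entries \<open>E\<close> that vanish on it. The
  weights \<open>1\<close>, \<open>N\<close>, \<open>N ^ 2\<close>, \<open>N ^ 3\<close> of the four free entries separate monomials, so two monomials of
  equal weight have equal values.
\<close>

lemma dvd_poly_eval_linear_subvariety:
  fixes B :: "'r::comm_ring_1 mat" and f :: "(nat \<times> nat) cpoly"
  assumes hom: "comm_ring_hom h"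
    and cols: "j0 < j1" "c0 < c1" "j1 < 4" "c1 < 4" "c0 \<noteq> j0" "c0 \<noteq> j1" "c1 \<noteq> j0" "c1 \<noteq> j1"
    and B: "B \<in> chart 2 4 {j0, j1}"
    and E: "E \<subseteq> {0, 1} \<times> {c0, c1}" "\<And>i j. (i, j) \<in> E \<Longrightarrow> D dvd B $$ (i, j)"
    and vanish: "\<And>C :: complex mat. \<lbrakk>C \<in> chart 2 4 {j0, j1}; \<And>i j. (i, j) \<in> E \<Longrightarrow> C $$ (i, j) = 0\<rbrakk>
      \<Longrightarrow> poly_eval (\<lambda>c. c) (entry C) f = 0"
  shows "D dvd poly_eval h (entry B) f"
proof -
  note B' = B[unfolded chart_pair_iff[OF cols(1,3)]]
  obtain S where S: "\<And>m x. m \<in> Poly_Mapping.keys f \<Longrightarrow> Poly_Mapping.lookup m x \<le> S"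
    using ex_exponent_bound by blast
  define N where "N = Suc S"
  define n :: "nat \<times> nat \<Rightarrow> nat" where
    "n x = (if x = (0, c0) then 1 else if x = (0, c1) then N else
      if x = (1, c0) then N ^ 2 else if x = (1, c1) then N ^ 3 else 0)" for x
  define T where "T = {(0, j0), (1, j1)} \<union> ({0, 1} \<times> {c0, c1} - E)"
  have "{j0, j1, c0, c1} = {..<4}"
    by (rule card_subset_eq) (use cols in auto)
  then have all_cols: "j < 4 \<longleftrightarrow> j = j0 \<or> j = j1 \<or> j = c0 \<or> j = c1" for j by blast
  let ?all = "{(0, j0), (1, j1), (0, c0), (0, c1), (1, c0), (1, c1)}"
  have T: "T \<subseteq> ?all" by (auto simp: T_def)
  show ?thesis
  proof (rule dvd_poly_eval_if_vanishes_on_curve[OF hom, where T = T and n = n])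
    fix z :: complex
    define C where "C = mat 2 4 (\<lambda>x. if x \<in> T then z ^ n x else 0)"
    have "entry C = (\<lambda>x. if x \<in> T then z ^ n x else 0)"
      using T cols by (auto simp: entry_def C_def fun_eq_iff)
    moreover have "C \<in> chart 2 4 {j0, j1}"
      unfolding chart_pair_iff[OF cols(1,3)] using cols by (auto simp: C_def T_def n_def)
    moreover have "C $$ (i, j) = 0" if "(i, j) \<in> E" for i j
      using that E(1) cols by (auto simp: C_def T_def)
    ultimately show "poly_eval (\<lambda>c. c) (\<lambda>x. if x \<in> T then z ^ n x else 0) f = 0"
      using vanish[of C] by simp
  next
    fix x assume x: "x \<notin> T"
    obtain i j where ij: "x = (i, j)" by (cases x)
    show "D dvd entry B x"
    proof (cases "i < 2 \<and> j < 4")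
      case True
      then have "i = 0 \<or> i = 1" by (simp add: less_2_cases_iff)
      moreover have "j = j0 \<or> j = j1 \<or> j = c0 \<or> j = c1" using all_cols True by blast
      ultimately consider "(i, j) \<in> E" | "i = 0" "j = j1" | "i = 1" "j = j0"
        using x unfolding ij T_def by blast
      then show ?thesis
      proof cases
        case 1
        with True E(2) B' show ?thesis unfolding ij by (simp add: entry_def)
      qed (use B' cols in \<open>simp_all add: ij entry_def\<close>)
    next
      case False
      then show ?thesis using B' unfolding ij by (auto simp: entry_def)
    qed
  next
    fix m m' assume m: "m \<in> Poly_Mapping.keys f" "m' \<in> Poly_Mapping.keys f"
      "Poly_Mapping.keys m \<subseteq> T" "Poly_Mapping.keys m' \<subseteq> T" "monomial_weight n m = monomial_weight n m'"
    let ?l = "Poly_Mapping.lookup"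
    have wt: "monomial_weight n m = ?l m (0, c0) + ?l m (0, c1) * N + ?l m (1, c0) * N ^ 2 + ?l m (1, c1) * N ^ 3"
      if "Poly_Mapping.keys m \<subseteq> T" for m
      using cols order_trans[OF that T] by (subst monomial_weight_superset[of ?all]) (simp_all add: n_def)
    have val: "monomial_value (entry B) m = B $$ (0, c0) ^ ?l m (0, c0) * B $$ (0, c1) ^ ?l m (0, c1) *
        B $$ (1, c0) ^ ?l m (1, c0) * B $$ (1, c1) ^ ?l m (1, c1)"
      if "Poly_Mapping.keys m \<subseteq> T" for m
      using cols order_trans[OF that T] B' less_trans[OF cols(1,3)] less_trans[OF cols(2,4)]
      by (subst monomial_value_superset[of ?all]) (simp_all add: entry_inside mult.assoc)
    have "?l m x < N" "?l m' x < N" for x using S m(1,2) by (auto simp: N_def less_Suc_eq_le)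
    then have "?l m (0, c0) = ?l m' (0, c0) \<and> ?l m (0, c1) = ?l m' (0, c1) \<and> ?l m (1, c0) = ?l m' (1, c0)
        \<and> ?l m (1, c1) = ?l m' (1, c1)"
      using m(5) unfolding wt[OF m(3)] wt[OF m(4)] by (intro four_digits_eq) auto
    then show "D dvd monomial_value (entry B) m - monomial_value (entry B) m'"
      unfolding val[OF m(3)] val[OF m(4)] by simp
  qed
qed

lemma diff_dvd_power_diff: "x - y dvd x ^ k - (y :: 'r::comm_ring_1) ^ k"
proof (induction k)
  case (Suc k)
  have "x ^ Suc k - y ^ Suc k = x * (x ^ k - y ^ k) + (x - y) * y ^ k" by (simp add: algebra_simps)
  then show ?case using Suc by simp
qed simp

text \<open>
  Monomials in the entries of a \<open>2\<times>2\<close> matrix that have the same degree in each row and in each column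
  differ by exchanging a power of \<open>a * d\<close> for one of \<open>b * c\<close>.
\<close>

lemma toric_monomials_cong:
  fixes a b c d D :: "'r::comm_ring_1"
  assumes D: "D dvd a * d - b * c"
    and exps: "i + j = i' + j'" "k + l = k' + l'" "i + k = i' + k'" "j + l = j' + l'" "i \<le> i'"
  shows "D dvd a ^ i * b ^ j * c ^ k * d ^ l - a ^ i' * b ^ j' * c ^ k' * d ^ l'"
proof -
  define s where "s = i' - i"
  have s: "i' = i + s" "j = j' + s" "k = k' + s" "l' = l + s" using exps by (auto simp: s_def)
  have "a ^ i' * b ^ j' * c ^ k' * d ^ l' - a ^ i * b ^ j * c ^ k * d ^ l =
      a ^ i * b ^ j' * c ^ k' * d ^ l * ((a * d) ^ s - (b * c) ^ s)"
    unfolding s by (simp add: algebra_simps power_add power_mult_distrib)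
  moreover have "D dvd (a * d) ^ s - (b * c) ^ s"
    using D diff_dvd_power_diff dvd_trans by blast
  ultimately have "D dvd a ^ i' * b ^ j' * c ^ k' * d ^ l' - a ^ i * b ^ j * c ^ k * d ^ l"
    by (simp only: dvd_mult)
  then have "D dvd - (a ^ i' * b ^ j' * c ^ k' * d ^ l' - a ^ i * b ^ j * c ^ k * d ^ l)"
    by (simp only: dvd_minus_iff)
  then show ?thesis by (simp only: minus_diff_eq)
qed

text \<open>
  The ideal of the cone of matrices of rank at most one is generated by the determinant. The curve lies on this
  cone, and its weights separate the degrees in the two rows and the two columns; by
  \<open>toric_monomials_cong\<close> this is enough.
\<close>

lemma dvd_poly_eval_determinantal_variety:
  fixes B :: "'r::comm_ring_1 mat" and f :: "(nat \<times> nat) cpoly"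
  assumes hom: "comm_ring_hom h"
    and B: "B \<in> chart 2 4 {2, 3}"
    and D: "D dvd B $$ (0, 0) * B $$ (1, 1) - B $$ (0, 1) * B $$ (1, 0)"
    and vanish: "\<And>C :: complex mat. \<lbrakk>C \<in> chart 2 4 {2, 3};
        C $$ (0, 0) * C $$ (1, 1) - C $$ (0, 1) * C $$ (1, 0) = 0\<rbrakk>
      \<Longrightarrow> poly_eval (\<lambda>c. c) (entry C) f = 0"
  shows "D dvd poly_eval h (entry B) f"
proof -
  have cols: "(2::nat) < 3" "(3::nat) < 4" by auto
  note B' = B[unfolded chart_pair_iff[OF cols]]
  obtain S where S: "\<And>m x. m \<in> Poly_Mapping.keys f \<Longrightarrow> Poly_Mapping.lookup m x \<le> S"
    using ex_exponent_bound by blast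
  define N where "N = Suc (2 * S)"
  \<comment> \<open>the curve of rank one matrices with rows \<open>z (z^{N^2}, z^{N^3})\<close> and \<open>z^N (z^{N^2}, z^{N^3})\<close>\<close>
  define n :: "nat \<times> nat \<Rightarrow> nat" where
    "n x = (if x = (0, 0) then 1 + N ^ 2 else if x = (0, 1) then 1 + N ^ 3 else
      if x = (1, 0) then N + N ^ 2 else if x = (1, 1) then N + N ^ 3 else 0)" for x
  define T :: "(nat \<times> nat) set" where "T = {(0, 2), (1, 3), (0, 0), (0, 1), (1, 0), (1, 1)}"
  have finT: "finite T" by (simp add: T_def)
  show ?thesis
  proof (rule dvd_poly_eval_if_vanishes_on_curve[OF hom, where T = T and n = n])
    fix z :: complex
    define C where "C = mat 2 4 (\<lambda>x. if x \<in> T then z ^ n x else 0)"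
    have "entry C = (\<lambda>x. if x \<in> T then z ^ n x else 0)"
      by (auto simp: entry_def C_def fun_eq_iff T_def)
    moreover have "C \<in> chart 2 4 {2, 3}"
      unfolding chart_pair_iff[OF cols] by (auto simp: C_def T_def n_def)
    moreover have "C $$ (0, 0) * C $$ (1, 1) - C $$ (0, 1) * C $$ (1, 0) = 0"
      by (simp add: C_def T_def n_def power_add)
    ultimately show "poly_eval (\<lambda>c. c) (\<lambda>x. if x \<in> T then z ^ n x else 0) f = 0"
      using vanish[of C] by simp
  next
    fix x assume x: "x \<notin> T"
    obtain i j where ij: "x = (i, j)" by (cases x)
    have "entry B x = 0"
    proof (cases "i < 2 \<and> j < 4")
      case True
      then have "i = 0 \<or> i = 1" "j = 0 \<or> j = 1 \<or> j = 2 \<or> j = 3" by auto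
      then show ?thesis using x B' unfolding ij by (auto simp: T_def entry_def)
    next
      case False
      then show ?thesis using B' unfolding ij by (auto simp: entry_def)
    qed
    then show "D dvd entry B x" by simp
  next
    fix m m' assume m: "m \<in> Poly_Mapping.keys f" "m' \<in> Poly_Mapping.keys f"
      "Poly_Mapping.keys m \<subseteq> T" "Poly_Mapping.keys m' \<subseteq> T" "monomial_weight n m = monomial_weight n m'"
    let ?l = "Poly_Mapping.lookup"
    have wt: "monomial_weight n m = (?l m (0, 0) + ?l m (0, 1)) + (?l m (1, 0) + ?l m (1, 1)) * N +
        (?l m (0, 0) + ?l m (1, 0)) * N ^ 2 + (?l m (0, 1) + ?l m (1, 1)) * N ^ 3"
      if "Poly_Mapping.keys m \<subseteq> T" for m
      by (subst monomial_weight_superset[OF finT that]) (simp add: T_def n_def algebra_simps)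
    have val: "monomial_value (entry B) m = B $$ (0, 0) ^ ?l m (0, 0) * B $$ (0, 1) ^ ?l m (0, 1) *
        B $$ (1, 0) ^ ?l m (1, 0) * B $$ (1, 1) ^ ?l m (1, 1)"
      if "Poly_Mapping.keys m \<subseteq> T" for m
      using B' by (subst monomial_value_superset[OF finT that]) (simp add: T_def entry_inside mult.assoc)
    have bound: "?l m x + ?l m y < N" "?l m' x + ?l m' y < N" for x y
      using S[OF m(1), of x] S[OF m(1), of y] S[OF m(2), of x] S[OF m(2), of y] by (auto simp: N_def)
    have exps: "?l m (0, 0) + ?l m (0, 1) = ?l m' (0, 0) + ?l m' (0, 1) \<and>
        ?l m (1, 0) + ?l m (1, 1) = ?l m' (1, 0) + ?l m' (1, 1) \<and>
        ?l m (0, 0) + ?l m (1, 0) = ?l m' (0, 0) + ?l m' (1, 0) \<and>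
        ?l m (0, 1) + ?l m (1, 1) = ?l m' (0, 1) + ?l m' (1, 1)"
      using m(5) bound unfolding wt[OF m(3)] wt[OF m(4)] by (intro four_digits_eq) auto
    show "D dvd monomial_value (entry B) m - monomial_value (entry B) m'"
    proof (cases "?l m (0, 0) \<le> ?l m' (0, 0)")
      case True
      then show ?thesis unfolding val[OF m(3)] val[OF m(4)]
        using exps by (intro toric_monomials_cong[OF D]) auto
    next
      case False
      then have "D dvd monomial_value (entry B) m' - monomial_value (entry B) m"
        unfolding val[OF m(3)] val[OF m(4)]
        using exps by (intro toric_monomials_cong[OF D]) auto
      then have "D dvd - (monomial_value (entry B) m' - monomial_value (entry B) m)"
        by (simp only: dvd_minus_iff)
      then show ?thesis by (simp only: minus_diff_eq)
    qed
  qed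
qed

text \<open>
  If \<open>J\<close> is one of the coordinates in question, the minor \<open>J\<close> is 1 and nothing is to be shown. Otherwise each
  free entry of a chart matrix is, up to sign, the minor whose columns are that of the entry and one
  of the two columns of \<open>J\<close>, so the coordinates of this kind cut out a coordinate subspace. If the
  minor with both columns outside \<open>J\<close> is among the coordinates too, it vanishes on this subspace,
  except for the Schubert divisor in the chart \<open>{2, 3}\<close>, which is the determinantal cone.
\<close>

lemma schubert_minor_dvd_chart_ideal:
  fixes B :: "'r::comm_ring_1 mat"
  assumes hom: "comm_ring_hom h"
    and J: "J \<in> index_sets 2 4" and B: "B \<in> chart 2 4 J"
    and f: "f \<in> chart_ideal 2 4 J (schubert 2 4 a b)" and ab: "a \<in> {1, 2}" "b \<in> {1, 2}"
    and D: "\<And>J'. J' \<in> schubert_coords a b \<Longrightarrow> D dvd minor J' B"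
  shows "D dvd poly_eval h (entry B) f"
proof (cases "J \<in> schubert_coords a b")
  case True
  then have "D dvd 1" using D[OF True] minor_chart[OF B J] by simp
  then show ?thesis using dvd_trans one_dvd by blast
next
  case False
  from J obtain j0 j1 where j: "J = {j0, j1}" "j0 < j1" "j1 < 4" by (rule index_sets_2_4E)
  have "j0 = 0 \<or> j0 = 1 \<or> j0 = 2" "j1 = 1 \<or> j1 = 2 \<or> j1 = 3" using j(2,3) by arith+
  then have "\<exists>c0 c1. c0 < c1 \<and> c1 < 4 \<and> c0 \<noteq> j0 \<and> c0 \<noteq> j1 \<and> c1 \<noteq> j0 \<and> c1 \<noteq> j1"
  proof -
    let ?F = "{..<4} - {j0, j1}"
    have "card ?F = 2" using j(2,3) by (subst card_Diff_subset) auto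
    then obtain c d where "?F = {c, d}" "c \<noteq> d" by (auto simp: card_2_iff)
    then have "c \<in> ?F" "d \<in> ?F" by auto
    with \<open>c \<noteq> d\<close> show ?thesis by (cases c d rule: linorder_cases) blast+
  qed
  then obtain c0 c1 where c: "c0 < c1" "c1 < 4" "c0 \<noteq> j0" "c0 \<noteq> j1" "c1 \<noteq> j0" "c1 \<noteq> j1"
    by blast
  have vanish: "poly_eval (\<lambda>c. c) (entry C) f = 0"
    if C: "C \<in> chart 2 4 J" and "\<And>J'. J' \<in> schubert_coords a b \<Longrightarrow> minor J' C = 0" for C :: "complex mat"
  proof -
    have "row_span C \<in> schubert 2 4 a b"
      using schubert_row_span_iff_minors[OF chart_carrier[OF C] J _ ab] minor_chart[OF C J] that(2) by simp
    then show ?thesis using f C by (simp add: chart_ideal_def)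
  qed
  have minor0: "minor {j1, c} C = C $$ (0, c) \<or> minor {j1, c} C = - C $$ (0, c)"
    and minor1: "minor {j0, c} C = C $$ (1, c) \<or> minor {j0, c} C = - C $$ (1, c)"
    if "C \<in> chart 2 4 J" "c \<in> {c0, c1}" for c and C :: "'s::comm_ring_1 mat"
  proof -
    note C = that(1)[unfolded j(1) chart_pair_iff[OF j(2,3)]]
    have lt: "c < 4" "c \<noteq> j0" "c \<noteq> j1" "j0 < 4" using that(2) c j by auto
    show "minor {j1, c} C = C $$ (0, c) \<or> minor {j1, c} C = - C $$ (0, c)"
    proof (cases "c < j1")
      case True
      have "{j1, c} = {c, j1}" by blast
      then show ?thesis using C True j(3) minor_pair[of C c j1] by simp
    next
      case False
      then show ?thesis using C lt minor_pair[of C j1 c] by simp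
    qed
    show "minor {j0, c} C = C $$ (1, c) \<or> minor {j0, c} C = - C $$ (1, c)"
    proof (cases "c < j0")
      case True
      have "{j0, c} = {c, j0}" by blast
      then show ?thesis using C True lt minor_pair[of C c j0] by simp
    next
      case False
      then show ?thesis using C lt minor_pair[of C j0 c] by simp
    qed
  qed
  show ?thesis
  proof (cases "a = 1 \<and> b = 1 \<and> J = {2, 3}")
    case True
    have coords: "J' \<in> schubert_coords a b \<longleftrightarrow> J' = {0, 1}" for J'
    proof
      assume J': "J' \<in> schubert_coords a b"
      then obtain i j where "J' = {i, j}" "i < j" "j < 4"
        using schubert_coords_subset index_sets_2_4E by blast
      then show "J' = {0, 1}" using J' True schubert_coords_pair_iff[of i j a b] by auto
    next
      assume "J' = {0, 1}"
      then show "J' \<in> schubert_coords a b" using True schubert_coords_pair_iff[of 0 1 a b] by simp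
    qed
    show ?thesis
    proof (rule dvd_poly_eval_determinantal_variety[OF hom])
      show "B \<in> chart 2 4 {2, 3}" using B True by simp
      show "D dvd B $$ (0, 0) * B $$ (1, 1) - B $$ (0, 1) * B $$ (1, 0)"
        using D[of "{0, 1}"] minor_pair[OF chart_carrier[OF B], of 0 1] by (simp add: coords)
      show "poly_eval (\<lambda>c. c) (entry C) f = 0"
        if "C \<in> chart 2 4 {2, 3}" "C $$ (0, 0) * C $$ (1, 1) - C $$ (0, 1) * C $$ (1, 0) = 0" for C
      proof (rule vanish)
        show "C \<in> chart 2 4 J" using that(1) True by simp
        show "minor J' C = 0" if "J' \<in> schubert_coords a b" for J'
          using that \<open>C $$ (0, 0) * C $$ (1, 1) - C $$ (0, 1) * C $$ (1, 0) = 0\<close>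
            minor_pair[OF chart_carrier[OF \<open>C \<in> chart 2 4 {2, 3}\<close>], of 0 1] unfolding coords by simp
      qed
    qed
  next
    case det: False
    define E where "E = {(0::nat, c) | c. c \<in> {c0, c1} \<and> {j1, c} \<in> schubert_coords a b} \<union>
      {(1, c) | c. c \<in> {c0, c1} \<and> {j0, c} \<in> schubert_coords a b}"
    show ?thesis
    proof (rule dvd_poly_eval_linear_subvariety[OF hom j(2) c(1) j(3) c(2-6)])
      show "B \<in> chart 2 4 {j0, j1}" using B j by simp
      show "E \<subseteq> {0, 1} \<times> {c0, c1}" by (auto simp: E_def)
      show "D dvd B $$ (k, l)" if "(k, l) \<in> E" for k l
        using that
      proof (unfold E_def, elim UnE CollectE exE conjE)
        fix c assume "(k, l) = (0, c)" "c \<in> {c0, c1}" "{j1, c} \<in> schubert_coords a b"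
        then show ?thesis using D[of "{j1, c}"] minor0[OF B, of c] by auto
      next
        fix c assume "(k, l) = (1, c)" "c \<in> {c0, c1}" "{j0, c} \<in> schubert_coords a b"
        then show ?thesis using D[of "{j0, c}"] minor1[OF B, of c] by auto
      qed
    next
      fix C :: "complex mat"
      assume C: "C \<in> chart 2 4 {j0, j1}" and zero: "\<And>i j. (i, j) \<in> E \<Longrightarrow> C $$ (i, j) = 0"
      have C': "C \<in> chart 2 4 J" using C j by simp
      have zero0: "C $$ (0, c) = 0" if "c \<in> {c0, c1}" "{j1, c} \<in> schubert_coords a b" for c
        using that by (intro zero) (auto simp: E_def)
      have zero1: "C $$ (1, c) = 0" if "c \<in> {c0, c1}" "{j0, c} \<in> schubert_coords a b" for c
        using that by (intro zero) (auto simp: E_def)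
      have mem: "{i, k} \<in> schubert_coords a b \<longleftrightarrow> (if a = 1 then i \<le> b \<and> k \<le> b else i < b \<or> k < b)"
        if "i < 4" "k < 4" "i \<noteq> k" for i k
      proof (cases "i < k")
        case True
        then show ?thesis using schubert_coords_pair_iff[of i k a b] ab that by auto
      next
        case False
        moreover have "{i, k} = {k, i}" by blast
        ultimately show ?thesis using schubert_coords_pair_iff[of k i a b] ab that by auto
      qed
      have notin: "\<not> (if a = 1 then j0 \<le> b \<and> j1 \<le> b else j0 < b \<or> j1 < b)"
        using mem[of j0 j1] False j by auto
      show "poly_eval (\<lambda>c. c) (entry C) f = 0"
      proof (rule vanish[OF C'])
        fix J' assume J': "J' \<in> schubert_coords a b"
        have "J' \<in> index_sets 2 4" using J' schubert_coords_subset by blast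
        then obtain i k where ik: "J' = {i, k}" "i < k" "k < 4" by (rule index_sets_2_4E)
        have "{j0, j1, c0, c1} = {..<4}"
          by (rule card_subset_eq) (use j c in auto)
        then have "i \<in> {j0, j1, c0, c1}" "k \<in> {j0, j1, c0, c1}" using ik(2,3) by auto
        then consider "J' = {j0, j1}" | d where "J' = {j0, d}" "d \<in> {c0, c1}"
          | d where "J' = {j1, d}" "d \<in> {c0, c1}" | "J' = {c0, c1}"
          using ik(1,2) by blast
        then show "minor J' C = 0"
        proof cases
          case 1
          then show ?thesis using J' False j by simp
        next
          case (2 d)
          then show ?thesis using zero1[of d] minor1[OF C', of d] J' by auto
        next
          case (3 d)
          then show ?thesis using zero0[of d] minor0[OF C', of d] J' by auto
        next
          case 4
          have m: "minor J' C = C $$ (0, c0) * C $$ (1, c1) - C $$ (0, c1) * C $$ (1, c0)"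
            unfolding 4 by (rule minor_pair[OF chart_carrier[OF C] c(1,2)])
          show ?thesis
          proof (cases "a = 1")
            case True
            then have le: "c0 \<le> b" "c1 \<le> b" using J' mem[of c0 c1] c unfolding 4 by auto
            have "j0 \<le> b"
            proof (rule ccontr)
              assume "\<not> j0 \<le> b"
              then have "b = 1 \<and> j0 = 2 \<and> j1 = 3" using ab(2) le j c by auto
              then show False using det True j by simp
            qed
            then have "C $$ (1, c0) = 0" "C $$ (1, c1) = 0"
              using mem[of j0 c0] mem[of j0 c1] c j le True by (intro zero1; simp)+
            then show ?thesis unfolding m by simp
          next
            case False
            then have "c0 < b" using J' mem[of c0 c1] c unfolding 4 by auto
            then have "C $$ (0, c0) = 0" "C $$ (1, c0) = 0"
              using mem[of j0 c0] mem[of j1 c0] c j False by (intro zero0 zero1; simp)+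
            then show ?thesis unfolding m by simp
          qed
        qed
      qed
    qed
  qed
qed

definition minor_poly :: "nat set \<Rightarrow> (nat \<times> nat) cpoly" where
  "minor_poly J = poly_var (0, Min J) * poly_var (1, Max J) - poly_var (0, Max J) * poly_var (1, Min J)"

lemma poly_eval_minor_poly:
  assumes "comm_ring_hom h" "B \<in> carrier_mat 2 4" "J \<in> index_sets 2 4"
  shows "poly_eval h (entry B) (minor_poly J) = minor J B"
proof -
  from assms(3) obtain i j where ij: "J = {i, j}" "i < j" "j < 4" by (rule index_sets_2_4E)
  then have "Min J = i" "Max J = j" by auto
  then show ?thesis
    using ij minor_pair[OF assms(2) ij(2,3)] assms(2)
    by (simp add: minor_poly_def poly_eval_hom[OF assms(1)] entry_inside)
qed

text \<open>
  Row spans that contain each other give factors in both directions. Their product is 1 because some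
  minor is not zero, so both are units.
\<close>

lemma fps_ord_minor_row_span:
  fixes A B :: "'k::field fps mat"
  assumes A: "A \<in> carrier_mat 2 4" and B: "B \<in> carrier_mat 2 4"
    and "row_span A = row_span B" and unit: "J0 \<in> index_sets 2 4" "minor J0 B dvd 1"
    and J: "J \<in> index_sets 2 4"
  shows "fps_ord (minor J A) = fps_ord (minor J B)"
proof -
  obtain u where u: "\<And>J. J \<in> index_sets 2 4 \<Longrightarrow> minor J A = u * minor J B"
    using minor_eq_if_row_span_subset[OF B A] assms(3) by blast
  obtain v where v: "\<And>J. J \<in> index_sets 2 4 \<Longrightarrow> minor J B = v * minor J A"
    using minor_eq_if_row_span_subset[OF A B] assms(3) by blast
  have "minor J0 B * (1 - v * u) = 0"
    using u[OF unit(1)] v[OF unit(1)] by (simp add: algebra_simps)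
  moreover have "minor J0 B \<noteq> 0" using unit(2) by auto
  ultimately have "v * u = 1" by simp
  then have "fps_ord v + fps_ord u = 0" by (metis fps_ord_1 fps_ord_mult)
  then show ?thesis using u[OF J] by (simp add: add_eq_0_iff_both_eq_0)
qed

text \<open>
  The Pluecker coordinates lie in the ideal, which bounds the contact order from above in one chart.
  The bound from below has to hold in every chart that contains the arc.
\<close>

lemma contact_order_schubert:
  assumes A: "A \<in> carrier_mat 2 4" and J0: "J0 \<in> index_sets 2 4" "minor J0 A dvd 1"
    and ab: "a \<in> {1, 2}" "b \<in> {1, 2}"
  shows "contact_order 2 4 (row_span A) (schubert 2 4 a b) = (INF J\<in>schubert_coords a b. fps_ord (minor J A))"
proof (rule antisym)
  note hom = comm_ring_hom_comp[OF comm_ring_hom_fps_const comm_ring_hom_scal]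
  obtain B where B: "B \<in> chart 2 4 J0" "row_span B = row_span A"
    using ex_chart_representative[OF A J0] .
  note Bc = chart_carrier[OF B(1)]
  show "contact_order 2 4 (row_span A) (schubert 2 4 a b) \<le> (INF J\<in>schubert_coords a b. fps_ord (minor J A))"
  proof (rule INF_greatest)
    fix J assume J: "J \<in> schubert_coords a b"
    then have J': "J \<in> index_sets 2 4" using schubert_coords_subset by blast
    have "minor_poly J \<in> chart_ideal 2 4 J0 (schubert 2 4 a b)"
      unfolding chart_ideal_def
    proof (intro CollectI ballI impI)
      fix C :: "complex mat" assume C: "C \<in> chart 2 4 J0" "row_span C \<in> schubert 2 4 a b"
      then have "minor J C = 0"
        using schubert_row_span_iff_minors[OF chart_carrier[OF C(1)] J0(1) _ ab] minor_chart[OF C(1) J0(1)] J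
        by simp
      then show "poly_eval (\<lambda>c. c) (entry C) (minor_poly J) = 0"
        using poly_eval_minor_poly[OF comm_ring_hom_id chart_carrier[OF C(1)] J'] by simp
    qed
    moreover have "fps_ord (poly_eval (\<lambda>c. fps_const (scal c)) (entry B) (minor_poly J)) = fps_ord (minor J A)"
      using fps_ord_minor_row_span[OF Bc A B(2) J0 J'] poly_eval_minor_poly[OF hom Bc J'] by simp
    ultimately show "contact_order 2 4 (row_span A) (schubert 2 4 a b) \<le> fps_ord (minor J A)"
      unfolding contact_order_def using B J0(1)
      by (intro Inf_lower CollectI exI[of _ J0] exI[of _ B] exI[of _ "minor_poly J"]) simp
  qed
  show "(INF J\<in>schubert_coords a b. fps_ord (minor J A)) \<le> contact_order 2 4 (row_span A) (schubert 2 4 a b)"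
    unfolding contact_order_def
  proof (rule Inf_greatest)
    fix x assume "x \<in> {fps_ord (poly_eval (\<lambda>c. fps_const (scal c)) (entry B) f) | J B f.
            J \<in> index_sets 2 4 \<and> B \<in> chart 2 4 J \<and> row_span B = row_span A \<and>
            f \<in> chart_ideal 2 4 J (schubert 2 4 a b)}"
    then obtain J B f where x: "x = fps_ord (poly_eval (\<lambda>c. fps_const (scal c)) (entry B) f)"
      and B: "J \<in> index_sets 2 4" "B \<in> chart 2 4 J" "row_span B = row_span A"
      and f: "f \<in> chart_ideal 2 4 J (schubert 2 4 a b)" by blast
    let ?N = "INF J\<in>schubert_coords a b. fps_ord (minor J A)"
    have "t_pow ?N dvd poly_eval (\<lambda>c. fps_const (scal c)) (entry B) f"
    proof (rule schubert_minor_dvd_chart_ideal[OF hom B(1,2) f ab])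
      fix J' assume J': "J' \<in> schubert_coords a b"
      then have "J' \<in> index_sets 2 4" using schubert_coords_subset by blast
      from fps_ord_minor_row_span[OF chart_carrier[OF B(2)] A B(3) J0 this] J'
      show "t_pow ?N dvd minor J' B"
        using INF_lower[OF J', of "\<lambda>J. fps_ord (minor J A)"] by (simp add: fps_dvd_iff_ord)
    qed
    then show "?N \<le> x" by (simp add: fps_dvd_iff_ord x)
  qed
qed

section \<open>Contact strata and orders of Pluecker coordinates\<close>

lemma schubert_coords_eq:
  "schubert_coords 1 1 = {{0, 1}}"
  "schubert_coords 1 2 = {{0, 1}, {0, 2}, {1, 2}}"
  "schubert_coords 2 1 = {{0, 1}, {0, 2}, {0, 3}}"
  "schubert_coords 2 2 = {{0, 1}, {0, 2}, {0, 3}, {1, 2}, {1, 3}}"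
proof -
  have six: "J \<in> schubert_coords a b \<Longrightarrow> J \<in> {{0,1},{0,2},{0,3},{1,2},{1,3},{2,3}}" for J a b
    using schubert_coords_subset[of a b] by (simp only: index_sets_2_4[symmetric]) blast
  note mem = schubert_coords_pair_iff doubleton_eq_iff
  show "schubert_coords 1 1 = {{0, 1}}"
    by (intro equalityI subsetI; (frule six)?; elim insertE emptyE; simp add: mem)
  show "schubert_coords 1 2 = {{0, 1}, {0, 2}, {1, 2}}"
    by (intro equalityI subsetI; (frule six)?; elim insertE emptyE; simp add: mem)
  show "schubert_coords 2 1 = {{0, 1}, {0, 2}, {0, 3}}"
    by (intro equalityI subsetI; (frule six)?; elim insertE emptyE; simp add: mem)
  show "schubert_coords 2 2 = {{0, 1}, {0, 2}, {0, 3}, {1, 2}, {1, 3}}"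
    by (intro equalityI subsetI; (frule six)?; elim insertE emptyE; simp add: mem)
qed

definition has_unit_minor :: "'r::comm_ring_1 mat \<Rightarrow> bool" where
  "has_unit_minor A \<longleftrightarrow> A \<in> carrier_mat 2 4 \<and> (\<exists>J\<in>index_sets 2 4. minor J A dvd 1)"

lemma has_unit_minor_carrier: "has_unit_minor A \<Longrightarrow> A \<in> carrier_mat 2 4"
  by (simp add: has_unit_minor_def)

lemma has_unit_minor_chart: "J \<in> index_sets 2 4 \<Longrightarrow> A \<in> chart 2 4 J \<Longrightarrow> has_unit_minor A"
  using minor_chart[of A J] chart_carrier[of A J] unfolding has_unit_minor_def by (metis dvd_refl)

lemma arcs_eq: "arcs 2 4 = {row_span A | A. has_unit_minor A}"
  by (auto simp: arcs_def grassmannian_def has_unit_minor_def)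

definition minor_order :: "univ_field fps mat \<Rightarrow> nat set \<Rightarrow> enat" where
  "minor_order A J = fps_ord (minor J A)"

lemma minor_order_row_span:
  assumes "has_unit_minor A" "has_unit_minor B" "row_span A = row_span B" "J \<in> index_sets 2 4"
  shows "minor_order A J = minor_order B J"
  using assms fps_ord_minor_row_span[of A B _ J] unfolding minor_order_def has_unit_minor_def by blast

lemma contact_stratum_iff:
  assumes A: "has_unit_minor A"
  shows "row_span A \<in> contact_stratum 2 4 \<beta> \<longleftrightarrow>
    \<beta> 1 1 = minor_order A {0, 1} - \<beta> 2 2 \<and>
    \<beta> 1 2 = min (minor_order A {0, 1}) (min (minor_order A {0, 2}) (minor_order A {1, 2})) \<and>
    \<beta> 2 1 = min (minor_order A {0, 1}) (min (minor_order A {0, 2}) (minor_order A {0, 3})) \<and>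
    \<beta> 2 2 = min (minor_order A {0, 1}) (min (minor_order A {0, 2}) (min (minor_order A {0, 3})
      (min (minor_order A {1, 2}) (minor_order A {1, 3}))))"
proof -
  obtain J0 where J0: "J0 \<in> index_sets 2 4" "minor J0 A dvd 1" using A by (auto simp: has_unit_minor_def)
  note c = contact_order_schubert[OF has_unit_minor_carrier[OF A] J0, folded minor_order_def]
  have o: "schubert_order 2 4 (row_span A) a b = (INF J\<in>schubert_coords a b. minor_order A J)"
    if "a \<in> {1, 2}" "b \<in> {1, 2}" for a b
    using that c[OF that] by (auto simp: schubert_order_def)
  have o_eq: "schubert_order 2 4 (row_span A) 1 1 = minor_order A {0, 1}"
    "schubert_order 2 4 (row_span A) 1 2 = min (minor_order A {0, 1}) (min (minor_order A {0, 2}) (minor_order A {1, 2}))"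
    "schubert_order 2 4 (row_span A) 2 1 = min (minor_order A {0, 1}) (min (minor_order A {0, 2}) (minor_order A {0, 3}))"
    "schubert_order 2 4 (row_span A) 2 2 = min (minor_order A {0, 1}) (min (minor_order A {0, 2}) (min (minor_order A {0, 3})
      (min (minor_order A {1, 2}) (minor_order A {1, 3}))))"
    using o[of 1 1] o[of 1 2] o[of 2 1] o[of 2 2]
    unfolding schubert_coords_eq by (simp_all add: inf_min del: One_nat_def)
  have outside: "schubert_order 2 4 (row_span A) 3 b = 0" "schubert_order 2 4 (row_span A) a 3 = 0" for a b
    by (simp_all add: schubert_order_def)
  have Suc: "(1::nat) + 1 = 2" "(2::nat) + 1 = 3" by simp_all
  have p: "profile 2 4 (row_span A) 1 1 = minor_order A {0, 1} - profile 2 4 (row_span A) 2 2"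
    "profile 2 4 (row_span A) 1 2 = min (minor_order A {0, 1}) (min (minor_order A {0, 2}) (minor_order A {1, 2}))"
    "profile 2 4 (row_span A) 2 1 = min (minor_order A {0, 1}) (min (minor_order A {0, 2}) (minor_order A {0, 3}))"
    "profile 2 4 (row_span A) 2 2 = min (minor_order A {0, 1}) (min (minor_order A {0, 2}) (min (minor_order A {0, 3})
      (min (minor_order A {1, 2}) (minor_order A {1, 3}))))"
    unfolding profile_def Suc outside o_eq idiff_0_right by (rule refl)+
  have "row_span A \<in> arcs 2 4" using A by (auto simp: arcs_eq)
  moreover have "{1..2::nat} = {1, 2}" by auto
  ultimately have "row_span A \<in> contact_stratum 2 4 \<beta> \<longleftrightarrow>
      profile 2 4 (row_span A) 1 1 = \<beta> 1 1 \<and> profile 2 4 (row_span A) 1 2 = \<beta> 1 2 \<and>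
      profile 2 4 (row_span A) 2 1 = \<beta> 2 1 \<and> profile 2 4 (row_span A) 2 2 = \<beta> 2 2"
    by (simp add: contact_stratum_def conj_assoc del: One_nat_def)
  then have "row_span A \<in> contact_stratum 2 4 \<beta> \<longleftrightarrow>
      \<beta> 1 1 = minor_order A {0, 1} - \<beta> 2 2 \<and> \<beta> 1 2 = profile 2 4 (row_span A) 1 2 \<and>
      \<beta> 2 1 = profile 2 4 (row_span A) 2 1 \<and> \<beta> 2 2 = profile 2 4 (row_span A) 2 2"
    unfolding p(1) by metis
  then show ?thesis unfolding p(2-4) .
qed

definition order_locus :: "(nat set \<Rightarrow> enat) \<Rightarrow> univ_field fps vec set set" where
  "order_locus \<omega> = {row_span A | A. has_unit_minor A \<and> (\<forall>J\<in>index_sets 2 4. \<omega> J \<le> minor_order A J)}"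

lemma row_span_in_order_locus_iff:
  assumes "has_unit_minor A"
  shows "row_span A \<in> order_locus \<omega> \<longleftrightarrow> (\<forall>J\<in>index_sets 2 4. \<omega> J \<le> minor_order A J)"
proof
  assume "row_span A \<in> order_locus \<omega>"
  then obtain B where B: "row_span A = row_span B" "has_unit_minor B" "\<forall>J\<in>index_sets 2 4. \<omega> J \<le> minor_order B J"
    by (auto simp: order_locus_def)
  then show "\<forall>J\<in>index_sets 2 4. \<omega> J \<le> minor_order A J"
    using minor_order_row_span[OF assms B(2,1)] by simp
qed (use assms in \<open>auto simp: order_locus_def\<close>)

definition minor_coeff_poly :: "nat set \<Rightarrow> nat \<Rightarrow> (nat \<times> nat \<times> nat) cpoly" where
  "minor_coeff_poly J p = (\<Sum>l = 0..p. poly_var (0, Min J, l) * poly_var (1, Max J, p - l))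
     - (\<Sum>l = 0..p. poly_var (0, Max J, l) * poly_var (1, Min J, p - l))"

lemma poly_eval_minor_coeff_poly:
  assumes "B \<in> carrier_mat 2 4" "J \<in> index_sets 2 4"
  shows "poly_eval scal (arc_coord B) (minor_coeff_poly J p) = fps_nth (minor J B) p"
proof -
  from assms(2) obtain i j where ij: "J = {i, j}" "i < j" "j < 4" by (rule index_sets_2_4E)
  then have "Min J = i" "Max J = j" by auto
  then show ?thesis
    using ij minor_pair[OF assms(1) ij(2,3)] assms(1)
    by (simp add: minor_coeff_poly_def poly_eval_hom[OF comm_ring_hom_scal] arc_coord_def entry_inside fps_mult_nth)
qed

text \<open>
  The coefficient of \<open>t ^ p\<close> in a minor is a polynomial in the arc coordinates.
\<close>

lemma zariski_closed_order_locus: "zariski_closed 2 4 (order_locus \<omega>)"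
  unfolding zariski_closed_def
proof (intro conjI ballI)
  show "order_locus \<omega> \<subseteq> arcs 2 4" by (auto simp: order_locus_def arcs_eq)
  fix J assume J: "J \<in> index_sets 2 4"
  let ?S = "{minor_coeff_poly J' p | J' p. J' \<in> index_sets 2 4 \<and> enat p < \<omega> J'}"
  show "\<exists>S. \<forall>B\<in>chart 2 4 J. row_span B \<in> order_locus \<omega> \<longleftrightarrow> (\<forall>f\<in>S. poly_eval scal (arc_coord B) f = 0)"
  proof (intro exI[of _ ?S] ballI)
    fix B :: "univ_field fps mat" assume B: "B \<in> chart 2 4 J"
    have "row_span B \<in> order_locus \<omega> \<longleftrightarrow>
        (\<forall>J'\<in>index_sets 2 4. \<forall>p. enat p < \<omega> J' \<longrightarrow> fps_nth (minor J' B) p = 0)"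
      unfolding row_span_in_order_locus_iff[OF has_unit_minor_chart[OF J B]] minor_order_def fps_ord_ge_iff ..
    also have "\<dots> \<longleftrightarrow> (\<forall>f\<in>?S. poly_eval scal (arc_coord B) f = 0)"
      using poly_eval_minor_coeff_poly[OF chart_carrier[OF B]] by fastforce
    finally show "row_span B \<in> order_locus \<omega> \<longleftrightarrow> (\<forall>f\<in>?S. poly_eval scal (arc_coord B) f = 0)" .
  qed
qed

text \<open>
  A polynomial in the arc coordinates becomes a polynomial in \<open>\<rho>\<close> along the family. If it vanishes for
  all but finitely many elements \<open>\<rho>\<close> of the infinite field, it vanishes at 0 too.
\<close>

lemma zariski_closed_affine_family:
  fixes g g' :: "nat \<Rightarrow> nat \<Rightarrow> univ_field fps"
  defines "F \<equiv> \<lambda>\<rho>. mat 2 4 (\<lambda>(i, j). g i j + fps_const \<rho> * g' i j)"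
  assumes Z: "zariski_closed 2 4 Z" and J: "J \<in> index_sets 2 4"
    and chart: "\<And>\<rho>. F \<rho> \<in> chart 2 4 J"
    and fin: "finite {\<rho>. row_span (F \<rho>) \<notin> Z}"
  shows "row_span (F 0) \<in> Z"
proof -
  have "\<exists>S. \<forall>B\<in>chart 2 4 J. row_span B \<in> Z \<longleftrightarrow> (\<forall>f\<in>S. poly_eval scal (arc_coord B) f = 0)"
    using Z J unfolding zariski_closed_def by (elim conjE) (rule bspec)
  then obtain S where "\<forall>B\<in>chart 2 4 J. row_span B \<in> Z \<longleftrightarrow> (\<forall>f\<in>S. poly_eval scal (arc_coord B) f = 0)"
    by (rule exE)
  note S = this[rule_format]
  define P where "P = (\<lambda>(i, j, p). if i < 2 \<and> j < (4::nat) then [:fps_nth (g i j) p, fps_nth (g' i j) p:] else 0)"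
  have coord: "arc_coord (F \<rho>) = (\<lambda>x. poly (P x) \<rho>)" for \<rho>
    by (auto simp: fun_eq_iff arc_coord_def entry_def F_def P_def)
  have "poly_eval scal (arc_coord (F 0)) f = 0" if f: "f \<in> S" for f
  proof -
    define q where "q = poly_eval (\<lambda>c. [:scal c:]) P f"
    have q: "poly_eval scal (arc_coord (F \<rho>)) f = poly q \<rho>" for \<rho>
      using hom_poly_eval[OF comm_ring_hom_poly[of \<rho>], of "\<lambda>c. [:scal c:]" P f] by (simp add: q_def coord)
    have "\<rho> \<in> {\<rho>. row_span (F \<rho>) \<notin> Z} \<or> poly q \<rho> = 0" for \<rho>
      using S[OF chart[of \<rho>]] f q[of \<rho>] by auto
    then have "UNIV = {\<rho>. row_span (F \<rho>) \<notin> Z} \<union> {\<rho>. poly q \<rho> = 0}" by blast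
    then have "infinite {\<rho>. poly q \<rho> = 0}" using fin infinite_univ_field by (metis finite_Un)
    then have "q = 0" using poly_roots_finite by blast
    then show ?thesis using q by simp
  qed
  then show ?thesis using S[OF chart[of 0]] by simp
qed

section \<open>Generic orders\<close>

text \<open>
  The orders of the Pluecker coordinates of the network matrix with the generic weighting. The entry
  that gives the coordinate \<open>{0, 2}\<close> is the sum of two path weights, hence the minimum.
\<close>

definition generic_order :: "(nat \<Rightarrow> nat \<Rightarrow> enat) \<Rightarrow> nat set \<Rightarrow> enat" where
  "generic_order \<beta> J =
    (if J = {0, 1} then \<beta> 2 2 + \<beta> 1 1
     else if J = {0, 2} then min (\<beta> 1 1) (\<beta> 1 2 + (\<beta> 2 1 - \<beta> 2 2))
     else if J = {0, 3} then \<beta> 2 1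
     else if J = {1, 2} then \<beta> 1 2
     else if J = {1, 3} then \<beta> 2 2 else 0)"

lemma generic_order_simps:
  "generic_order \<beta> {0, 1} = \<beta> 2 2 + \<beta> 1 1"
  "generic_order \<beta> {0, 2} = min (\<beta> 1 1) (\<beta> 1 2 + (\<beta> 2 1 - \<beta> 2 2))"
  "generic_order \<beta> {0, 3} = \<beta> 2 1"
  "generic_order \<beta> {1, 2} = \<beta> 1 2"
  "generic_order \<beta> {1, 3} = \<beta> 2 2"
  "generic_order \<beta> {2, 3} = 0"
  by (simp_all add: generic_order_def doubleton_eq_iff del: One_nat_def)

lemma ball_index_sets_2_4:
  "(\<forall>J\<in>index_sets 2 4. P J) \<longleftrightarrow> P {0, 1} \<and> P {0, 2} \<and> P {0, 3} \<and> P {1, 2} \<and> P {1, 3} \<and> P {2, 3}"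
  unfolding index_sets_2_4 by simp

lemma plane_partition_2_2:
  "plane_partition 2 2 \<beta> \<longleftrightarrow> \<beta> 2 2 \<le> \<beta> 1 2 \<and> \<beta> 2 2 \<le> \<beta> 2 1 \<and> \<beta> 1 2 \<le> \<beta> 1 1 \<and> \<beta> 2 1 \<le> \<beta> 1 1"
proof -
  have "{1..2::nat} = {1, 2}" by auto
  moreover have "(1::nat) + 1 = 2" by simp
  ultimately show ?thesis unfolding plane_partition_def by (simp del: One_nat_def add_2_eq_Suc') blast
qed

lemma enat_diff_add: "a \<le> c \<Longrightarrow> a + (c - a) = (c :: enat)"
  by (cases a; cases c) auto

lemma enat_le_add_diff:
  assumes "a \<le> b" "a \<le> c" shows "c \<le> b + (c - a :: enat)"
  using add_right_mono[OF assms(1), of "c - a"] enat_diff_add[OF assms(2)] by simp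

lemma enat_add_diff_le:
  assumes "a \<le> c" "b + c \<le> x + a" "a \<noteq> \<infinity>" shows "b + (c - a) \<le> (x :: enat)"
  using assms by (cases a; cases b; cases c; cases x) auto

text \<open>
  Here \<open>xij\<close> is the order of the coordinate \<open>{i, j}\<close> and \<open>rel\<close> expresses the Pluecker relation. If
  \<open>x13\<close> is the minimum \<open>a\<close>, the relation gives the bound. Otherwise the minimum is attained at a
  coordinate that also occurs in \<open>b\<close> or in \<open>c\<close>; then \<open>a = b\<close> or \<open>a = c\<close>, and \<open>b + (c - a)\<close> is \<open>c\<close>
  or \<open>b\<close>.
\<close>

lemma minor_order_stratum_ge_aux:
  fixes a b c d :: enat
  assumes a: "a = min x01 (min x02 (min x03 (min x12 x13)))"
    and b: "b = min x01 (min x02 x12)" and c: "c = min x01 (min x02 x03)"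
    and d: "d = x01 - a" and rel: "min (x01 + x23) (x03 + x12) \<le> x02 + x13"
  shows "min d (b + (c - a)) \<le> x02"
proof (cases "a = \<infinity>")
  case True
  then show ?thesis using a by (simp add: min_def split: if_splits)
next
  case fin: False
  have le: "a \<le> x01" "a \<le> b" "a \<le> c" "b \<le> x02" "c \<le> x02" "b \<le> x12" "c \<le> x03"
    unfolding a b c by (auto simp: min_le_iff_disj)
  show ?thesis
  proof (cases "x13 = a")
    case True
    show ?thesis
    proof (cases "x01 + x23 \<le> x02 + a")
      case True
      have "x01 \<le> x01 + x23" by (cases x01; cases x23) auto
      from order_trans[OF this True] have "x01 \<le> x02 + a" .
      then have "d \<le> x02" unfolding d using fin by (cases a; cases x01; cases x02) auto
      then show ?thesis by (simp add: min.coboundedI1)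
    next
      case False
      then have "x03 + x12 \<le> x02 + a" using rel \<open>x13 = a\<close> by (simp add: min_def split: if_splits)
      then have "b + c \<le> x02 + a" using add_mono[OF le(6,7)] by (simp add: add.commute)
      then have "b + (c - a) \<le> x02" using enat_add_diff_le le(3) fin by blast
      then show ?thesis by (simp add: min.coboundedI2)
    qed
  next
    case False
    then have "a = b \<or> a = c" using a unfolding b c by (auto simp: min_def split: if_splits)
    then show ?thesis
    proof
      assume "a = b"
      then have "b + (c - a) = c" using enat_diff_add[OF le(3)] by simp
      then show ?thesis using le(5) by (simp add: min.coboundedI2)
    next
      assume "a = c"
      then have "b + (c - a) = b" using fin by (cases c) (auto simp: zero_enat_def)
      then show ?thesis using min.coboundedI2[OF le(4), of d] by (simp only:)
    qed
  qed
qed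

lemma contact_stratum_subset_order_locus: "contact_stratum 2 4 \<beta> \<subseteq> order_locus (generic_order \<beta>)"
proof
  fix L assume L: "L \<in> contact_stratum 2 4 \<beta>"
  then have "L \<in> arcs 2 4" by (simp add: contact_stratum_def)
  then obtain A where A: "has_unit_minor A" "L = row_span A" by (auto simp: arcs_eq)
  let ?x = "minor_order A"
  note iff = L[unfolded A(2) contact_stratum_iff[OF A(1)]]
  have m: "minor {i, j} A = A $$ (0, i) * A $$ (1, j) - A $$ (0, j) * A $$ (1, i)" if "i < j" "j < 4" for i j
    using minor_pair[OF has_unit_minor_carrier[OF A(1)] that] .
  have "minor {0, 2} A * minor {1, 3} A = minor {0, 1} A * minor {2, 3} A + minor {0, 3} A * minor {1, 2} A"
    by (simp add: m algebra_simps del: One_nat_def)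
  then have "?x {0, 2} + ?x {1, 3} = fps_ord (minor {0, 1} A * minor {2, 3} A + minor {0, 3} A * minor {1, 2} A)"
    unfolding minor_order_def by (metis fps_ord_mult)
  moreover have "min (?x {0, 1} + ?x {2, 3}) (?x {0, 3} + ?x {1, 2}) \<le> \<dots>"
    unfolding minor_order_def by (intro fps_ord_add_ge) simp_all
  ultimately have rel: "min (?x {0, 1} + ?x {2, 3}) (?x {0, 3} + ?x {1, 2}) \<le> ?x {0, 2} + ?x {1, 3}"
    by simp
  have a: "\<beta> 2 2 = min (?x {0, 1}) (min (?x {0, 2}) (min (?x {0, 3}) (min (?x {1, 2}) (?x {1, 3}))))"
    and b: "\<beta> 1 2 = min (?x {0, 1}) (min (?x {0, 2}) (?x {1, 2}))"
    and c: "\<beta> 2 1 = min (?x {0, 1}) (min (?x {0, 2}) (?x {0, 3}))"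
    and d: "\<beta> 1 1 = ?x {0, 1} - \<beta> 2 2"
    using iff by blast+
  have "\<beta> 2 2 \<le> ?x {0, 1}" "\<beta> 2 2 \<le> ?x {1, 3}" "\<beta> 1 2 \<le> ?x {1, 2}" "\<beta> 2 1 \<le> ?x {0, 3}"
    unfolding a b c by (simp_all add: min_le_iff_disj)
  moreover have "\<beta> 2 2 + \<beta> 1 1 = ?x {0, 1}" using enat_diff_add[OF calculation(1)] d by simp
  moreover have "min (\<beta> 1 1) (\<beta> 1 2 + (\<beta> 2 1 - \<beta> 2 2)) \<le> ?x {0, 2}"
    by (rule minor_order_stratum_ge_aux[OF a b c d rel])
  ultimately show "L \<in> order_locus (generic_order \<beta>)"
    unfolding A(2) row_span_in_order_locus_iff[OF A(1)] ball_index_sets_2_4 generic_order_simps by simp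
qed


section \<open>Deformations in the opposite big cell\<close>

text \<open>
  The matrices with rows \<open>(R, S)\<close> and \<open>(P, Q)\<close> whose determinant has order at least \<open>f\<close> are limits of
  those with unit entries and order exactly \<open>f\<close>. A primitive vector proportional to the row \<open>(R, S)\<close>
  exists because of two power series over a field one divides the other. Adding a multiple of it to
  the row \<open>(P, Q)\<close> keeps the determinant and makes \<open>P\<close> or \<open>Q\<close> a unit. A perturbation of the
  cofactor of this unit makes the order of the determinant exact, and elementary row and column
  operations with generic coefficients turn all entries into units. The proof runs through these steps
  from the last to the first.
\<close>

lemma determinantal_locus_deformation:
  fixes G :: "'k::field fps \<Rightarrow> 'k fps \<Rightarrow> 'k fps \<Rightarrow> 'k fps \<Rightarrow> bool"
  assumes deform: "\<And>P Q R S P' Q' R' S'.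
      finite {\<rho>. \<not> G (P + fps_const \<rho> * P') (Q + fps_const \<rho> * Q') (R + fps_const \<rho> * R') (S + fps_const \<rho> * S')}
      \<Longrightarrow> G P Q R S"
    and base: "\<And>P Q R S. \<lbrakk>fps_ord P = 0; fps_ord Q = 0; fps_ord R = 0; fps_ord S = 0;
        fps_ord (R * Q - S * P) = f\<rbrakk> \<Longrightarrow> G P Q R S"
    and ord: "f \<le> fps_ord (R * Q - S * P)"
  shows "G P Q R S"
proof -
  note bad = finite_non_generic_order
  \<comment> \<open>add \<open>\<rho>\<close> times the first column to the second\<close>
  have PR: "G P Q R S" if "fps_ord P = 0" "fps_ord R = 0" "fps_ord (R * Q - S * P) = f" for P Q R S
  proof (rule deform[of P 0 Q P R 0 S R], rule finite_subset)
    show "{\<rho>. \<not> G (P + fps_const \<rho> * 0) (Q + fps_const \<rho> * P) (R + fps_const \<rho> * 0) (S + fps_const \<rho> * R)}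
      \<subseteq> {\<rho>. fps_ord (Q + fps_const \<rho> * P) \<noteq> 0} \<union> {\<rho>. fps_ord (S + fps_const \<rho> * R) \<noteq> 0}"
      using base[of P _ R _] that by (auto simp: algebra_simps)
    show "finite ({\<rho>. fps_ord (Q + fps_const \<rho> * P) \<noteq> 0} \<union> {\<rho>. fps_ord (S + fps_const \<rho> * R) \<noteq> 0})"
      using bad[of P 0 Q] bad[of R 0 S] that by simp
  qed
  \<comment> \<open>add \<open>\<rho>\<close> times the row \<open>(P, Q)\<close> to the row \<open>(R, S)\<close>\<close>
  have P: "G P Q R S" if "fps_ord P = 0" "fps_ord (R * Q - S * P) = f" for P Q R S
  proof (rule deform[of P 0 Q 0 R P S Q], rule finite_subset)
    show "{\<rho>. \<not> G (P + fps_const \<rho> * 0) (Q + fps_const \<rho> * 0) (R + fps_const \<rho> * P) (S + fps_const \<rho> * Q)}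
      \<subseteq> {\<rho>. fps_ord (R + fps_const \<rho> * P) \<noteq> 0}"
      using PR[of P _ Q _] that by (auto simp: algebra_simps)
    show "finite {\<rho>. fps_ord (R + fps_const \<rho> * P) \<noteq> 0}" using bad[of P 0 R] that by simp
  qed
  \<comment> \<open>add \<open>\<rho>\<close> times the second column to the first\<close>
  have Q: "G P Q R S" if "fps_ord Q = 0" "fps_ord (R * Q - S * P) = f" for P Q R S
  proof (rule deform[of P Q Q 0 R S S 0], rule finite_subset)
    show "{\<rho>. \<not> G (P + fps_const \<rho> * Q) (Q + fps_const \<rho> * 0) (R + fps_const \<rho> * S) (S + fps_const \<rho> * 0)}
      \<subseteq> {\<rho>. fps_ord (P + fps_const \<rho> * Q) \<noteq> 0}"
      using P[of _ _ Q S] that by (auto simp: algebra_simps)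
    show "finite {\<rho>. fps_ord (P + fps_const \<rho> * Q) \<noteq> 0}" using bad[of Q 0 P] that by simp
  qed
  \<comment> \<open>make the order of the determinant exact\<close>
  have PQ: "G P Q R S" if unit: "fps_ord P = 0 \<or> fps_ord Q = 0" and le: "f \<le> fps_ord (R * Q - S * P)" for P Q R S
    using unit
  proof
    assume Q0: "fps_ord Q = 0"
    show ?thesis
    proof (rule deform[of P 0 Q 0 R "t_pow f" S 0], rule finite_subset)
      show "{\<rho>. \<not> G (P + fps_const \<rho> * 0) (Q + fps_const \<rho> * 0) (R + fps_const \<rho> * t_pow f) (S + fps_const \<rho> * 0)}
        \<subseteq> {\<rho>. fps_ord ((R * Q - S * P) + fps_const \<rho> * (t_pow f * Q)) \<noteq> f}"
        using Q[OF Q0, of _ S P] by (auto simp: algebra_simps)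
      show "finite {\<rho>. fps_ord ((R * Q - S * P) + fps_const \<rho> * (t_pow f * Q)) \<noteq> f}"
        using Q0 le by (intro bad) simp_all
    qed
  next
    assume P0: "fps_ord P = 0"
    show ?thesis
    proof (rule deform[of P 0 Q 0 R 0 S "t_pow f"], rule finite_subset)
      show "{\<rho>. \<not> G (P + fps_const \<rho> * 0) (Q + fps_const \<rho> * 0) (R + fps_const \<rho> * 0) (S + fps_const \<rho> * t_pow f)}
        \<subseteq> {\<rho>. fps_ord ((R * Q - S * P) + fps_const \<rho> * (- (t_pow f * P))) \<noteq> f}"
        using P[OF P0, of R Q] by (auto simp: algebra_simps)
      show "finite {\<rho>. fps_ord ((R * Q - S * P) + fps_const \<rho> * (- (t_pow f * P))) \<noteq> f}"
        using P0 le by (intro bad) simp_all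
    qed
  qed
  \<comment> \<open>add \<open>\<rho>\<close> times \<open>(1, k)\<close> or \<open>(k, 1)\<close> to the row \<open>(P, Q)\<close>\<close>
  show ?thesis
  proof (cases "fps_ord R \<le> fps_ord S")
    case True
    then obtain k where k: "S = R * k" by (auto simp flip: fps_dvd_iff_ord)
    show ?thesis
    proof (rule deform[of P 1 Q k R 0 S 0], rule finite_subset)
      show "{\<rho>. \<not> G (P + fps_const \<rho> * 1) (Q + fps_const \<rho> * k) (R + fps_const \<rho> * 0) (S + fps_const \<rho> * 0)}
        \<subseteq> {\<rho>. fps_ord (P + fps_const \<rho> * 1) \<noteq> 0}"
        using PQ[of _ _ R S] ord by (auto simp: k algebra_simps)
      show "finite {\<rho>. fps_ord (P + fps_const \<rho> * 1) \<noteq> 0}" by (intro bad) simp_all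
    qed
  next
    case False
    then have "fps_ord S \<le> fps_ord R" by simp
    then obtain k where k: "R = S * k" by (auto simp flip: fps_dvd_iff_ord)
    show ?thesis
    proof (rule deform[of P k Q 1 R 0 S 0], rule finite_subset)
      show "{\<rho>. \<not> G (P + fps_const \<rho> * k) (Q + fps_const \<rho> * 1) (R + fps_const \<rho> * 0) (S + fps_const \<rho> * 0)}
        \<subseteq> {\<rho>. fps_ord (Q + fps_const \<rho> * 1) \<noteq> 0}"
        using PQ[of _ _ R S] ord by (auto simp: k algebra_simps)
      show "finite {\<rho>. fps_ord (Q + fps_const \<rho> * 1) \<noteq> 0}" by (intro bad) simp_all
    qed
  qed
qed

text \<open>
  The arc of the big cell with coordinates \<open>p\<close>, \<open>q\<close>, \<open>r\<close>, \<open>s\<close>: up to sign these are the minors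
  \<open>{0, 2}\<close>, \<open>{1, 2}\<close>, \<open>{0, 3}\<close>, \<open>{1, 3}\<close>, and the minor \<open>{0, 1}\<close> is \<open>r * q - s * p\<close>.
\<close>

definition cell :: "'r \<Rightarrow> 'r \<Rightarrow> 'r \<Rightarrow> 'r \<Rightarrow> 'r::comm_ring_1 mat" where
  "cell p q r s = mat 2 4 (\<lambda>(i, j). if i = 0
     then (if j = 0 then r else if j = 1 then s else if j = 2 then 1 else 0)
     else (if j = 0 then p else if j = 1 then q else if j = 2 then 0 else 1))"

lemma cell_in_chart: "cell p q r s \<in> chart 2 4 {2, 3}"
  by (subst chart_pair_iff) (simp_all add: cell_def)

lemma cell_has_unit_minor: "has_unit_minor (cell p q r s)"
  by (rule has_unit_minor_chart[OF _ cell_in_chart]) (simp add: index_sets_2_4)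

lemma chart_eq_cell:
  assumes "B \<in> chart 2 4 {2, 3}"
  shows "B = cell (B $$ (1, 0)) (B $$ (1, 1)) (B $$ (0, 0)) (B $$ (0, 1))"
proof (rule eq_matI)
  have B: "B \<in> carrier_mat 2 4" "B $$ (0, 2) = 1" "B $$ (0, 3) = 0" "B $$ (1, 2) = 0" "B $$ (1, 3) = 1"
    using assms by (simp_all add: chart_pair_iff)
  fix i j assume "i < dim_row (cell (B $$ (1, 0)) (B $$ (1, 1)) (B $$ (0, 0)) (B $$ (0, 1)))"
    "j < dim_col (cell (B $$ (1, 0)) (B $$ (1, 1)) (B $$ (0, 0)) (B $$ (0, 1)))"
  then have "i = 0 \<or> i = 1" "j = 0 \<or> j = 1 \<or> j = 2 \<or> j = 3" by (auto simp: cell_def)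
  then show "B $$ (i, j) = cell (B $$ (1, 0)) (B $$ (1, 1)) (B $$ (0, 0)) (B $$ (0, 1)) $$ (i, j)"
    using B(2-5) by (elim disjE) (simp_all add: cell_def)
qed (use chart_carrier[OF assms] in \<open>simp_all add: cell_def\<close>)

lemma minor_order_cell:
  "minor_order (cell p q r s) {0, 1} = fps_ord (r * q - s * p)"
  "minor_order (cell p q r s) {0, 2} = fps_ord p"
  "minor_order (cell p q r s) {0, 3} = fps_ord r"
  "minor_order (cell p q r s) {1, 2} = fps_ord q"
  "minor_order (cell p q r s) {1, 3} = fps_ord s"
  "minor_order (cell p q r s) {2, 3} = 0"
  using chart_carrier[OF cell_in_chart[of p q r s]]
  by (simp_all add: minor_order_def minor_pair del: One_nat_def) (simp_all add: cell_def)

lemma zariski_closed_cell_deformation: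
  assumes Z: "zariski_closed 2 4 Z"
    and fin: "finite {\<rho>. row_span (cell (p + fps_const \<rho> * p') (q + fps_const \<rho> * q')
      (r + fps_const \<rho> * r') (s + fps_const \<rho> * s')) \<notin> Z}"
  shows "row_span (cell p q r s) \<in> Z"
proof -
  define g' where "g' i j = (if i = 0 then (if j = 0 then r' else if j = 1 then s' else 0)
     else (if j = 0 then p' else if j = 1 then q' else 0))" for i j :: nat
  have F: "mat 2 4 (\<lambda>(i, j). cell p q r s $$ (i, j) + fps_const \<rho> * g' i j) =
    cell (p + fps_const \<rho> * p') (q + fps_const \<rho> * q') (r + fps_const \<rho> * r') (s + fps_const \<rho> * s')" for \<rho>
    by (rule eq_matI) (auto simp: cell_def g'_def)
  have J: "{2, 3} \<in> index_sets 2 4" by (simp add: index_sets_2_4)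
  from zariski_closed_affine_family[OF Z J, of "\<lambda>i j. cell p q r s $$ (i, j)" g', unfolded F, OF cell_in_chart fin]
  show ?thesis by simp
qed

lemma cell_in_contact_stratum:
  assumes \<beta>: "plane_partition 2 2 \<beta>"
    and "fps_ord q = \<beta> 1 2" "fps_ord r = \<beta> 2 1" "fps_ord s = \<beta> 2 2" "\<beta> 1 2 \<le> fps_ord p" "\<beta> 2 1 \<le> fps_ord p"
      "fps_ord (r * q - s * p) = \<beta> 2 2 + \<beta> 1 1"
  shows "row_span (cell p q r s) \<in> contact_stratum 2 4 \<beta>"
proof -
  note ineq = \<beta>[unfolded plane_partition_2_2]
  have le: "\<beta> 2 1 \<le> \<beta> 2 2 + \<beta> 1 1" "\<beta> 1 2 \<le> \<beta> 2 2 + \<beta> 1 1" "\<beta> 2 2 \<le> \<beta> 2 2 + \<beta> 1 1" "\<beta> 2 2 \<le> fps_ord p"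
  proof -
    have "\<beta> 1 1 \<le> \<beta> 2 2 + \<beta> 1 1" by (simp add: add_increasing)
    then show "\<beta> 2 1 \<le> \<beta> 2 2 + \<beta> 1 1" "\<beta> 1 2 \<le> \<beta> 2 2 + \<beta> 1 1"
      using ineq order_trans by blast+
    show "\<beta> 2 2 \<le> \<beta> 2 2 + \<beta> 1 1" by (simp add: add_increasing2)
    show "\<beta> 2 2 \<le> fps_ord p" using ineq assms(5) order_trans by blast
  qed
  have diff: "\<beta> 1 1 = \<beta> 2 2 + \<beta> 1 1 - \<beta> 2 2"
  proof (cases "\<beta> 2 2 = \<infinity>")
    case True
    then have "\<beta> 1 1 = \<infinity>" using ineq by (metis enat_ord_simps(5))
    then show ?thesis using True by simp
  next
    case False
    then show ?thesis by (cases "\<beta> 2 2"; cases "\<beta> 1 1") auto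
  qed
  show ?thesis
    unfolding contact_stratum_iff[OF cell_has_unit_minor] minor_order_cell assms(2-4,7)
    using le ineq assms(5,6) by (intro conjI diff) (simp_all add: min_absorb2)
qed

text \<open>
  The bounds on the entries imply the one on the determinant. First \<open>q\<close>, \<open>r\<close> and \<open>s\<close> are perturbed to
  exact order; then a perturbation of \<open>p\<close> by \<open>\<rho> * t ^ \<beta> 1 1\<close> changes the determinant by a series of order exactly
  \<open>\<beta> 2 2 + \<beta> 1 1\<close>.
\<close>

lemma cell_in_closed_if_unconstrained:
  assumes \<beta>: "plane_partition 2 2 \<beta>" and Z: "zariski_closed 2 4 Z" "contact_stratum 2 4 \<beta> \<subseteq> Z"
    and le: "\<beta> 2 2 + \<beta> 1 1 \<le> \<beta> 1 2 + \<beta> 2 1"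
    and ord: "\<beta> 1 1 \<le> fps_ord p" "\<beta> 1 2 \<le> fps_ord q" "\<beta> 2 1 \<le> fps_ord r" "\<beta> 2 2 \<le> fps_ord s"
  shows "row_span (cell p q r s) \<in> Z"
proof -
  note ineq = \<beta>[unfolded plane_partition_2_2]
  note bad = finite_non_generic_order
  have exact: "row_span (cell p q r s) \<in> Z"
    if qrs: "fps_ord q = \<beta> 1 2" "fps_ord r = \<beta> 2 1" "fps_ord s = \<beta> 2 2" for q r s
  proof (rule zariski_closed_cell_deformation[OF Z(1), of p "t_pow (\<beta> 1 1)" q 0 r 0 s 0], rule finite_subset)
    show "{\<rho>. row_span (cell (p + fps_const \<rho> * t_pow (\<beta> 1 1)) (q + fps_const \<rho> * 0) (r + fps_const \<rho> * 0) (s + fps_const \<rho> * 0)) \<notin> Z}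
      \<subseteq> {\<rho>. fps_ord ((r * q - s * p) + fps_const \<rho> * (- (s * t_pow (\<beta> 1 1)))) \<noteq> \<beta> 2 2 + \<beta> 1 1}"
    proof (intro subsetI CollectI notI; elim CollectE notE)
      fix \<rho> assume *: "fps_ord ((r * q - s * p) + fps_const \<rho> * (- (s * t_pow (\<beta> 1 1)))) = \<beta> 2 2 + \<beta> 1 1"
      have "\<beta> 1 1 \<le> fps_ord (p + fps_const \<rho> * t_pow (\<beta> 1 1))"
        using ord(1) by (intro fps_ord_add_ge) (simp_all add: add_increasing)
      then have "row_span (cell (p + fps_const \<rho> * t_pow (\<beta> 1 1)) q r s) \<in> contact_stratum 2 4 \<beta>"
        using * qrs ineq by (intro cell_in_contact_stratum[OF \<beta>]) (auto simp: algebra_simps)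
      then show "row_span (cell (p + fps_const \<rho> * t_pow (\<beta> 1 1)) (q + fps_const \<rho> * 0) (r + fps_const \<rho> * 0) (s + fps_const \<rho> * 0)) \<in> Z"
        using Z(2) by auto
    qed
    show "finite {\<rho>. fps_ord ((r * q - s * p) + fps_const \<rho> * (- (s * t_pow (\<beta> 1 1)))) \<noteq> \<beta> 2 2 + \<beta> 1 1}"
    proof (rule bad)
      show "\<beta> 2 2 + \<beta> 1 1 \<le> fps_ord (r * q - s * p)"
        using qrs le ord(1) by (intro fps_ord_diff_ge) (simp_all add: add.commute add_left_mono)
    qed (use qrs in simp)
  qed
  show ?thesis
  proof (rule zariski_closed_cell_deformation[OF Z(1), of p 0 q "t_pow (\<beta> 1 2)" r "t_pow (\<beta> 2 1)" s "t_pow (\<beta> 2 2)"], rule finite_subset)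
    show "{\<rho>. row_span (cell (p + fps_const \<rho> * 0) (q + fps_const \<rho> * t_pow (\<beta> 1 2)) (r + fps_const \<rho> * t_pow (\<beta> 2 1)) (s + fps_const \<rho> * t_pow (\<beta> 2 2))) \<notin> Z}
      \<subseteq> {\<rho>. fps_ord (q + fps_const \<rho> * t_pow (\<beta> 1 2)) \<noteq> \<beta> 1 2} \<union> {\<rho>. fps_ord (r + fps_const \<rho> * t_pow (\<beta> 2 1)) \<noteq> \<beta> 2 1}
        \<union> {\<rho>. fps_ord (s + fps_const \<rho> * t_pow (\<beta> 2 2)) \<noteq> \<beta> 2 2}"
      using exact by auto
    show "finite ({\<rho>. fps_ord (q + fps_const \<rho> * t_pow (\<beta> 1 2)) \<noteq> \<beta> 1 2} \<union> {\<rho>. fps_ord (r + fps_const \<rho> * t_pow (\<beta> 2 1)) \<noteq> \<beta> 2 1}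
        \<union> {\<rho>. fps_ord (s + fps_const \<rho> * t_pow (\<beta> 2 2)) \<noteq> \<beta> 2 2})"
      using ord by (intro finite_UnI bad) simp_all
  qed
qed

text \<open>
  After division of \<open>p\<close>, \<open>q\<close>, \<open>r\<close>, \<open>s\<close> by \<open>t\<close> to the exponents \<open>m\<close>, \<open>\<beta> 1 2\<close>, \<open>\<beta> 2 1\<close>, \<open>\<beta> 2 2\<close> the
  determinant is divided by \<open>t\<close> to the exponent \<open>\<beta> 1 2 + \<beta> 2 1 = \<beta> 2 2 + m\<close>, and the only condition that remains is
  \<open>f \<le> ord (R * Q - S * P)\<close>.
\<close>

lemma cell_in_closed_if_determinantal:
  assumes \<beta>: "plane_partition 2 2 \<beta>" and Z: "zariski_closed 2 4 Z" "contact_stratum 2 4 \<beta> \<subseteq> Z"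
    and less: "\<beta> 1 2 + \<beta> 2 1 < \<beta> 2 2 + \<beta> 1 1"
    and ord: "\<beta> 1 2 + (\<beta> 2 1 - \<beta> 2 2) \<le> fps_ord p" "\<beta> 1 2 \<le> fps_ord q" "\<beta> 2 1 \<le> fps_ord r" "\<beta> 2 2 \<le> fps_ord s"
      "\<beta> 2 2 + \<beta> 1 1 \<le> fps_ord (r * q - s * p)"
  shows "row_span (cell p q r s) \<in> Z"
proof -
  note ineq = \<beta>[unfolded plane_partition_2_2]
  define m where "m = \<beta> 1 2 + (\<beta> 2 1 - \<beta> 2 2)"
  define f where "f = (\<beta> 2 2 + \<beta> 1 1) - (\<beta> 1 2 + \<beta> 2 1)"
  have am: "\<beta> 2 2 + m = \<beta> 1 2 + \<beta> 2 1"
    using enat_diff_add[of "\<beta> 2 2" "\<beta> 2 1"] ineq by (simp add: m_def add.left_commute)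
  have f: "(\<beta> 1 2 + \<beta> 2 1) + f = \<beta> 2 2 + \<beta> 1 1"
    unfolding f_def using less by (intro enat_diff_add) simp
  have fin: "\<beta> 1 2 + \<beta> 2 1 \<noteq> \<infinity>"
  proof
    assume "\<beta> 1 2 + \<beta> 2 1 = \<infinity>"
    with less show False by (simp only: enat_ord_simps)
  qed
  have bm: "\<beta> 1 2 \<le> m" "\<beta> 2 1 \<le> m"
    using enat_le_add_diff[of "\<beta> 2 2" "\<beta> 1 2" "\<beta> 2 1"] ineq by (simp_all add: m_def)
  have pow: "t_pow (\<beta> 2 2) * t_pow m = t_pow (\<beta> 2 1) * (t_pow (\<beta> 1 2) :: univ_field fps)"
  proof -
    have "\<beta> 2 2 + m \<noteq> \<infinity>" using fin by (simp only: am not_False_eq_True)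
    then have "\<beta> 2 2 \<noteq> \<infinity>" "m \<noteq> \<infinity>" unfolding plus_eq_infty_iff_enat by simp_all
    moreover have "\<beta> 1 2 \<noteq> \<infinity>" "\<beta> 2 1 \<noteq> \<infinity>" using fin unfolding plus_eq_infty_iff_enat by simp_all
    ultimately have "\<exists>x y z w. \<beta> 2 2 = enat x \<and> m = enat y \<and> \<beta> 1 2 = enat z \<and> \<beta> 2 1 = enat w"
      by (simp only: not_infinity_eq) blast
    then obtain x y z w where n: "\<beta> 2 2 = enat x" "m = enat y" "\<beta> 1 2 = enat z" "\<beta> 2 1 = enat w" by blast
    then have "x + y = w + z" using am by simp
    then show ?thesis unfolding n by (simp add: t_pow_def flip: power_add)
  qed
  define G where "G P Q R S \<longleftrightarrow>
    row_span (cell (t_pow m * P) (t_pow (\<beta> 1 2) * Q) (t_pow (\<beta> 2 1) * R) (t_pow (\<beta> 2 2) * S)) \<in> Z" for P Q R S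
  have det: "(t_pow (\<beta> 2 1) * R) * (t_pow (\<beta> 1 2) * Q) - (t_pow (\<beta> 2 2) * S) * (t_pow m * P) =
      (t_pow (\<beta> 2 1) * t_pow (\<beta> 1 2)) * (R * Q - S * P)" for P Q R S :: "univ_field fps"
  proof -
    have "(t_pow (\<beta> 2 2) * S) * (t_pow m * P) = (t_pow (\<beta> 2 2) * t_pow m) * (S * P)" by (simp only: mult_ac)
    moreover have "(t_pow (\<beta> 2 1) * R) * (t_pow (\<beta> 1 2) * Q) = (t_pow (\<beta> 2 1) * t_pow (\<beta> 1 2)) * (R * Q)" by (simp only: mult_ac)
    ultimately show ?thesis unfolding pow by (simp only: right_diff_distrib)
  qed
  obtain P Q R S where PQRS: "p = t_pow m * P" "q = t_pow (\<beta> 1 2) * Q" "r = t_pow (\<beta> 2 1) * R" "s = t_pow (\<beta> 2 2) * S"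
  proof -
    have "t_pow m dvd p" "t_pow (\<beta> 1 2) dvd q" "t_pow (\<beta> 2 1) dvd r" "t_pow (\<beta> 2 2) dvd s"
      using ord by (simp_all add: fps_dvd_iff_ord m_def)
    then show ?thesis using that by (elim dvdE) blast
  qed
  have "G P Q R S"
  proof (rule determinantal_locus_deformation[where G = G and f = f])
    fix P Q R S P' Q' R' S'
    assume "finite {\<rho>. \<not> G (P + fps_const \<rho> * P') (Q + fps_const \<rho> * Q') (R + fps_const \<rho> * R') (S + fps_const \<rho> * S')}"
    then show "G P Q R S"
      unfolding G_def distrib_left mult.left_commute[of "t_pow _" "fps_const _"]
      by (rule zariski_closed_cell_deformation[OF Z(1)])
  next
    fix P Q R S :: "univ_field fps"
    assume units: "fps_ord P = 0" "fps_ord Q = 0" "fps_ord R = 0" "fps_ord S = 0" "fps_ord (R * Q - S * P) = f"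
    have "row_span (cell (t_pow m * P) (t_pow (\<beta> 1 2) * Q) (t_pow (\<beta> 2 1) * R) (t_pow (\<beta> 2 2) * S)) \<in> contact_stratum 2 4 \<beta>"
    proof (rule cell_in_contact_stratum[OF \<beta>])
      show "fps_ord ((t_pow (\<beta> 2 1) * R) * (t_pow (\<beta> 1 2) * Q) - (t_pow (\<beta> 2 2) * S) * (t_pow m * P)) = \<beta> 2 2 + \<beta> 1 1"
        unfolding det fps_ord_mult fps_ord_t_pow units(5) f[symmetric] by (simp only: add.commute)
    qed (use units bm in simp_all)
    then show "G P Q R S" unfolding G_def using Z(2) by blast
  next
    have "(\<beta> 1 2 + \<beta> 2 1) + f \<le> (\<beta> 1 2 + \<beta> 2 1) + fps_ord (R * Q - S * P)"
      using ord(5) unfolding PQRS det fps_ord_mult fps_ord_t_pow f by (simp only: add.commute)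
    then show "f \<le> fps_ord (R * Q - S * P)" using fin by (auto simp only: enat_add_left_cancel_le)
  qed
  then show ?thesis unfolding G_def PQRS .
qed


section \<open>Moving arcs into the opposite big cell\<close>

text \<open>
  Up to sign the minor of the set \<open>{i, j}\<close>. Being alternating in \<open>i\<close> and \<open>j\<close>, it saves distinguishing
  which column comes first.
\<close>

definition column_minor :: "'r::comm_ring_1 mat \<Rightarrow> nat \<Rightarrow> nat \<Rightarrow> 'r" where
  "column_minor A i j = A $$ (0, i) * A $$ (1, j) - A $$ (0, j) * A $$ (1, i)"

lemma minor_order_column_minor:
  assumes "A \<in> carrier_mat 2 4" "i < 4" "j < 4" "i \<noteq> j"
  shows "minor_order A {i, j} = fps_ord (column_minor A i j)"
proof (cases "i < j")
  case True
  then show ?thesis using minor_pair[OF assms(1) True assms(3)] by (simp add: minor_order_def column_minor_def)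
next
  case False
  have "{i, j} = {j, i}" by blast
  moreover have "column_minor A i j = - column_minor A j i" by (simp add: column_minor_def)
  ultimately show ?thesis using False assms minor_pair[OF assms(1), of j i]
    by (simp only: fps_ord_uminus minor_order_def) (simp add: column_minor_def)
qed

lemma row_span_in_order_locus_iff_columns:
  assumes A: "has_unit_minor A"
  shows "row_span A \<in> order_locus \<omega> \<longleftrightarrow>
    (\<forall>i j. i < 4 \<longrightarrow> j < 4 \<longrightarrow> i \<noteq> j \<longrightarrow> \<omega> {i, j} \<le> fps_ord (column_minor A i j))"
    (is "_ \<longleftrightarrow> ?R")
proof -
  note c = minor_order_column_minor[OF has_unit_minor_carrier[OF A]]
  have "(\<forall>J\<in>index_sets 2 4. \<omega> J \<le> minor_order A J) \<longleftrightarrow> ?R"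
  proof
    assume L: "\<forall>J\<in>index_sets 2 4. \<omega> J \<le> minor_order A J"
    show ?R
    proof (intro allI impI)
      fix i j :: nat assume ij: "i < 4" "j < 4" "i \<noteq> j"
      then have "{i, j} \<in> index_sets 2 4" by (simp add: index_sets_def)
      then show "\<omega> {i, j} \<le> fps_ord (column_minor A i j)" using L c[OF ij] by (metis (full_types))
    qed
  next
    assume R: ?R
    show "\<forall>J\<in>index_sets 2 4. \<omega> J \<le> minor_order A J"
    proof
      fix J assume "J \<in> index_sets 2 4"
      then obtain i j where ij: "J = {i, j}" "i < j" "j < 4" by (rule index_sets_2_4E)
      then show "\<omega> J \<le> minor_order A J" using R c[of i j] by simp
    qed
  qed
  then show ?thesis using row_span_in_order_locus_iff[OF A] by simp
qed

text \<open>
  Add \<open>\<rho>\<close> times column \<open>k\<close> to the later column \<open>l\<close>. The arc stays in the chart \<open>{k, m}\<close> since \<open>l\<close> is not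
  one of its columns, and it stays in the order locus since \<open>\<omega>\<close> does not grow when a column index moves
  to the right. The minor \<open>{l, m}\<close> changes by \<open>\<rho>\<close> times the minor \<open>{k, m}\<close>, which is \<open>\<plusminus>1\<close>; so a
  generic member lies in the chart \<open>{l, m}\<close> as well.
\<close>

lemma chart_inclusion_by_column_move:
  assumes Z: "zariski_closed 2 4 Z"
    and mono: "\<And>k l m. \<lbrakk>k < l; l < 4; m < 4; m \<noteq> k; m \<noteq> l\<rbrakk> \<Longrightarrow> \<omega> {l, m} \<le> \<omega> {k, m}"
    and klm: "k < l" "l < 4" "m < 4" "m \<noteq> k" "m \<noteq> l"
    and target: "\<And>B. B \<in> chart 2 4 {l, m} \<Longrightarrow> row_span B \<in> order_locus \<omega> \<Longrightarrow> row_span B \<in> Z"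
    and A: "A \<in> chart 2 4 {k, m}" "row_span A \<in> order_locus \<omega>"
  shows "row_span A \<in> Z"
proof -
  have J: "{k, m} \<in> index_sets 2 4" "{l, m} \<in> index_sets 2 4" using klm by (simp_all add: index_sets_def)
  have Ac: "A \<in> carrier_mat 2 4" using A(1) by (rule chart_carrier)
  define g' where "g' i j = (if j = l then A $$ (i, k) else 0)" for i j
  define F where "F \<rho> = mat 2 4 (\<lambda>(i, j). A $$ (i, j) + fps_const \<rho> * g' i j)" for \<rho>
  have F: "F \<rho> \<in> carrier_mat 2 4" for \<rho> by (simp add: F_def)
  have F_index: "F \<rho> $$ (i, j) = (if j = l then A $$ (i, l) + fps_const \<rho> * A $$ (i, k) else A $$ (i, j))"
    if "i < 2" "j < 4" for i j \<rho> using that by (simp add: F_def g'_def)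
  have chart: "F \<rho> \<in> chart 2 4 {k, m}" for \<rho>
  proof (cases "k < m")
    case True
    then show ?thesis using A(1) F[of \<rho>] klm by (simp add: chart_pair_iff F_index)
  next
    case False
    then have mk: "m < k" "k < 4" using klm by auto
    have eq: "{k, m} = {m, k}" by blast
    show ?thesis using A(1) F[of \<rho>] klm mk unfolding eq by (simp add: chart_pair_iff F_index)
  qed
  note unitF = has_unit_minor_chart[OF J(1) chart]
  have minors: "column_minor (F \<rho>) i j = (if i = l then column_minor A l j + fps_const \<rho> * column_minor A k j
      else if j = l then column_minor A i l + fps_const \<rho> * column_minor A i k else column_minor A i j)"
    if "i < 4" "j < 4" "i \<noteq> j" for i j \<rho>
    using that klm by (simp add: column_minor_def F_index algebra_simps)
  have unitA: "has_unit_minor A" by (rule has_unit_minor_chart[OF J(1) A(1)])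
  have ordA: "\<omega> {i, j} \<le> fps_ord (column_minor A i j)" if "i < 4" "j < 4" "i \<noteq> j" for i j
    using A(2) that unfolding row_span_in_order_locus_iff_columns[OF unitA] by blast
  have self: "column_minor A i i = 0" for i by (simp add: column_minor_def)
  have comm: "\<omega> {i, j} = \<omega> {j, i}" for i j by (simp only: insert_commute)
  have ord_k: "\<omega> {l, j} \<le> fps_ord (column_minor A k j)" "\<omega> {j, l} \<le> fps_ord (column_minor A j k)"
    if "j < 4" "j \<noteq> l" for j
  proof -
    show "\<omega> {l, j} \<le> fps_ord (column_minor A k j)"
    proof (cases "j = k")
      case False
      then show ?thesis using mono[of k l j] ordA[of k j] klm that order_trans by simp
    qed (simp add: self)
    show "\<omega> {j, l} \<le> fps_ord (column_minor A j k)"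
    proof (cases "j = k")
      case False
      then show ?thesis using mono[of k l j] ordA[of j k] klm that order_trans
        by (simp add: comm[of j])
    qed (simp add: self)
  qed
  have scale: "n \<le> fps_ord x \<Longrightarrow> n \<le> fps_ord (fps_const \<rho> * x)" for n \<rho> and x :: "univ_field fps"
    by (simp add: add_increasing)
  have locus: "row_span (F \<rho>) \<in> order_locus \<omega>" for \<rho>
    unfolding row_span_in_order_locus_iff_columns[OF unitF]
  proof (intro allI impI)
    fix i j :: nat assume ij: "i < 4" "j < 4" "i \<noteq> j"
    consider "i = l" | "i \<noteq> l" "j = l" | "i \<noteq> l" "j \<noteq> l" by blast
    then show "\<omega> {i, j} \<le> fps_ord (column_minor (F \<rho>) i j)"
    proof cases
      case 1
      have "\<omega> {l, j} \<le> fps_ord (column_minor A l j + fps_const \<rho> * column_minor A k j)"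
        using ij 1 klm by (intro fps_ord_add_ge ordA scale ord_k) auto
      then show ?thesis unfolding minors[OF ij] using 1 by simp
    next
      case 2
      have "\<omega> {i, l} \<le> fps_ord (column_minor A i l + fps_const \<rho> * column_minor A i k)"
        using ij 2 klm by (intro fps_ord_add_ge ordA scale ord_k) auto
      then show ?thesis unfolding minors[OF ij] using 2 by simp
    next
      case 3
      then show ?thesis using minors[OF ij] ordA[OF ij] by simp
    qed
  qed
  have F0: "F 0 = A"
    using Ac by (intro eq_matI) (simp_all add: F_def)
  have "row_span (F 0) \<in> Z"
    unfolding F_def
  proof (rule zariski_closed_affine_family[OF Z J(1)])
    show "mat 2 4 (\<lambda>(i, j). A $$ (i, j) + fps_const \<rho> * g' i j) \<in> chart 2 4 {k, m}" for \<rho>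
      using chart[of \<rho>] by (simp only: F_def)
    have "row_span (F \<rho>) \<in> Z" if "fps_ord (column_minor A l m + fps_const \<rho> * column_minor A k m) = 0" for \<rho>
    proof -
      have "minor_order (F \<rho>) {l, m} = 0"
        using that minors[of l m \<rho>] minor_order_column_minor[OF F, of l m \<rho>] klm by simp
      then have "minor {l, m} (F \<rho>) dvd 1" by (simp only: minor_order_def fps_unit_iff_ord)
      then obtain B where "B \<in> chart 2 4 {l, m}" "row_span B = row_span (F \<rho>)"
        using ex_chart_representative[OF F J(2)] by blast
      then show ?thesis using target[of B] locus[of \<rho>] by simp
    qed
    then have "{\<rho>. row_span (F \<rho>) \<notin> Z} \<subseteq>
        {\<rho>. fps_ord (column_minor A l m + fps_const \<rho> * column_minor A k m) \<noteq> 0}" by blast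
    moreover have "fps_ord (column_minor A k m) = 0"
      using minor_chart[OF A(1) J(1)] minor_order_column_minor[OF Ac, of k m] klm
      by (simp add: minor_order_def)
    then have "finite {\<rho>. fps_ord (column_minor A l m + fps_const \<rho> * column_minor A k m) \<noteq> 0}"
      by (rule finite_non_generic_order) simp
    ultimately show "finite {\<rho>. row_span (mat 2 4 (\<lambda>(i, j). A $$ (i, j) + fps_const \<rho> * g' i j)) \<notin> Z}"
      unfolding F_def by (rule finite_subset)
  qed
  then show ?thesis by (simp only: F0)
qed

lemma generic_order_mono:
  assumes \<beta>: "plane_partition 2 2 \<beta>" and klm: "k < l" "l < 4" "m < 4" "m \<noteq> k" "m \<noteq> l"
  shows "generic_order \<beta> {l, m} \<le> generic_order \<beta> {k, m}"
proof -
  note ineq = \<beta>[unfolded plane_partition_2_2]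
  have d: "\<beta> 1 1 \<le> \<beta> 2 2 + \<beta> 1 1" by (simp add: add_increasing)
  have comm: "generic_order \<beta> {i, j} = generic_order \<beta> {j, i}" for i j by (simp only: insert_commute)
  note o = generic_order_simps generic_order_simps[of \<beta>, unfolded comm[of 0 1] comm[of 0 2] comm[of 0 3] comm[of 1 2] comm[of 1 3] comm[of 2 3]]
  have le: "\<beta> 1 2 \<le> min (\<beta> 1 1) (\<beta> 1 2 + (\<beta> 2 1 - \<beta> 2 2))" "\<beta> 2 1 \<le> min (\<beta> 1 1) (\<beta> 1 2 + (\<beta> 2 1 - \<beta> 2 2))"
    "min (\<beta> 1 1) (\<beta> 1 2 + (\<beta> 2 1 - \<beta> 2 2)) \<le> \<beta> 2 2 + \<beta> 1 1"
    "\<beta> 1 2 \<le> \<beta> 2 2 + \<beta> 1 1" "\<beta> 2 1 \<le> \<beta> 2 2 + \<beta> 1 1" "\<beta> 2 2 \<le> \<beta> 2 2 + \<beta> 1 1"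
    using ineq enat_le_add_diff[of "\<beta> 2 2" "\<beta> 1 2" "\<beta> 2 1"] order_trans[OF _ d]
    by (simp_all add: min.coboundedI1 del: One_nat_def)
  have "k = 0 \<or> k = 1 \<or> k = 2" "l = 1 \<or> l = 2 \<or> l = 3" "m = 0 \<or> m = 1 \<or> m = 2 \<or> m = 3"
    using klm by arith+
  then show ?thesis
    using klm le ineq by (elim disjE) (simp_all add: o del: One_nat_def)
qed

text \<open>
  In the chart \<open>{2, 3}\<close> the two deformation lemmas apply. Column moves lead to this chart from \<open>{1, 3}\<close>,
  \<open>{0, 3}\<close>, \<open>{1, 2}\<close> and \<open>{0, 2}\<close>, and from \<open>{0, 1}\<close> to \<open>{1, 2}\<close>.
\<close>

theorem order_locus_subset_closed:
  assumes \<beta>: "plane_partition 2 2 \<beta>" and Z: "zariski_closed 2 4 Z" "contact_stratum 2 4 \<beta> \<subseteq> Z"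
  shows "order_locus (generic_order \<beta>) \<subseteq> Z"
proof -
  let ?P = "\<lambda>J. \<forall>A\<in>chart 2 4 J. row_span A \<in> order_locus (generic_order \<beta>) \<longrightarrow> row_span A \<in> Z"
  have cell: "?P {2, 3}"
  proof (intro ballI impI)
    fix A :: "univ_field fps mat"
    assume A: "A \<in> chart 2 4 {2, 3}" "row_span A \<in> order_locus (generic_order \<beta>)"
    obtain p q r s where eq: "A = cell p q r s" using chart_eq_cell[OF A(1)] by blast
    have ord: "\<beta> 2 2 + \<beta> 1 1 \<le> fps_ord (r * q - s * p)" "min (\<beta> 1 1) (\<beta> 1 2 + (\<beta> 2 1 - \<beta> 2 2)) \<le> fps_ord p"
      "\<beta> 2 1 \<le> fps_ord r" "\<beta> 1 2 \<le> fps_ord q" "\<beta> 2 2 \<le> fps_ord s"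
      using A(2) unfolding eq row_span_in_order_locus_iff[OF cell_has_unit_minor] ball_index_sets_2_4
        minor_order_cell generic_order_simps by blast+
    note ineq = \<beta>[unfolded plane_partition_2_2]
    have sum: "\<beta> 2 2 + (\<beta> 1 2 + (\<beta> 2 1 - \<beta> 2 2)) = \<beta> 1 2 + \<beta> 2 1"
      using enat_diff_add[of "\<beta> 2 2" "\<beta> 2 1"] ineq by (simp add: add.left_commute)
    show "row_span A \<in> Z"
    proof (cases "\<beta> 2 2 + \<beta> 1 1 \<le> \<beta> 1 2 + \<beta> 2 1")
      case True
      have "\<beta> 1 1 \<le> fps_ord p"
      proof (cases "\<beta> 2 2 = \<infinity>")
        case True
        then show ?thesis using ineq ord(2) by simp
      next
        case False
        then have "\<beta> 1 1 \<le> \<beta> 1 2 + (\<beta> 2 1 - \<beta> 2 2)"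
          using True unfolding sum[symmetric] by (auto simp only: enat_add_left_cancel_le)
        then show ?thesis using ord(2) by (simp add: min_absorb1)
      qed
      then show ?thesis unfolding eq
        by (intro cell_in_closed_if_unconstrained[OF \<beta> Z True] ord)
    next
      case False
      then have less: "\<beta> 1 2 + \<beta> 2 1 < \<beta> 2 2 + \<beta> 1 1" by simp
      then have "\<beta> 1 2 + (\<beta> 2 1 - \<beta> 2 2) \<le> \<beta> 1 1"
        unfolding sum[symmetric] using add_left_mono[of "\<beta> 1 1" "\<beta> 1 2 + (\<beta> 2 1 - \<beta> 2 2)" "\<beta> 2 2"]
        by (meson leI not_le order_less_imp_le)
      then have "\<beta> 1 2 + (\<beta> 2 1 - \<beta> 2 2) \<le> fps_ord p" using ord(2) by (simp add: min_absorb2)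
      then show ?thesis unfolding eq
        by (intro cell_in_closed_if_determinantal[OF \<beta> Z less] ord)
    qed
  qed
  have move: "?P {k, m}" if "?P {l, m}" "k < l" "l < 4" "m < 4" "m \<noteq> k" "m \<noteq> l" for k l m
  proof (intro ballI impI)
    fix A :: "univ_field fps mat"
    assume A: "A \<in> chart 2 4 {k, m}" "row_span A \<in> order_locus (generic_order \<beta>)"
    show "row_span A \<in> Z"
    proof (rule chart_inclusion_by_column_move[where \<omega> = "generic_order \<beta>", OF Z(1) _ that(2-6) _ A])
      show "row_span B \<in> Z" if "B \<in> chart 2 4 {l, m}" "row_span B \<in> order_locus (generic_order \<beta>)" for B
        using \<open>?P {l, m}\<close> that by blast
    qed (rule generic_order_mono[OF \<beta>])
  qed
  have comm: "{2, 3} = {3, 2::nat}" "{2, 1} = {1, 2::nat}" by blast+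
  have "?P {1, 3}" by (rule move[OF cell]) simp_all
  moreover have "?P {0, 3}" by (rule move[OF cell]) simp_all
  moreover have 12: "?P {1, 2}" by (rule move[OF cell[unfolded comm(1)]]) simp_all
  moreover have "?P {0, 2}" by (rule move[OF cell[unfolded comm(1)]]) simp_all
  moreover have "?P {0, 1}" by (rule move[OF 12[folded comm(2)]]) simp_all
  ultimately have P: "?P J" if "J \<in> index_sets 2 4" for J
    using cell that unfolding index_sets_2_4 by blast
  show ?thesis
  proof
    fix L assume L: "L \<in> order_locus (generic_order \<beta>)"
    then obtain A where A: "L = row_span A" "has_unit_minor A" by (auto simp: order_locus_def)
    then obtain J where J: "J \<in> index_sets 2 4" "minor J A dvd 1" by (auto simp: has_unit_minor_def)
    obtain B where "B \<in> chart 2 4 J" "row_span B = row_span A"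
      using ex_chart_representative[OF has_unit_minor_carrier[OF A(2)] J] .
    then show "L \<in> Z" using P[OF J(1)] L A(1) by metis
  qed
qed

section \<open>The network for G(2,4)\<close>

lemma network_edges_2_4:
  "network_edges 2 4 = {(Source 1, Inner 1 2), (Source 2, Inner 2 2), (Inner 1 2, Inner 1 1), (Inner 2 2, Inner 2 1),
    (Inner 1 1, Inner 2 1), (Inner 1 2, Inner 2 2), (Inner 2 1, Sink 1), (Inner 2 2, Sink 2)}"
proof -
  have iv: "{1..2::nat} = {1, 2}" by auto
  have lt: "1 \<le> i \<and> i < 2 \<longleftrightarrow> i = 1" "1 \<le> i \<and> i < 2 \<and> P \<longleftrightarrow> i = 1 \<and> P" for i :: nat and P by auto
  have dim: "4 - 2 = (2::nat)" by simp
  have two: "(1::nat) + 1 = 2" by simp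
  have "{(Source i, Inner i 2) | i. i \<in> {1, 2}} = {(Source 1, Inner 1 2), (Source 2, Inner 2 2)}" by blast
  moreover have "{(Inner i (j + 1), Inner i j) | i j. i \<in> {1, 2} \<and> j = 1} =
      {(Inner 1 2, Inner 1 1), (Inner 2 2, Inner 2 1)}" unfolding two[symmetric] by blast
  moreover have "{(Inner i j, Inner (i + 1) j) | i j. i = 1 \<and> j \<in> {1, 2}} =
      {(Inner 1 1, Inner 2 1), (Inner 1 2, Inner 2 2)}" unfolding two[symmetric] by blast
  moreover have "{(Inner 2 j, Sink j) | j. j \<in> {1, 2}} = {(Inner 2 1, Sink 1), (Inner 2 2, Sink 2)}" by blast
  ultimately show ?thesis
    unfolding network_edges_def dim iv lt by (simp only: Un_insert_left Un_empty_left)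
qed

text \<open>
  The network has no cycles, so repeated unfolding enumerates the paths.
\<close>

lemma network_paths_unfold:
  "network_paths k n x y = (if x = y then {[x]} else {}) \<union>
    (\<Union>z\<in>{z. (x, z) \<in> network_edges k n}. Cons x ` network_paths k n z y)" (is "?L = ?R")
proof (intro equalityI subsetI)
  fix p assume p: "p \<in> ?L"
  show "p \<in> ?R"
  proof (cases p)
    case Nil
    then show ?thesis using p by (simp add: network_paths_def)
  next
    case (Cons a q)
    then show ?thesis using p by (cases q) (auto simp: network_paths_def)
  qed
next
  fix p assume "p \<in> ?R"
  then consider "x = y" "p = [x]" | z q where "(x, z) \<in> network_edges k n" "q \<in> network_paths k n z y" "p = x # q"
    by (auto split: if_splits)
  then show "p \<in> ?L"
  proof cases
    case (2 z q)
    then show ?thesis by (cases q) (auto simp: network_paths_def)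
  qed (simp add: network_paths_def)
qed

lemma network_successors:
  "{z. (Source 1, z) \<in> network_edges 2 4} = {Inner 1 2}"
  "{z. (Source 2, z) \<in> network_edges 2 4} = {Inner 2 2}"
  "{z. (Inner 1 2, z) \<in> network_edges 2 4} = {Inner 1 1, Inner 2 2}"
  "{z. (Inner 1 1, z) \<in> network_edges 2 4} = {Inner 2 1}"
  "{z. (Inner 2 2, z) \<in> network_edges 2 4} = {Inner 2 1, Sink 2}"
  "{z. (Inner 2 1, z) \<in> network_edges 2 4} = {Sink 1}"
  "{z. (Sink j, z) \<in> network_edges 2 4} = {}"
  unfolding network_edges_2_4 by auto

lemma network_paths_to_sink:
  "network_paths 2 4 (Sink i) (Sink j) = (if i = j then {[Sink i]} else {})"
  "network_paths 2 4 (Inner 2 1) (Sink j) = (if j = 1 then {[Inner 2 1, Sink 1]} else {})"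
  "network_paths 2 4 (Inner 2 2) (Sink j) =
    (if j = 1 then {[Inner 2 2, Inner 2 1, Sink 1]} else if j = 2 then {[Inner 2 2, Sink 2]} else {})"
  "network_paths 2 4 (Inner 1 1) (Sink j) = (if j = 1 then {[Inner 1 1, Inner 2 1, Sink 1]} else {})"
proof -
  show 1: "network_paths 2 4 (Sink i) (Sink j) = (if i = j then {[Sink i]} else {})" for i j
    by (subst network_paths_unfold) (simp add: network_successors)
  show 2: "network_paths 2 4 (Inner 2 1) (Sink j) = (if j = 1 then {[Inner 2 1, Sink 1]} else {})" for j
    by (subst network_paths_unfold) (simp add: network_successors 1 del: One_nat_def)
  show "network_paths 2 4 (Inner 2 2) (Sink j) =
    (if j = 1 then {[Inner 2 2, Inner 2 1, Sink 1]} else if j = 2 then {[Inner 2 2, Sink 2]} else {})"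
    by (subst network_paths_unfold) (simp add: network_successors 1 2 del: One_nat_def)
  show "network_paths 2 4 (Inner 1 1) (Sink j) = (if j = 1 then {[Inner 1 1, Inner 2 1, Sink 1]} else {})"
    by (subst network_paths_unfold) (simp add: network_successors 2 del: One_nat_def)
qed

lemma network_paths_2_4:
  "network_paths 2 4 (Source 1) (Sink 1) =
    {[Source 1, Inner 1 2, Inner 1 1, Inner 2 1, Sink 1], [Source 1, Inner 1 2, Inner 2 2, Inner 2 1, Sink 1]}"
  "network_paths 2 4 (Source 1) (Sink 2) = {[Source 1, Inner 1 2, Inner 2 2, Sink 2]}"
  "network_paths 2 4 (Source 2) (Sink 1) = {[Source 2, Inner 2 2, Inner 2 1, Sink 1]}"
  "network_paths 2 4 (Source 2) (Sink 2) = {[Source 2, Inner 2 2, Sink 2]}"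
proof -
  have 1: "network_paths 2 4 (Inner 1 2) (Sink j) = Cons (Inner 1 2) ` network_paths 2 4 (Inner 1 1) (Sink j)
      \<union> Cons (Inner 1 2) ` network_paths 2 4 (Inner 2 2) (Sink j)" for j
    by (subst network_paths_unfold) (simp add: network_successors del: One_nat_def)
  have 2: "network_paths 2 4 (Source 1) (Sink j) = Cons (Source 1) ` network_paths 2 4 (Inner 1 2) (Sink j)"
    "network_paths 2 4 (Source 2) (Sink j) = Cons (Source 2) ` network_paths 2 4 (Inner 2 2) (Sink j)" for j
    by (subst network_paths_unfold, simp add: network_successors del: One_nat_def)+
  show "network_paths 2 4 (Source 1) (Sink 1) =
    {[Source 1, Inner 1 2, Inner 1 1, Inner 2 1, Sink 1], [Source 1, Inner 1 2, Inner 2 2, Inner 2 1, Sink 1]}"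
  "network_paths 2 4 (Source 1) (Sink 2) = {[Source 1, Inner 1 2, Inner 2 2, Sink 2]}"
  "network_paths 2 4 (Source 2) (Sink 1) = {[Source 2, Inner 2 2, Inner 2 1, Sink 1]}"
  "network_paths 2 4 (Source 2) (Sink 2) = {[Source 2, Inner 2 2, Sink 2]}"
    unfolding 2 1 network_paths_to_sink by (simp_all add: insert_commute del: One_nat_def)
qed

lemma network_entry_2_4:
  "network_entry 2 4 w 1 1 = w 1 1 + w 1 2 * w 2 1 * w 2 2"
  "network_entry 2 4 w 1 2 = w 1 2 * w 2 2"
  "network_entry 2 4 w 2 1 = w 2 1 * w 2 2"
  "network_entry 2 4 w 2 2 = w 2 2"
  unfolding network_entry_def network_paths_2_4
  by (simp_all add: path_weight_def vertex_weight_def edge_weight_def mult_ac)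

lemma network_minors:
  "minor {0, 1} (network_matrix 2 4 w) = w 1 1 * w 2 2"
  "minor {0, 2} (network_matrix 2 4 w) = w 1 1 + w 1 2 * w 2 1 * w 2 2"
  "minor {0, 3} (network_matrix 2 4 w) = - (w 2 1 * w 2 2)"
  "minor {1, 2} (network_matrix 2 4 w) = w 1 2 * w 2 2"
  "minor {1, 3} (network_matrix 2 4 w) = - w 2 2"
  "minor {2, 3} (network_matrix 2 4 w) = - 1"
proof -
  let ?M = "network_matrix 2 4 w"
  have M: "?M \<in> carrier_mat 2 4" by (simp add: network_matrix_def)
  have entries: "?M $$ (0, 0) = w 1 1 + w 1 2 * w 2 1 * w 2 2" "?M $$ (0, 1) = w 1 2 * w 2 2"
    "?M $$ (1, 0) = w 2 1 * w 2 2" "?M $$ (1, 1) = w 2 2"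
    "?M $$ (0, 2) = 0" "?M $$ (0, 3) = 1" "?M $$ (1, 2) = 1" "?M $$ (1, 3) = 0"
    using network_entry_2_4[of w] by (simp_all add: network_matrix_def numeral_2_eq_2)
  show "minor {0, 1} ?M = w 1 1 * w 2 2" "minor {0, 2} ?M = w 1 1 + w 1 2 * w 2 1 * w 2 2"
    "minor {0, 3} ?M = - (w 2 1 * w 2 2)" "minor {1, 2} ?M = w 1 2 * w 2 2" "minor {1, 3} ?M = - w 2 2"
    "minor {2, 3} ?M = - 1"
    by (simp_all add: minor_pair[OF M] entries algebra_simps del: One_nat_def)
qed

lemma t_pow_add: "t_pow (x + y) = t_pow x * (t_pow y :: 'r::comm_ring_1 fps)"
  by (cases x; cases y) (simp_all add: t_pow_def power_add)

lemma t_pow_nth: "fps_nth (t_pow x * g) p = (if x \<le> enat p then fps_nth g (p - the_enat x) else (0 :: 'r::comm_ring_1))"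
  by (cases x) (auto simp: t_pow_def fps_X_power_mult_nth)

lemma fps_ord_eqI:
  assumes "fps_nth f m \<noteq> 0" "\<And>p. p < m \<Longrightarrow> fps_nth f p = 0"
  shows "fps_ord f = enat m"
proof -
  have "f \<noteq> 0" using assms(1) by (metis fps_zero_nth)
  then show ?thesis using subdegreeI[OF assms] by (simp add: fps_ord_def)
qed

lemma fps_ord_t_pow_sum:
  fixes g h :: "'r::comm_ring_1 fps"
  assumes "fps_nth g 0 \<noteq> 0" "fps_nth h 0 \<noteq> 0" "fps_nth g 0 + fps_nth h 0 \<noteq> 0"
  shows "fps_ord (t_pow x * g + t_pow y * h) = min x y"
proof (cases "min x y")
  case (enat m)
  let ?f = "t_pow x * g + t_pow y * h"
  have "fps_nth ?f m \<noteq> 0"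
    using assms enat by (cases x; cases y) (auto simp: t_pow_nth min_def split: if_splits)
  moreover have "fps_nth ?f p = 0" if "p < m" for p
    using that enat by (cases x; cases y) (auto simp: t_pow_nth min_def split: if_splits)
  ultimately show ?thesis unfolding enat by (rule fps_ord_eqI)
next
  case infinity
  then have "x = \<infinity>" "y = \<infinity>" by (auto simp: min_def split: if_splits)
  then show ?thesis by (simp add: t_pow_def)
qed

lemma fps_ord_t_pow_mult:
  fixes g :: "'r::comm_ring_1 fps"
  assumes "fps_nth g 0 \<noteq> 0"
  shows "fps_ord (t_pow x * g) = x"
proof (cases x)
  case (enat m)
  show ?thesis
    unfolding enat by (rule fps_ord_eqI) (use assms in \<open>simp_all add: t_pow_nth\<close>)
qed (simp add: t_pow_def)

text \<open>
  Each minor is a power of \<open>t\<close> times a product of the series \<open>u i j\<close>, or for \<open>{0, 2}\<close> a sum of two such terms. Setting all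
  transcendentals to 1 shows that no leading coefficient vanishes: it becomes \<open>\<plusminus>1\<close>, or 2 if the two
  terms have the same order.
\<close>

lemma generic_minor_order_eq:
  assumes \<beta>: "plane_partition 2 2 \<beta>" and J: "J \<in> index_sets 2 4"
  shows "generic_minor_order 2 4 \<beta> J = generic_order \<beta> J"
proof -
  note ineq = \<beta>[unfolded plane_partition_2_2]
  define u :: "nat \<Rightarrow> nat \<Rightarrow> (nat \<times> nat \<times> nat) cpoly fps" where "u = generic_series"
  define w where "w = generic_weighting 2 4 \<beta>"
  have w: "w 1 1 = t_pow (\<beta> 1 1) * u 1 1" "w 1 2 = t_pow (\<beta> 1 2 - \<beta> 2 2) * u 1 2"
    "w 2 1 = t_pow (\<beta> 2 1 - \<beta> 2 2) * u 2 1" "w 2 2 = t_pow (\<beta> 2 2) * u 2 2"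
    by (simp_all add: w_def generic_weighting_def weight_exponent_def u_def numeral_2_eq_2)
  define ev :: "(nat \<times> nat \<times> nat) cpoly \<Rightarrow> complex" where "ev = poly_eval (\<lambda>c. c) (\<lambda>_. 1)"
  have ev: "ev (x + y) = ev x + ev y" "ev (x * y) = ev x * ev y" "ev 0 = 0" for x y
    by (simp_all add: ev_def poly_eval_hom[OF comm_ring_hom_id])
  have ev_u: "ev (fps_nth (u i j) 0) = 1" for i j
    by (simp add: ev_def u_def generic_series_def poly_eval_hom[OF comm_ring_hom_id])
  have nonzero: "ev x \<noteq> 0 \<Longrightarrow> x \<noteq> 0" for x using ev(3) by auto
  have prods: "w 1 1 * w 2 2 = t_pow (\<beta> 2 2 + \<beta> 1 1) * (u 1 1 * u 2 2)"
    "w 2 1 * w 2 2 = t_pow (\<beta> 2 1) * (u 2 1 * u 2 2)"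
    "w 1 2 * w 2 2 = t_pow (\<beta> 1 2) * (u 1 2 * u 2 2)"
    "w 1 2 * w 2 1 * w 2 2 = t_pow (\<beta> 1 2 + (\<beta> 2 1 - \<beta> 2 2)) * (u 1 2 * u 2 1 * u 2 2)"
  proof -
    have e: "t_pow (\<beta> 1 2) = t_pow (\<beta> 2 2) * (t_pow (\<beta> 1 2 - \<beta> 2 2) :: (nat \<times> nat \<times> nat) cpoly fps)"
      "t_pow (\<beta> 2 1) = t_pow (\<beta> 2 2) * (t_pow (\<beta> 2 1 - \<beta> 2 2) :: (nat \<times> nat \<times> nat) cpoly fps)"
      using enat_diff_add[of "\<beta> 2 2" "\<beta> 1 2"] enat_diff_add[of "\<beta> 2 2" "\<beta> 2 1"] ineq
      by (simp_all flip: t_pow_add)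
    show "w 1 1 * w 2 2 = t_pow (\<beta> 2 2 + \<beta> 1 1) * (u 1 1 * u 2 2)"
      unfolding w t_pow_add by (simp only: mult_ac)
    show "w 2 1 * w 2 2 = t_pow (\<beta> 2 1) * (u 2 1 * u 2 2)"
      unfolding w e by (simp only: mult_ac)
    show "w 1 2 * w 2 2 = t_pow (\<beta> 1 2) * (u 1 2 * u 2 2)"
      unfolding w e by (simp only: mult_ac)
    show "w 1 2 * w 2 1 * w 2 2 = t_pow (\<beta> 1 2 + (\<beta> 2 1 - \<beta> 2 2)) * (u 1 2 * u 2 1 * u 2 2)"
      unfolding w t_pow_add e(1) by (simp only: mult_ac)
  qed
  have uminus: "fps_ord (- f) = fps_ord f" for f :: "(nat \<times> nat \<times> nat) cpoly fps" by (rule fps_ord_uminus)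
  have units: "fps_nth (u 1 1 * u 2 2) 0 \<noteq> 0" "fps_nth (u 2 1 * u 2 2) 0 \<noteq> 0" "fps_nth (u 1 2 * u 2 2) 0 \<noteq> 0"
    "fps_nth (u 2 2) 0 \<noteq> 0" "fps_nth (u 1 1) 0 \<noteq> 0" "fps_nth (u 1 2 * u 2 1 * u 2 2) 0 \<noteq> 0"
    "fps_nth (u 1 1) 0 + fps_nth (u 1 2 * u 2 1 * u 2 2) 0 \<noteq> 0"
    by (rule nonzero; simp add: ev ev_u fps_mult_nth_0 del: One_nat_def)+
  have "\<forall>J\<in>index_sets 2 4. generic_minor_order 2 4 \<beta> J = generic_order \<beta> J"
    unfolding ball_index_sets_2_4 generic_order_simps generic_minor_order_def w_def[symmetric] network_minors prods uminus
    unfolding w(1,4)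
    by (intro conjI refl fps_ord_t_pow_mult fps_ord_t_pow_sum fps_ord_1 units)
  then show ?thesis using J by blast
qed


section \<open>Closures of contact strata\<close>

text \<open>
  The network matrix with all \<open>u i j\<close> equal to 1 and its two rows exchanged. As \<open>1 + 1 \<noteq> 0\<close>, the two path
  weights in the entry \<open>p\<close> do not cancel.
\<close>

lemma ex_generic_arc:
  assumes \<beta>: "plane_partition 2 2 \<beta>"
  shows "\<exists>A. has_unit_minor A \<and> row_span A \<in> contact_stratum 2 4 \<beta> \<and>
    (\<forall>J\<in>index_sets 2 4. minor_order A J = generic_order \<beta> J)"
proof -
  note ineq = \<beta>[unfolded plane_partition_2_2]
  let ?m = "\<beta> 1 2 + (\<beta> 2 1 - \<beta> 2 2)"
  define p q r s :: "univ_field fps"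
    where "p = t_pow (\<beta> 1 1) + t_pow ?m" and "q = t_pow (\<beta> 1 2)" and "r = t_pow (\<beta> 2 1)" and "s = t_pow (\<beta> 2 2)"
  have two: "(1 :: univ_field) + 1 \<noteq> 0"
  proof
    interpret comm_ring_hom scal by (rule comm_ring_hom_scal)
    assume "(1 :: univ_field) + 1 = 0"
    then have "scal (1 + 1) = scal 0" by (simp only: hom_add hom_one hom_zero)
    then have "(1 :: complex) + 1 = 0" by (rule injD[OF inj_scal])
    then show False by simp
  qed
  have ord_p: "fps_ord p = min (\<beta> 1 1) ?m"
    using fps_ord_t_pow_sum[of 1 1 "\<beta> 1 1" ?m] two unfolding p_def by simp
  have le: "\<beta> 1 2 \<le> min (\<beta> 1 1) ?m" "\<beta> 2 1 \<le> min (\<beta> 1 1) ?m"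
    using ineq enat_le_add_diff[of "\<beta> 2 2" "\<beta> 1 2" "\<beta> 2 1"] by (simp_all del: One_nat_def)
  have sum: "\<beta> 2 2 + ?m = \<beta> 2 1 + \<beta> 1 2"
    using enat_diff_add[of "\<beta> 2 2" "\<beta> 2 1"] ineq by (simp add: add.left_commute add.commute)
  have "r * q - s * p = - t_pow (\<beta> 2 2 + \<beta> 1 1)"
    unfolding p_def q_def r_def s_def distrib_left t_pow_add[symmetric] sum by simp
  then have det: "fps_ord (r * q - s * p) = \<beta> 2 2 + \<beta> 1 1" by simp
  show ?thesis
  proof (intro exI[of _ "cell p q r s"] conjI)
    show "has_unit_minor (cell p q r s)" by (rule cell_has_unit_minor)
    show "row_span (cell p q r s) \<in> contact_stratum 2 4 \<beta>"
      using le det by (intro cell_in_contact_stratum[OF \<beta>]) (simp_all add: ord_p q_def r_def s_def del: One_nat_def)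
    show "\<forall>J\<in>index_sets 2 4. minor_order (cell p q r s) J = generic_order \<beta> J"
      unfolding ball_index_sets_2_4 minor_order_cell generic_order_simps det ord_p
      by (simp add: q_def r_def s_def del: One_nat_def)
  qed
qed

text \<open>
  The order locus is closed and contains the stratum, and every closed set that contains the stratum
  contains the order locus.
\<close>

theorem zariski_closure_contact_stratum:
  assumes "plane_partition 2 2 \<beta>"
  shows "zariski_closure 2 4 (contact_stratum 2 4 \<beta>) = order_locus (generic_order \<beta>)"
  unfolding zariski_closure_def
proof (intro equalityI Inter_lower Inter_greatest CollectI conjI)
  show "zariski_closed 2 4 (order_locus (generic_order \<beta>))" by (rule zariski_closed_order_locus)
  show "contact_stratum 2 4 \<beta> \<subseteq> order_locus (generic_order \<beta>)" by (rule contact_stratum_subset_order_locus)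
  show "order_locus (generic_order \<beta>) \<subseteq> Z"
    if "Z \<in> {Z. zariski_closed 2 4 Z \<and> contact_stratum 2 4 \<beta> \<subseteq> Z}" for Z
    using that order_locus_subset_closed[OF assms] by blast
qed

theorem proposition8p4:
  fixes \<beta> \<beta>' :: "nat \<Rightarrow> nat \<Rightarrow> enat"
  assumes "plane_partition 2 2 \<beta>" and "plane_partition 2 2 \<beta>'"
  shows "zariski_closure 2 4 (contact_stratum 2 4 \<beta>) \<supseteq> zariski_closure 2 4 (contact_stratum 2 4 \<beta>')
           \<longleftrightarrow> pluecker_le 2 4 \<beta> \<beta>'"
proof -
  have le: "pluecker_le 2 4 \<beta> \<beta>' \<longleftrightarrow> (\<forall>J\<in>index_sets 2 4. generic_order \<beta> J \<le> generic_order \<beta>' J)"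
    unfolding pluecker_le_def by (intro ball_cong refl) (simp add: generic_minor_order_eq assms)
  have "order_locus (generic_order \<beta>') \<subseteq> order_locus (generic_order \<beta>) \<longleftrightarrow>
      (\<forall>J\<in>index_sets 2 4. generic_order \<beta> J \<le> generic_order \<beta>' J)"
  proof
    assume sub: "order_locus (generic_order \<beta>') \<subseteq> order_locus (generic_order \<beta>)"
    obtain A where A: "has_unit_minor A" "row_span A \<in> contact_stratum 2 4 \<beta>'"
      "\<forall>J\<in>index_sets 2 4. minor_order A J = generic_order \<beta>' J"
      using ex_generic_arc[OF assms(2)] by blast
    have "row_span A \<in> order_locus (generic_order \<beta>)"
      using A(2) contact_stratum_subset_order_locus sub by blast
    then show "\<forall>J\<in>index_sets 2 4. generic_order \<beta> J \<le> generic_order \<beta>' J"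
      unfolding row_span_in_order_locus_iff[OF A(1)] using A(3) by simp
  next
    assume "\<forall>J\<in>index_sets 2 4. generic_order \<beta> J \<le> generic_order \<beta>' J"
    then show "order_locus (generic_order \<beta>') \<subseteq> order_locus (generic_order \<beta>)"
      unfolding order_locus_def using order_trans by blast
  qed
  then show ?thesis
    unfolding zariski_closure_contact_stratum[OF assms(1)] zariski_closure_contact_stratum[OF assms(2)] le .
qed

end
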